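(* The model-checking problem $\mathrm{MC}(\mathtt{KS},\mathtt{fCTL})$ is in $\textsc{Exp}$: there is a deterministic algorithm that, given a (finite) Kripke structure $\mathcal{K}$ and an $\mathtt{fCTL}$ formula $\Phi$ (with the numbers in frequency constraints encoded in binary), decides whether $\mathcal{K}\models\Phi$ in time exponential in the size of the input.
   Context: Let $AP$ be a finite set of atomic propositions. A Kripke structure is $\mathcal{K}=(S,s_I,E,\lambda)$ with $S$ a finite set of states, $s_I\in S$ the initial state, $E\subseteq S\times S$ and $\lambda:S\to 2^{AP}$. A path is a (finite or infinite) sequence of states whose consecutive pairs are in $E$; a run is an infinite path $\rho$ with $\rho(0)=s_I$ ($\rho(i)$ denotes its $(i+1)$-th state); $\mathtt{Runs}(\mathcal{K})$ is the set of runs. $\mathtt{KS}$ is the class of all Kripke structures. $\mathtt{fCTL}$ formulae are given by $\varphi ::= p \mid \varphi\land\varphi \mid \neg\varphi \mid \mathtt{E}\beta \mid \mathtt{A}\beta$ and $\beta ::= \mathtt{X}\varphi \mid \varphi\,\mathtt{U}^{\frac{n}{m}}\varphi$ with $p\in AP$ and natural numbers $n\le m$, $m>0$. Semantics is over a run $\rho$ and a position $i\in\mathbb{N}$: $(\rho,i)\models p$ iff $p\in\lambda(\rho(i))$; Boolean connectives as usual; $(\rho,i)\models\mathtt{X}\varphi$ iff $(\rho,i+1)\models\varphi$; $(\rho,i)\models\varphi\,\mathtt{U}^{\frac{n}{m}}\psi$ iff $(\rho,i)\models\psi$, or there is $k\ge i$ with $(\rho,k+1)\models\psi$ and $m\cdot|\{j\in[i,k]\mid(\rho,j)\models\varphi\}|\ge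 n\cdot(k-i+1)$; $(\rho,i)\models\mathtt{E}\varphi$ iff there is $\rho'\in\mathtt{Runs}(\mathcal{K})$ with $\rho'(j)=\rho(j)$ for all $j\le i$ and $(\rho',i)\models\varphi$; $\mathtt{A}\varphi\equiv\neg\mathtt{E}\neg\varphi$. A state $s$ satisfies $\varphi$ if there are $\rho\in\mathtt{Runs}(\mathcal{K})$ and $i$ with $\rho(i)=s$ and $(\rho,i)\models\varphi$; $\mathcal{K}\models\varphi$ iff $s_I$ satisfies $\varphi$. The model-checking problem $\mathrm{MC}(\mathfrak{K},\mathcal{L})$: given $\mathcal{K}\in\mathfrak{K}$ and $\varphi\in\mathcal{L}$, decide whether $\mathcal{K}\models\varphi$. The formula size counts numbers in binary. *)

theory Defs
  imports Main
begin

text \<open>A Kripke structure with states 0,...,nst-1, atomic propositions encoded as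
natural numbers, an explicit (finite) edge list and a labelling given by one list
of atoms per state.\<close>

record kripke =
  nst    :: nat
  kinit  :: nat
  kedges :: "(nat \<times> nat) list"
  klabels :: "nat list list"

definition kripke_wf :: "kripke \<Rightarrow> bool" where
  "kripke_wf K \<longleftrightarrow> kinit K < nst K \<and>
     (\<forall>(a, b) \<in> set (kedges K). a < nst K \<and> b < nst K) \<and>
     length (klabels K) = nst K"

definition klab :: "kripke \<Rightarrow> nat \<Rightarrow> nat set" where
  "klab K s = set (klabels K ! s)"

definition is_run :: "kripke \<Rightarrow> (nat \<Rightarrow> nat) \<Rightarrow> bool" where
  "is_run K \<rho> \<longleftrightarrow> \<rho> 0 = kinit K \<and> (\<forall>i. (\<rho> i, \<rho> (Suc i)) \<in> set (kedges K))"

datatype fctl = Prop nat | And fctl fctl | Neg fctl | Ex pfctl | All pfctl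
and pfctl = Next fctl | Until fctl nat nat fctl  \<comment> \<open>Until phi n m psi = phi U^(n/m) psi\<close>

primrec fctl_wf :: "fctl \<Rightarrow> bool" and pfctl_wf :: "pfctl \<Rightarrow> bool" where
  "fctl_wf (Prop p) = True"
| "fctl_wf (And a b) = (fctl_wf a \<and> fctl_wf b)"
| "fctl_wf (Neg a) = fctl_wf a"
| "fctl_wf (Ex b) = pfctl_wf b"
| "fctl_wf (All b) = pfctl_wf b"
| "pfctl_wf (Next a) = fctl_wf a"
| "pfctl_wf (Until a n m b) = (n \<le> m \<and> 0 < m \<and> fctl_wf a \<and> fctl_wf b)"

primrec sat :: "kripke \<Rightarrow> (nat \<Rightarrow> nat) \<Rightarrow> nat \<Rightarrow> fctl \<Rightarrow> bool"
  and psat :: "kripke \<Rightarrow> (nat \<Rightarrow> nat) \<Rightarrow> nat \<Rightarrow> pfctl \<Rightarrow> bool" where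
  "sat K \<rho> i (Prop p) = (p \<in> klab K (\<rho> i))"
| "sat K \<rho> i (And a b) = (sat K \<rho> i a \<and> sat K \<rho> i b)"
| "sat K \<rho> i (Neg a) = (\<not> sat K \<rho> i a)"
| "sat K \<rho> i (Ex b) =
     (\<exists>\<rho>'. is_run K \<rho>' \<and> (\<forall>j\<le>i. \<rho>' j = \<rho> j) \<and> psat K \<rho>' i b)"
| "sat K \<rho> i (All b) =
     (\<forall>\<rho>'. is_run K \<rho>' \<and> (\<forall>j\<le>i. \<rho>' j = \<rho> j) \<longrightarrow> psat K \<rho>' i b)"
| "psat K \<rho> i (Next a) = sat K \<rho> (Suc i) a"
| "psat K \<rho> i (Until a n m b) =
     (sat K \<rho> i b \<or>
      (\<exists>k\<ge>i. sat K \<rho> (Suc k) b \<and>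
         m * card {j \<in> {i..k}. sat K \<rho> j a} \<ge> n * (k - i + 1)))"

definition models :: "kripke \<Rightarrow> fctl \<Rightarrow> bool" where
  "models K \<phi> \<longleftrightarrow> (\<exists>\<rho> i. is_run K \<rho> \<and> \<rho> i = kinit K \<and> sat K \<rho> i \<phi>)"

text \<open>Input alphabet: 1 = bit 0, 2 = bit 1, 3 = end of number, 4 = list item,
5 = end of list, 6..12 = tags of the formula constructors. 0 is the blank.\<close>

fun bits :: "nat \<Rightarrow> nat list" where
  "bits n = (if n = 0 then [] else (n mod 2 + 1) # bits (n div 2))"

definition enc_nat :: "nat \<Rightarrow> nat list" where
  "enc_nat n = bits n @ [3]"

definition enc_list :: "('a \<Rightarrow> nat list) \<Rightarrow> 'a list \<Rightarrow> nat list" where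
  "enc_list f xs = concat (map (\<lambda>x. 4 # f x) xs) @ [5]"

definition enc_kripke :: "kripke \<Rightarrow> nat list" where
  "enc_kripke K = enc_nat (nst K) @ enc_nat (kinit K)
     @ enc_list (\<lambda>(a, b). enc_nat a @ enc_nat b) (kedges K)
     @ enc_list (enc_list enc_nat) (klabels K)"

primrec enc_fctl :: "fctl \<Rightarrow> nat list" and enc_pfctl :: "pfctl \<Rightarrow> nat list" where
  "enc_fctl (Prop p) = 6 # enc_nat p"
| "enc_fctl (And a b) = 7 # enc_fctl a @ enc_fctl b"
| "enc_fctl (Neg a) = 8 # enc_fctl a"
| "enc_fctl (Ex b) = 9 # enc_pfctl b"
| "enc_fctl (All b) = 10 # enc_pfctl b"
| "enc_pfctl (Next a) = 11 # enc_fctl a"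
| "enc_pfctl (Until a n m b) = 12 # enc_nat n @ enc_nat m @ enc_fctl a @ enc_fctl b"

definition enc_input :: "kripke \<Rightarrow> fctl \<Rightarrow> nat list" where
  "enc_input K \<phi> = enc_kripke K @ enc_fctl \<phi>"

record tm =
  tm_nstates :: nat
  tm_nsyms   :: nat
  tm_delta   :: "nat \<Rightarrow> nat \<Rightarrow> nat \<times> nat \<times> int"
  tm_acc     :: nat
  tm_rej     :: nat

text \<open>States are 0..nstates-1 (0 is the start state), tape symbols 0..nsyms-1
(0 is the blank); the transition table is finite by restriction to these ranges.\<close>

definition tm_wf :: "tm \<Rightarrow> bool" where
  "tm_wf M \<longleftrightarrow> 13 \<le> tm_nsyms M \<and> 0 < tm_nstates M \<and>
     tm_acc M < tm_nstates M \<and> tm_rej M < tm_nstates M \<and> tm_acc M \<noteq> tm_rej M \<and>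
     (\<forall>q < tm_nstates M. \<forall>a < tm_nsyms M.
        (case tm_delta M q a of (q', b, d) \<Rightarrow>
           q' < tm_nstates M \<and> b < tm_nsyms M \<and> d \<in> {-1, 0, 1}))"

type_synonym config = "nat \<times> (int \<Rightarrow> nat) \<times> int"

definition tm_step :: "tm \<Rightarrow> config \<Rightarrow> config" where
  "tm_step M c = (case c of (q, tp, h) \<Rightarrow>
     if q = tm_acc M \<or> q = tm_rej M then c
     else (case tm_delta M q (tp h) of (q', b, d) \<Rightarrow> (q', tp(h := b), h + d)))"

definition tm_init :: "nat list \<Rightarrow> config" where
  "tm_init x = (0, \<lambda>i. if 0 \<le> i \<and> i < int (length x) then x ! nat i else 0, 0)"

definition tm_conf :: "tm \<Rightarrow> nat list \<Rightarrow> nat \<Rightarrow> config" where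
  "tm_conf M x t = (tm_step M ^^ t) (tm_init x)"

definition tm_decides_within :: "tm \<Rightarrow> nat list \<Rightarrow> nat \<Rightarrow> bool \<Rightarrow> bool" where
  "tm_decides_within M x T b \<longleftrightarrow>
     (\<exists>t\<le>T. (fst (tm_conf M x t) = tm_acc M \<or> fst (tm_conf M x t) = tm_rej M)
             \<and> (fst (tm_conf M x t) = tm_acc M \<longleftrightarrow> b))"

end

theory Submission
  imports Defs "HOL-Library.Nat_Bijection"
begin

text \<open>The truth of an fCTL formula at a position of a run depends only on the current state. For the
until operators it is decided by a one-counter walk through the graph that gains \<open>m - n\<close> or loses \<open>n\<close> in
each step. By pumping cycles, walks of exponential length suffice, so iterating one counter
threshold per state exponentially often yields the exact answer. These thresholds have polynomially many bits.
The whole computation therefore works with a fixed number of registers whose values are at most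
\<open>W = 2 ^ poly\<close>. A Turing machine may keep such registers in unary, since every operation on
them costs \<open>O(W)\<close> and nested loops up to \<open>W\<close> cost \<open>W ^ O(1) = 2 ^ poly\<close>.\<close>

section \<open>Loop programs and their compilation\<close>

text \<open>The obstacle: \<open>m\<close> is written in binary, so witness lengths and counter
  values may be exponential, while a program has a fixed set of registers. Hence sets, threshold
  vectors and the evaluation stack are each packed into one number. Let \<open>L\<close> be the
  input length. The cycle arguments bound the relevant path length by
  \<open>2 * m * N * N + N\<close>, which is below \<open>2 ^ (5 * L)\<close> because
  \<open>m < 2 ^ L\<close> and \<open>N \<le> L\<close>. In that many steps a counter starting at 0
  stays below \<open>2 ^ (7 * L)\<close> in absolute value. Thresholds with this offset are at most
  \<open>2 ^ (8 * L)\<close>, so base \<open>2 ^ (9 * L)\<close> separates them as digits, and a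
  vector takes at most \<open>9 * L * L\<close> bits. The stack takes \<open>L * L\<close> bits. The
  wall is raised to \<open>L * 2 ^ (L ^ 4)\<close>, which suffices as
  \<open>9 * L * L \<le> L ^ 4\<close> for \<open>L \<ge> 4\<close>. Arithmetic saturates at the
  wall, so correctness amounts to showing that the relevant values stay below it. The two untils
  differ: a finite witness for E must end in a state with an infinite continuation, whereas the
  negation of A is a safety condition whose finite survival must be turned into an infinite
  path.\<close>

text \<open>Register 0 is a wall: no other register can be increased beyond it, so that all values are bounded
by its final value. Register 1 is constantly 0. The loop \<open>For i r c\<close> runs \<open>c\<close> for \<open>i = 0, 1, \<dots>\<close> below
register \<open>r\<close>; its body must not modify \<open>i\<close> and \<open>r\<close>.\<close>

datatype com =
    Inc nat
  | Zero nat
  | Seq com com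
  | IfEq nat nat com com
  | IfSym nat nat com com
  | For nat nat com

type_synonym store = "nat \<Rightarrow> nat"

definition inp :: "nat list \<Rightarrow> nat \<Rightarrow> nat" where
  "inp x p = (if p < length x then x ! p else 0)"

definition bump :: "nat \<Rightarrow> store \<Rightarrow> store" where
  "bump r s = (if r \<noteq> 0 \<and> s r = s 0 then s else s(r := Suc (s r)))"

primrec exec :: "nat list \<Rightarrow> com \<Rightarrow> store \<Rightarrow> store" where
  "exec x (Inc r) s = bump r s"
| "exec x (Zero r) s = s(r := 0)"
| "exec x (Seq c d) s = exec x d (exec x c s)"
| "exec x (IfEq r q c d) s = (if s r = s q then exec x c s else exec x d s)"
| "exec x (IfSym a r c d) s = (if inp x (s r) = a then exec x c s else exec x d s)"
| "exec x (For i r c) s = ((\<lambda>s. bump i (exec x c s)) ^^ s r) (s(i := 0))"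

primrec mods :: "com \<Rightarrow> nat set" where
  "mods (Inc r) = {r}"
| "mods (Zero r) = {r}"
| "mods (Seq c d) = mods c \<union> mods d"
| "mods (IfEq r q c d) = mods c \<union> mods d"
| "mods (IfSym a r c d) = mods c \<union> mods d"
| "mods (For i r c) = insert i (mods c)"

primrec wfc :: "com \<Rightarrow> bool" where
  "wfc (Inc r) \<longleftrightarrow> r \<noteq> 1"
| "wfc (Zero r) \<longleftrightarrow> 2 \<le> r"
| "wfc (Seq c d) \<longleftrightarrow> wfc c \<and> wfc d"
| "wfc (IfEq r q c d) \<longleftrightarrow> wfc c \<and> wfc d"
| "wfc (IfSym a r c d) \<longleftrightarrow> wfc c \<and> wfc d"
| "wfc (For i r c) \<longleftrightarrow> wfc c \<and> 2 \<le> i \<and> i \<notin> mods c \<and> r \<notin> mods c \<and> i \<noteq> r"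

text \<open>The constant 0 in register 1 serves programs as a zero to compare with, and later its
  marker identifies tape cell 0.\<close>

definition bounded :: "store \<Rightarrow> bool" where
  "bounded s \<longleftrightarrow> (\<forall>r. s r \<le> s 0) \<and> s 1 = 0"

lemma bump_other [simp]: "r \<noteq> q \<Longrightarrow> bump q s r = s r"
  by (simp add: bump_def)

lemma exec_frame: "r \<notin> mods c \<Longrightarrow> exec x c s r = s r"
proof (induction c arbitrary: s)
  case (For i q c)
  have "((\<lambda>s. bump i (exec x c s)) ^^ n) t r = t r" for n t
    using For by (induction n) auto
  then show ?case using For by simp
qed auto

lemma bump_bounded:
  "bounded s \<Longrightarrow> r \<noteq> 1 \<Longrightarrow> bounded (bump r s) \<and> s 0 \<le> bump r s 0"
  by (auto simp: bounded_def bump_def le_Suc_eq Suc_le_eq) (metis nat_less_le)+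

lemma zero_bounded: "bounded s \<Longrightarrow> 2 \<le> r \<Longrightarrow> bounded (s(r := 0))"
  by (auto simp: bounded_def)

lemma exec_bounded:
  "wfc c \<Longrightarrow> bounded s \<Longrightarrow> bounded (exec x c s) \<and> s 0 \<le> exec x c s 0"
proof (induction c arbitrary: s)
  case (Seq c d)
  then have "bounded (exec x c s)" "s 0 \<le> exec x c s 0" by auto
  with Seq.IH(2)[of "exec x c s"] Seq.prems show ?case by auto
next
  case (For i q c)
  define z where "z = s(i := 0)"
  have z: "bounded z" "z 0 = s 0" unfolding z_def using For.prems by (auto intro: zero_bounded)
  have "bounded (((\<lambda>s. bump i (exec x c s)) ^^ n) z)
      \<and> z 0 \<le> ((\<lambda>s. bump i (exec x c s)) ^^ n) z 0" for n
  proof (induction n)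
    case 0
    then show ?case using z by simp
  next
    case (Suc n)
    define u where "u = ((\<lambda>s. bump i (exec x c s)) ^^ n) z"
    have "bounded (exec x c u)" "z 0 \<le> exec x c u 0"
      using For.IH[of u] For.prems Suc by (auto simp: u_def[symmetric])
    with bump_bounded[of "exec x c u" i] For.prems show ?case
      by (auto simp: u_def[symmetric])
  qed
  with z show ?case by (simp add: z_def[symmetric])
qed (auto simp: bump_bounded zero_bounded)

text \<open>\<open>G k\<close> is the store before iteration \<open>k\<close>. The counter really
  equals \<open>k\<close>: the loop bound never exceeds the wall and the wall never shrinks, so no
  increment of \<open>i\<close> is swallowed by saturation.\<close>

lemma For_unroll:
  assumes "wfc (For i r c)" "bounded s"
  obtains G where "exec x (For i r c) s = G (s r)" "G 0 = s(i := 0)"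
    "\<And>k. G (Suc k) = bump i (exec x c (G k))" "\<And>k. bounded (G k)"
    "\<And>k. k \<le> s r \<Longrightarrow> G k i = k" "\<And>k q. q \<notin> mods c \<Longrightarrow> q \<noteq> i \<Longrightarrow> G k q = s q"
proof -
  define z where "z = s(i := 0)"
  define G where "G k = ((\<lambda>s. bump i (exec x c s)) ^^ k) z" for k
  have G0: "G 0 = z" and GS: "G (Suc k) = bump i (exec x c (G k))" for k
    by (simp_all add: G_def)
  have wf: "wfc c" "2 \<le> i" "i \<notin> mods c" "r \<notin> mods c" "i \<noteq> r" using assms by auto
  have z: "bounded z" "z i = 0" "\<And>q. q \<noteq> i \<Longrightarrow> z q = s q"
    unfolding z_def using wf by (auto intro!: zero_bounded assms)
  have bnd: "bounded (G k)" for k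
  proof (induction k)
    case 0
    then show ?case by (simp add: G0 z)
  next
    case (Suc k)
    then have "bounded (exec x c (G k))" using exec_bounded wf by blast
    then show ?case using bump_bounded[of _ i] wf by (simp add: GS)
  qed
  have fr: "G k q = s q" if "q \<notin> mods c" "q \<noteq> i" for k q
    by (induction k) (use that z in \<open>simp_all add: G0 GS exec_frame\<close>)
  have "k \<le> s r \<Longrightarrow> G k i = k" for k
  proof (induction k)
    case 0
    then show ?case by (simp add: G0 z)
  next
    case (Suc k)
    have "s r \<le> G k 0" using bnd[of k] fr[of r k] wf unfolding bounded_def by metis
    also have "\<dots> \<le> exec x c (G k) 0" using exec_bounded[of c "G k" x] bnd wf by auto
    finally have "k < exec x c (G k) 0" using Suc by simp
    moreover have "exec x c (G k) i = k" using Suc wf by (simp add: exec_frame)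
    ultimately show ?case by (simp add: GS bump_def)
  qed
  with bnd fr show thesis by (intro that[of G]) (simp_all add: G_def z_def)
qed

section \<open>Jump code and the running time of compiled programs\<close>

datatype ins = IInc nat | IZero nat | IEq nat nat | ISym nat nat

text \<open>An instruction comes with two jump targets; \<^const>\<open>IInc\<close> and \<^const>\<open>IZero\<close> use the first only.\<close>

type_synonym code = "(ins \<times> nat \<times> nat) list"

definition istep :: "nat list \<Rightarrow> code \<Rightarrow> nat \<times> store \<Rightarrow> nat \<times> store" where
  "istep x P c = (case c of (pc, s) \<Rightarrow> case P ! pc of (op, t, f) \<Rightarrow>
     (case op of
        IInc r \<Rightarrow> (t, bump r s)
      | IZero r \<Rightarrow> (t, s(r := 0))
      | IEq r q \<Rightarrow> (if s r = s q then t else f, s)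
      | ISym a r \<Rightarrow> (if inp x (s r) = a then t else f, s)))"

inductive steps :: "nat list \<Rightarrow> code \<Rightarrow> nat \<Rightarrow> nat \<times> store \<Rightarrow> nat \<times> store \<Rightarrow> bool"
  for x P where
  steps_0: "steps x P 0 c c"
| steps_Suc: "fst c < length P \<Longrightarrow> steps x P t (istep x P c) c' \<Longrightarrow> steps x P (Suc t) c c'"

lemma steps_trans: "steps x P t c c' \<Longrightarrow> steps x P u c' c'' \<Longrightarrow> steps x P (t + u) c c''"
  by (induction rule: steps.induct) (auto intro: steps.intros)

primrec csize :: "com \<Rightarrow> nat" where
  "csize (Inc r) = 1"
| "csize (Zero r) = 1"
| "csize (Seq c d) = csize c + csize d"
| "csize (IfEq r q c d) = Suc (csize c + csize d)"
| "csize (IfSym a r c d) = Suc (csize c + csize d)"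
| "csize (For i r c) = csize c + 3"

text \<open>\<open>compile c b e\<close> is code placed at address \<open>b\<close> that leaves to address \<open>e\<close>.\<close>

primrec compile :: "com \<Rightarrow> nat \<Rightarrow> nat \<Rightarrow> code" where
  "compile (Inc r) b e = [(IInc r, e, e)]"
| "compile (Zero r) b e = [(IZero r, e, e)]"
| "compile (Seq c d) b e = compile c b (b + csize c) @ compile d (b + csize c) e"
| "compile (IfEq r q c d) b e =
     (IEq r q, Suc b, Suc b + csize c) # compile c (Suc b) e @ compile d (Suc b + csize c) e"
| "compile (IfSym a r c d) b e =
     (ISym a r, Suc b, Suc b + csize c) # compile c (Suc b) e @ compile d (Suc b + csize c) e"
| "compile (For i r c) b e =
     (IZero i, b + 1, b + 1) # (IEq i r, e, b + 3) # (IInc i, b + 1, b + 1) # compile c (b + 3) (b + 2)"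

lemma length_compile [simp]: "length (compile c b e) = csize c"
  by (induction c arbitrary: b e) auto

definition seg :: "code \<Rightarrow> nat \<Rightarrow> code \<Rightarrow> bool" where
  "seg P b c \<longleftrightarrow> (\<exists>u v. P = u @ c @ v \<and> length u = b)"

lemma seg_append: "seg P b (c @ d) \<Longrightarrow> seg P b c \<and> seg P (b + length c) d"
proof -
  assume "seg P b (c @ d)"
  then obtain u v where "P = u @ (c @ d) @ v" "length u = b" unfolding seg_def by blast
  then have "P = u @ c @ (d @ v)" "P = (u @ c) @ d @ v" "length u = b" "length (u @ c) = b + length c"
    by simp_all
  then show ?thesis unfolding seg_def by blast
qed

lemma seg_Cons: "seg P b (i # c) \<Longrightarrow> b < length P \<and> P ! b = i \<and> seg P (Suc b) c"
proof -
  assume "seg P b (i # c)"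
  then obtain u v where uv: "P = u @ (i # c) @ v" "length u = b" unfolding seg_def by blast
  then have "P = (u @ [i]) @ c @ v" "length (u @ [i]) = Suc b" by simp_all
  then have "seg P (Suc b) c" unfolding seg_def by blast
  with uv show ?thesis by (auto simp: nth_append)
qed

text \<open>Sequential composition adds running times and adds sizes in the exponent; this
  inequality reconciles the two.\<close>

lemma pow_add_le:
  fixes X :: nat assumes "2 \<le> X" "0 < a" "0 < b" shows "X ^ a + X ^ b \<le> X ^ (a + b)"
proof -
  have "2 \<le> X ^ a" "2 \<le> X ^ b"
    using assms self_le_power[of X a] self_le_power[of X b] by linarith+
  then obtain p q where "X ^ a = p + 2" "X ^ b = q + 2"
    by (metis add.commute le_Suc_ex)
  then show ?thesis by (simp add: power_add algebra_simps)
qed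

text \<open>Pays for the test instruction of a branch with its one extra unit of size.\<close>

lemma Suc_le_pow:
  fixes X :: nat assumes "t \<le> X ^ a" "2 \<le> X" "a \<le> b" shows "Suc t \<le> X ^ Suc b"
proof -
  have "t \<le> X ^ b" using assms by (meson le_trans numeral_le_iff one_le_numeral power_increasing)
  moreover have "1 \<le> X ^ b" using assms by simp
  moreover have "2 * X ^ b \<le> X ^ Suc b" using assms by simp
  ultimately show ?thesis by linarith
qed

lemma csize_pos: "0 < csize c" by (induction c) auto

text \<open>A loop runs at most as often as the wall is high, and the wall only grows, so its final
  value bounds every factor; the exponent is the syntactic size, a constant for a fixed program.
  Adding 5 makes the base large enough to absorb constant overheads.\<close>

lemma compile_correct:
  "wfc c \<Longrightarrow> bounded s \<Longrightarrow> seg P b (compile c b e) \<Longrightarrow>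
   \<exists>t \<le> (exec x c s 0 + 5) ^ csize c. steps x P t (b, s) (e, exec x c s)"
proof (induction c arbitrary: s b e)
  case (Inc r)
  then have "steps x P (Suc 0) (b, s) (e, exec x (Inc r) s)"
    by (auto dest!: seg_Cons simp: istep_def intro!: steps.intros)
  then show ?case by (intro exI[of _ "Suc 0"]) auto
next
  case (Zero r)
  then have "steps x P (Suc 0) (b, s) (e, exec x (Zero r) s)"
    by (auto dest!: seg_Cons simp: istep_def intro!: steps.intros)
  moreover have "Suc 0 \<le> (exec x (Zero r) s 0 + 5) ^ csize (Zero r)" by simp
  ultimately show ?case by blast
next
  case (Seq c d)
  let ?s = "exec x c s"
  have sg: "seg P b (compile c b (b + csize c))" "seg P (b + csize c) (compile d (b + csize c) e)"
    using Seq.prems(3) by (auto dest: seg_append)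
  have b: "bounded ?s" using Seq.prems exec_bounded by auto
  obtain t1 where t1: "t1 \<le> (?s 0 + 5) ^ csize c" "steps x P t1 (b, s) (b + csize c, ?s)"
    using Seq.IH(1)[OF _ _ sg(1)] Seq.prems by auto
  obtain t2 where t2: "t2 \<le> (exec x d ?s 0 + 5) ^ csize d"
    "steps x P t2 (b + csize c, ?s) (e, exec x d ?s)"
    using Seq.IH(2)[OF _ b sg(2)] Seq.prems by auto
  have "?s 0 \<le> exec x d ?s 0" using exec_bounded[of d ?s] b Seq.prems by auto
  then have "t1 \<le> (exec x d ?s 0 + 5) ^ csize c"
    using t1(1) by (meson add_le_mono1 order_trans power_mono zero_le)
  with t2 have "t1 + t2 \<le> (exec x d ?s 0 + 5) ^ (csize c + csize d)"
    using pow_add_le[of "exec x d ?s 0 + 5" "csize c" "csize d"] csize_pos[of c] csize_pos[of d] by simp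
  with steps_trans[OF t1(2) t2(2)] show ?case by auto
next
  case (IfEq r q c d)
  let ?c = "if s r = s q then c else d" and ?b = "if s r = s q then Suc b else Suc b + csize c"
  have sg: "b < length P" "P ! b = (IEq r q, Suc b, Suc b + csize c)"
    "seg P (Suc b) (compile c (Suc b) e)" "seg P (Suc b + csize c) (compile d (Suc b + csize c) e)"
    using IfEq.prems(3) by (auto dest!: seg_Cons seg_append)
  have "\<exists>t \<le> (exec x ?c s 0 + 5) ^ csize ?c. steps x P t (?b, s) (e, exec x ?c s)"
    using IfEq.IH(1)[OF _ _ sg(3)] IfEq.IH(2)[OF _ _ sg(4)] IfEq.prems by auto
  then obtain t where t: "t \<le> (exec x ?c s 0 + 5) ^ csize ?c" "steps x P t (?b, s) (e, exec x ?c s)"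
    by blast
  have "Suc t \<le> (exec x ?c s 0 + 5) ^ Suc (csize c + csize d)"
    using t(1) by (rule Suc_le_pow) auto
  moreover have "steps x P (Suc t) (b, s) (e, exec x ?c s)"
    using sg t(2) by (intro steps_Suc) (auto simp: istep_def)
  ultimately show ?case by (intro exI[of _ "Suc t"]) auto
next
  case (IfSym a r c d)
  let ?c = "if inp x (s r) = a then c else d" and ?b = "if inp x (s r) = a then Suc b else Suc b + csize c"
  have sg: "b < length P" "P ! b = (ISym a r, Suc b, Suc b + csize c)"
    "seg P (Suc b) (compile c (Suc b) e)" "seg P (Suc b + csize c) (compile d (Suc b + csize c) e)"
    using IfSym.prems(3) by (auto dest!: seg_Cons seg_append)
  have "\<exists>t \<le> (exec x ?c s 0 + 5) ^ csize ?c. steps x P t (?b, s) (e, exec x ?c s)"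
    using IfSym.IH(1)[OF _ _ sg(3)] IfSym.IH(2)[OF _ _ sg(4)] IfSym.prems by auto
  then obtain t where t: "t \<le> (exec x ?c s 0 + 5) ^ csize ?c" "steps x P t (?b, s) (e, exec x ?c s)"
    by blast
  have "Suc t \<le> (exec x ?c s 0 + 5) ^ Suc (csize c + csize d)"
    using t(1) by (rule Suc_le_pow) auto
  moreover have "steps x P (Suc t) (b, s) (e, exec x ?c s)"
    using sg t(2) by (intro steps_Suc) (auto simp: istep_def)
  ultimately show ?case by (intro exI[of _ "Suc t"]) auto
next
  case (For i r c)
  have sg: "b + 2 < length P" "P ! b = (IZero i, b + 1, b + 1)" "P ! (b + 1) = (IEq i r, e, b + 3)"
    "P ! (b + 2) = (IInc i, b + 1, b + 1)" "seg P (b + 3) (compile c (b + 3) (b + 2))"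
    using For.prems(3) by (auto dest!: seg_Cons simp: numeral_2_eq_2 numeral_3_eq_3)
  define z where "z = s(i := 0)"
  obtain G where ex: "exec x (For i r c) s = G (s r)" and G0: "G 0 = z"
    and GS: "\<And>k. G (Suc k) = bump i (exec x c (G k))" and bnd: "\<And>k. bounded (G k)"
    and idx: "\<And>k. k \<le> s r \<Longrightarrow> G k i = k"
    and fr: "\<And>k q. q \<notin> mods c \<Longrightarrow> q \<noteq> i \<Longrightarrow> G k q = s q"
    unfolding z_def by (rule For_unroll[OF For.prems(1,2)]) blast
  have wf: "wfc c" "2 \<le> i" "i \<notin> mods c" "r \<notin> mods c" "i \<noteq> r" using For.prems by auto
  have inv: "bounded (G k) \<and> G k r = s r" for k using bnd fr wf by auto
  have mono1: "exec x c (G k) 0 \<le> G (Suc k) 0 \<and> G k 0 \<le> G (Suc k) 0" for k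
    using exec_bounded[of c "G k" x] inv[of k] wf by (simp add: GS)
  have mono: "k \<le> l \<Longrightarrow> G k 0 \<le> G l 0" for k l
    by (rule lift_Suc_mono_le[of "\<lambda>k. G k 0"]) (use mono1 in auto)
  define X where "X = G (s r) 0 + 5"
  have iter: "k \<le> s r \<Longrightarrow> \<exists>t \<le> k * (X ^ csize c + 2). steps x P t (b + 1, z) (b + 1, G k)" for k
  proof (induction k)
    case 0
    then show ?case by (auto simp: G0 intro: steps_0)
  next
    case (Suc k)
    then obtain t where t: "t \<le> k * (X ^ csize c + 2)" "steps x P t (b + 1, z) (b + 1, G k)"
      by auto
    obtain u where u: "u \<le> (exec x c (G k) 0 + 5) ^ csize c"
       "steps x P u (b + 3, G k) (b + 2, exec x c (G k))"
      using For.IH[OF wf(1) _ sg(5)] inv by blast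
    have "exec x c (G k) 0 + 5 \<le> X" using mono[of "Suc k" "s r"] mono1[of k] Suc.prems unfolding X_def by simp
    then have u1: "u \<le> X ^ csize c" using u(1) by (meson order_trans power_mono zero_le)
    have "G k i \<noteq> G k r" using idx[of k] inv[of k] Suc.prems by simp
    then have "steps x P (Suc 0) (b + 1, G k) (b + 3, G k)"
      using sg by (intro steps_Suc) (auto simp: istep_def intro: steps_0)
    moreover have "steps x P (Suc 0) (b + 2, exec x c (G k)) (b + 1, G (Suc k))"
      using sg by (intro steps_Suc) (auto simp: istep_def GS intro: steps_0)
    ultimately have "steps x P (t + (Suc 0 + (u + Suc 0))) (b + 1, z) (b + 1, G (Suc k))"
      using t u by (blast intro: steps_trans)
    moreover have "t + (Suc 0 + (u + Suc 0)) \<le> Suc k * (X ^ csize c + 2)" using t u1 by simp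
    ultimately show ?case by blast
  qed
  obtain t where t: "t \<le> s r * (X ^ csize c + 2)" "steps x P t (b + 1, z) (b + 1, G (s r))"
    using iter[of "s r"] by auto
  have "steps x P (Suc 0) (b, s) (b + 1, z)"
    using sg by (intro steps_Suc) (auto simp: istep_def z_def[symmetric] intro: steps_0)
  moreover have "steps x P (Suc 0) (b + 1, G (s r)) (e, G (s r))"
    using sg idx[of "s r"] inv[of "s r"] by (intro steps_Suc) (auto simp: istep_def intro: steps_0)
  ultimately have st: "steps x P (Suc 0 + (t + Suc 0)) (b, s) (e, G (s r))"
    using t(2) by (blast intro: steps_trans)
  have sX: "s r + 5 \<le> X" using inv[of "s r"] unfolding X_def bounded_def by (metis add_le_mono1)
  define Y where "Y = X ^ csize c"
  have Y: "1 \<le> Y" unfolding Y_def X_def by simp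
  have "Suc 0 + (t + Suc 0) \<le> s r * (Y + 2) + 2" using t(1) Y_def by simp
  also have "\<dots> \<le> X * (3 * Y)"
  proof -
    have "s r * (Y + 2) \<le> s r * (3 * Y)" using Y by (intro mult_left_mono) auto
    moreover have "s r * (3*Y) + 5 * (3 * Y) \<le> X * (3 * Y)" using sX by (metis add_mult_distrib mult_le_mono1)
    ultimately show ?thesis using Y by linarith
  qed
  \<comment> \<open>\<open>3 \<le> X\<close> absorbs the constant; the next factor \<open>X\<close>
    is slack that brings the exponent up to \<open>csize c + 3\<close>.\<close>
  also have "\<dots> \<le> X * (X * Y)" using sX by (intro mult_left_mono mult_right_mono) auto
  also have "\<dots> \<le> X * (X * (X * Y))" using sX by (intro mult_left_mono) auto
  finally have "Suc 0 + (t + Suc 0) \<le> X ^ (csize c + 3)"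
    by (simp add: Y_def power_add numeral_3_eq_3 mult_ac)
  with st show ?case unfolding X_def ex by (intro exI[of _ "Suc 0 + (t + Suc 0)"]) auto
qed

section \<open>Simulation by a Turing machine\<close>

text \<open>Registers are kept in unary: register \<open>r\<close> holds \<open>j\<close> if tape cell \<open>j\<close> carries the marker \<open>r\<close>, next to
the input symbol of that cell. The markers of a cell form the binary digits of a number.\<close>

definition marks :: "nat \<Rightarrow> store \<Rightarrow> nat \<Rightarrow> nat set" where
  "marks R s j = {r. r < R \<and> s r = j}"

text \<open>There are 13 input symbols including the blank, so \<open>mod\<close> and
  \<open>div\<close> recover symbol and marker set. A cell outside the input without markers gets
  code 0, the blank of the machine.\<close>

definition tape :: "nat list \<Rightarrow> (nat \<Rightarrow> nat set) \<Rightarrow> int \<Rightarrow> nat" where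
  "tape x F i = (if i < 0 then 0 else inp x (nat i) + 13 * set_encode (F (nat i)))"

text \<open>State \<open>3 * pc + 2\<close> scans rightwards for the registers of the instruction at \<open>pc\<close>,
\<open>3 * pc + 3\<close> completes a modification, and \<open>3 * pc + 4\<close> moves back to cell 0 and continues at \<open>pc\<close>.
State 0 puts all markers but that of the wall into cell 0, and state 1 puts the wall behind the input.\<close>

primrec run_act :: "ins \<Rightarrow> nat \<Rightarrow> nat \<Rightarrow> nat \<Rightarrow> nat \<Rightarrow> nat set \<Rightarrow> nat \<times> nat set \<times> int" where
  "run_act (IInc r) t f q a A =
     (if r \<notin> A then (q, A, 1)
      else if r \<noteq> 0 \<and> 0 \<in> A then (3 * t + 4, A, 0) else (q + 1, A - {r}, 1))"
| "run_act (IZero r) t f q a A = (if r \<notin> A then (q, A, 1) else (q + 1, A - {r}, 0))"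
| "run_act (IEq r r') t f q a A =
     (if r \<in> A \<and> r' \<in> A then (3 * t + 4, A, 0)
      else if r \<in> A \<or> r' \<in> A then (3 * f + 4, A, 0) else (q, A, 1))"
| "run_act (ISym b r) t f q a A =
     (if r \<notin> A then (q, A, 1) else ((if a = b then 3 * t + 4 else 3 * f + 4), A, 0))"

primrec mid_act :: "ins \<Rightarrow> nat \<Rightarrow> nat \<Rightarrow> nat set \<Rightarrow> nat \<times> nat set \<times> int" where
  "mid_act (IInc r) t q A = (3 * t + 4, insert r A, 0)"
| "mid_act (IZero r) t q A = (if 1 \<in> A then (3 * t + 4, insert r A, 0) else (q, A, -1))"
| "mid_act (IEq r r') t q A = (q, A, 0)"
| "mid_act (ISym b r) t q A = (q, A, 0)"

definition act :: "nat \<Rightarrow> code \<Rightarrow> nat \<Rightarrow> nat \<Rightarrow> nat set \<Rightarrow> nat \<times> nat set \<times> int" where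
  "act R P q a A =
    (if q = 0 then (1, {1..<R}, 1)
     else if q = 1 then (if a = 0 then (4, {0}, 0) else (1, A, 1))
     else let pc = (q - 2) div 3; ph = (q - 2) mod 3 in
       if ph = 2 then (if 1 \<in> A then (3 * pc + 2, A, 0) else (q, A, -1))
       else if length P \<le> pc then (q, A, 0)
       else case P ! pc of (op, t, f) \<Rightarrow>
         if ph = 0 then run_act op t f q a A else mid_act op t q A)"

text \<open>Intersecting with \<open>{..<R}\<close> keeps every written symbol inside the finite
  alphabet, whatever the code contains.\<close>

definition delta :: "nat \<Rightarrow> code \<Rightarrow> nat \<Rightarrow> nat \<Rightarrow> nat \<times> nat \<times> int" where
  "delta R P q b = (case act R P q (b mod 13) (set_decode (b div 13)) of
     (q', B, d) \<Rightarrow> (q', b mod 13 + 13 * set_encode (B \<inter> {..<R}), d))"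

text \<open>Summing all jump targets is a crude way to exceed each of them.\<close>

definition tgts :: "code \<Rightarrow> nat" where
  "tgts P = length P + 2 + sum_list (map (\<lambda>(op, t, f). t + f) P)"

text \<open>Reaching address \<open>length P\<close> means acceptance, reaching \<open>length P + 1\<close> rejection.\<close>

definition machine :: "nat \<Rightarrow> code \<Rightarrow> tm" where
  "machine R P = \<lparr>tm_nstates = 3 * tgts P + 5, tm_nsyms = 13 * 2 ^ R, tm_delta = delta R P,
     tm_acc = 3 * length P + 2, tm_rej = 3 * (length P + 1) + 2\<rparr>"

lemma act_eq:
  assumes "q = 3 * pc + ph + 2" "ph < 3"
  shows "act R P q a A =
    (if ph = 2 then (if 1 \<in> A then (3 * pc + 2, A, 0) else (q, A, -1))
     else if length P \<le> pc then (q, A, 0)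
     else case P ! pc of (op, t, f) \<Rightarrow>
       if ph = 0 then run_act op t f q a A else mid_act op t q A)"
proof -
  have "q - 2 = ph + 3 * pc" using assms(1) by simp
  then have "(q - 2) div 3 = pc" "(q - 2) mod 3 = ph" using assms(2) by simp_all
  moreover have "q \<noteq> 0" "q \<noteq> 1" using assms(1) by auto
  ultimately show ?thesis by (simp only: act_def Let_def if_False)
qed

lemma set_encode_less: "A \<subseteq> {..<R} \<Longrightarrow> set_encode A < 2 ^ R"
proof -
  assume "A \<subseteq> {..<R}"
  then have "set_encode A \<le> (\<Sum>i<R. 2 ^ i)"
    unfolding set_encode_def by (intro sum_mono2) auto
  also have "\<dots> < (2::nat) ^ R" by (induction R) auto
  finally show ?thesis .
qed

lemma tgts_le: "(op, t, f) \<in> set P \<Longrightarrow> t < tgts P \<and> f < tgts P"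
  using member_le_sum_list[of "t + f" "map (\<lambda>(op, t, f). t + f) P"]
  by (force simp: tgts_def)

lemma machine_wf: "2 \<le> R \<Longrightarrow> tm_wf (machine R P)"
proof -
  assume "2 \<le> R"
  have "case delta R P q a of (q', b, d) \<Rightarrow>
      q' < 3 * tgts P + 5 \<and> b < 13 * 2 ^ R \<and> d \<in> {-1, 0, 1}"
    if q: "q < 3 * tgts P + 5" for q a
  proof -
    obtain q' B d where A: "act R P q (a mod 13) (set_decode (a div 13)) = (q', B, d)"
      by (cases "act R P q (a mod 13) (set_decode (a div 13))") auto
    have "q' < 3 * tgts P + 5 \<and> d \<in> {-1, 0, 1}"
    proof (cases "q < 2")
      case True
      then show ?thesis using A by (auto simp: act_def less_2_cases_iff split: if_splits)
    next
      case False
      define pc ph where "pc = (q - 2) div 3" and "ph = (q - 2) mod 3"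
      have q2: "q = 3 * pc + ph + 2" "ph < 3" using False unfolding pc_def ph_def by simp_all
      show ?thesis
      proof (cases "ph = 2 \<or> length P \<le> pc")
        case True
        then show ?thesis using A q q2 False
          by (auto simp: act_def pc_def[symmetric] ph_def[symmetric] split: if_splits)
      next
        case F2: False
        obtain op t f where P: "P ! pc = (op, t, f)" by (cases "P ! pc") auto
        have t: "t < tgts P" "f < tgts P" using F2 P tgts_le[of op t f P] nth_mem[of pc P] by auto
        have "pc < tgts P" using F2 by (simp add: tgts_def)
        then have q3: "q + 1 < 3 * tgts P + 5" using q2 by simp
        show ?thesis using A q q2 False F2 P t q3
          by (cases op) (auto simp: act_def pc_def[symmetric] ph_def[symmetric] split: if_splits)
      qed
    qed
    moreover have "a mod 13 + 13 * set_encode (B \<inter> {..<R}) < 13 * 2 ^ R"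
    proof -
      have "set_encode (B \<inter> {..<R}) + 1 \<le> 2 ^ R" using set_encode_less[of "B \<inter> {..<R}" R] by simp
      then have "13 * set_encode (B \<inter> {..<R}) + 13 \<le> 13 * 2 ^ R" by linarith
      moreover have "a mod 13 < 13" by simp
      ultimately show ?thesis by linarith
    qed
    ultimately show ?thesis using A by (simp add: delta_def)
  qed
  moreover have "(13::nat) \<le> 13 * 2 ^ R" by simp
  ultimately show ?thesis unfolding tm_wf_def machine_def by (auto simp: tgts_def)
qed

section \<open>Runs of the simulating machine\<close>

definition reach :: "tm \<Rightarrow> nat \<Rightarrow> config \<Rightarrow> config \<Rightarrow> bool" where
  "reach M t c c' \<longleftrightarrow> (tm_step M ^^ t) c = c'"

lemma reach_trans: "reach M t c c' \<Longrightarrow> reach M u c' c'' \<Longrightarrow> reach M (t + u) c c''"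
  by (auto simp: reach_def funpow_add add.commute[of t u])

lemma reach_0: "reach M 0 c c" by (simp add: reach_def)

definition rused :: "ins \<Rightarrow> nat set" where
  "rused op = (case op of IInc r \<Rightarrow> {r} | IZero r \<Rightarrow> {r} | IEq r q \<Rightarrow> {r, q} | ISym a r \<Rightarrow> {r})"

definition wf_ins :: "nat \<Rightarrow> ins \<Rightarrow> bool" where
  "wf_ins R op \<longleftrightarrow> rused op \<subseteq> {..<R} \<and> (\<forall>r. op = IInc r \<longrightarrow> r \<noteq> 1) \<and> (\<forall>r. op = IZero r \<longrightarrow> 2 \<le> r)"

context
  fixes R :: nat and P :: code and x :: "nat list"
  assumes R: "2 \<le> R" and x13: "\<And>a. a \<in> set x \<Longrightarrow> 0 < a \<and> a < 13"
begin

lemma inp_less: "inp x j < 13"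
  using x13 by (auto simp: inp_def)

lemma reach_1:
  assumes "q \<noteq> 3 * length P + 2" "q \<noteq> 3 * (length P + 1) + 2"
    and F: "F j \<subseteq> {..<R}" and a: "act R P q (inp x j) (F j) = (q', B, d)" and B: "B \<subseteq> {..<R}"
  shows "reach (machine R P) 1 (q, tape x F, int j) (q', tape x (F(j := B)), int j + d)"
proof -
  have fin: "finite (F j)" using F finite_subset by blast
  have "tape x F (int j) = inp x j + 13 * set_encode (F j)" by (simp add: tape_def)
  then have "delta R P q (tape x F (int j)) = (q', inp x j + 13 * set_encode B, d)"
    using a B fin inp_less[of j] by (simp add: delta_def Int_absorb2)
  moreover have "(tape x F)(int j := inp x j + 13 * set_encode B) = tape x (F(j := B))"
    by (rule ext) (auto simp: tape_def)
  ultimately show ?thesis using assms(1,2) by (simp add: reach_def tm_step_def machine_def)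
qed

lemma reach_stay:
  assumes "q \<noteq> 3 * length P + 2" "q \<noteq> 3 * (length P + 1) + 2"
    and "F j \<subseteq> {..<R}" "act R P q (inp x j) (F j) = (q', B, 0)" "B \<subseteq> {..<R}"
  shows "reach (machine R P) 1 (q, tape x F, int j) (q', tape x (F(j := B)), int j)"
  using reach_1[of q F j q' B 0] assms by simp

lemma reach_right:
  assumes "q \<noteq> 3 * length P + 2" "q \<noteq> 3 * (length P + 1) + 2"
    and "\<And>i. i < d \<Longrightarrow> F (j + i) \<subseteq> {..<R} \<and> act R P q (inp x (j + i)) (F (j + i)) = (q, F (j + i), 1)"
  shows "reach (machine R P) d (q, tape x F, int j) (q, tape x F, int (j + d))"
  using assms(3)
proof (induction d)
  case 0
  then show ?case by (simp add: reach_0)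
next
  case (Suc d)
  have "reach (machine R P) d (q, tape x F, int j) (q, tape x F, int (j + d))"
    using Suc by simp
  moreover have "reach (machine R P) 1 (q, tape x F, int (j + d)) (q, tape x F, int (j + d) + 1)"
    using reach_1[of q F "j + d" q "F (j + d)" 1] assms(1,2) Suc.prems[of d] by simp
  ultimately show ?case using reach_trans by (fastforce simp: algebra_simps)
qed

lemma reach_left:
  assumes "q \<noteq> 3 * length P + 2" "q \<noteq> 3 * (length P + 1) + 2"
    and "\<And>i. 0 < i \<Longrightarrow> i \<le> d \<Longrightarrow> F i \<subseteq> {..<R} \<and> act R P q (inp x i) (F i) = (q, F i, -1)"
  shows "reach (machine R P) d (q, tape x F, int d) (q, tape x F, 0)"
  using assms(3)
proof (induction d)
  case 0
  then show ?case by (simp add: reach_0)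
next
  case (Suc d)
  have "reach (machine R P) d (q, tape x F, int d) (q, tape x F, 0)"
    using Suc by simp
  moreover have "reach (machine R P) 1 (q, tape x F, int (Suc d)) (q, tape x F, int d)"
    using reach_1[of q F "Suc d" q "F (Suc d)" "-1"] assms(1,2) Suc.prems[of "Suc d"] by simp
  ultimately show ?case using reach_trans by fastforce
qed

text \<open>The marker of register 1 occurs in cell 0 only, so the walk to the left knows where to
  stop.\<close>

lemma reach_ret:
  assumes "\<And>i. F i \<subseteq> {..<R}" "\<And>i. 1 \<in> F i \<longleftrightarrow> i = 0"
  shows "reach (machine R P) (d + 1) (3 * t + 4, tape x F, int d) (3 * t + 2, tape x F, 0)"
proof -
  have q: "3 * t + 4 \<noteq> 3 * length P + 2" "3 * t + 4 \<noteq> 3 * (length P + 1) + 2" by presburger+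
  have A: "act R P (3 * t + 4) a (F i) = (if i = 0 then (3 * t + 2, F i, 0) else (3 * t + 4, F i, -1))" for a i
    using act_eq[of "3 * t + 4" t 2 R P a "F i"] assms(2)[of i] by simp
  have "reach (machine R P) d (3 * t + 4, tape x F, int d) (3 * t + 4, tape x F, 0)"
    by (rule reach_left[OF q]) (use A assms in auto)
  moreover have "reach (machine R P) 1 (3 * t + 4, tape x F, int 0) (3 * t + 2, tape x F, int 0 + 0)"
    using reach_1[of "3 * t + 4" F 0 "3 * t + 2" "F 0" 0] q A assms by simp
  ultimately show ?thesis using reach_trans by fastforce
qed

lemma act_run:
  assumes "pc < length P" "P ! pc = (op, t, f)"
  shows "act R P (3 * pc + 2) a A = run_act op t f (3 * pc + 2) a A"
  using assms act_eq[of "3 * pc + 2" pc 0 R P a A] by simp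

lemma act_mid:
  assumes "pc < length P" "P ! pc = (op, t, f)"
  shows "act R P (3 * pc + 3) a A = mid_act op t (3 * pc + 3) A"
  using assms act_eq[of "3 * pc + 3" pc 1 R P a A] by simp

lemma marks_sub: "marks R s j \<subseteq> {..<R}" by (auto simp: marks_def)

text \<open>Each instruction makes one trip to the marker concerned and one trip back, both no
  longer than the wall up to a constant; hence the factor 2.\<close>

lemma sim_step:
  assumes pc: "pc < length P" and op: "P ! pc = (op, t, f)" and s: "bounded s"
    and r: "rused op \<subseteq> {..<R}" and w: "\<And>r. op = IInc r \<Longrightarrow> r \<noteq> 1" "\<And>r. op = IZero r \<Longrightarrow> 2 \<le> r"
    and st: "istep x P (pc, s) = (pc', s')"
  shows "\<exists>u \<le> 2 * s 0 + 5. reach (machine R P) u (3 * pc + 2, tape x (marks R s), 0)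
            (3 * pc' + 2, tape x (marks R s'), 0)"
proof -
  let ?M = "machine R P" and ?F = "marks R s"
  have q: "3 * pc + 2 \<noteq> 3 * length P + 2" "3 * pc + 2 \<noteq> 3 * (length P + 1) + 2"
    "3 * pc + 3 \<noteq> 3 * length P + 2" "3 * pc + 3 \<noteq> 3 * (length P + 1) + 2"
    using pc by presburger+
  have le: "s r \<le> s 0" for r using s by (simp add: bounded_def)
  have one: "1 \<in> marks R s' i \<longleftrightarrow> i = 0" if "bounded s'" for s' i
    using that R by (auto simp: bounded_def marks_def)
  have ret: "reach ?M (d + 1) (3 * t + 4, tape x (marks R s'), int d) (3 * t + 2, tape x (marks R s'), 0)"
    if "bounded s'" for d t s' using reach_ret[of "marks R s'"] one that marks_sub by blast
  have scan: "reach ?M d (3 * pc + 2, tape x ?F, 0) (3 * pc + 2, tape x ?F, int d)"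
    if "\<And>i a. i < d \<Longrightarrow> run_act op t f (3 * pc + 2) a (?F i) = (3 * pc + 2, ?F i, 1)" for d
    using reach_right[OF q(1,2), of d ?F 0] that marks_sub act_run[OF pc op] by simp
  show ?thesis
  proof (cases op)
    case (IInc r)
    have rR: "r < R" "r \<noteq> 1" using r w IInc by (auto simp: rused_def)
    have s': "pc' = t" "s' = bump r s" using st op IInc by (auto simp: istep_def)
    have b': "bounded s'" using bump_bounded s rR s' by auto
    have sc: "reach ?M (s r) (3 * pc + 2, tape x ?F, 0) (3 * pc + 2, tape x ?F, int (s r))"
      by (rule scan) (auto simp: IInc marks_def)
    show ?thesis
    proof (cases "r \<noteq> 0 \<and> s r = s 0")
      case True
      \<comment> \<open>Saturation is visible locally: the wall marker sits in the same
        cell.\<close>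
      then have "r \<in> ?F (s r)" "0 \<in> ?F (s r)" "r \<noteq> 0" using rR by (auto simp: marks_def)
      then have "reach ?M 1 (3 * pc + 2, tape x ?F, int (s r)) (3 * t + 4, tape x ?F, int (s r))"
        using reach_stay[OF q(1,2), of ?F "s r" "3 * t + 4" "?F (s r)"] marks_sub act_run[OF pc op] IInc
        by simp
      from reach_trans[OF reach_trans[OF sc this] ret[OF s, of "s r" t]]
      have "reach ?M (s r + 1 + (s r + 1)) (3 * pc + 2, tape x ?F, 0) (3 * t + 2, tape x ?F, 0)" .
      moreover have "s' = s" using True s' by (simp add: bump_def)
      ultimately show ?thesis using s' le[of r] by (intro exI[of _ "s r + 1 + (s r + 1)"]) auto
    next
      case False
      define G where "G = ?F(s r := ?F (s r) - {r})"
      have Gs: "G j \<subseteq> {..<R}" for j using marks_sub by (auto simp: G_def marks_def)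
      have 1: "reach ?M 1 (3 * pc + 2, tape x ?F, int (s r)) (3 * pc + 3, tape x G, int (Suc (s r)))"
      proof -
        have "act R P (3 * pc + 2) (inp x (s r)) (?F (s r)) = (3 * pc + 3, ?F (s r) - {r}, 1)"
          using act_run[OF pc op] IInc rR False by (auto simp: marks_def)
        from reach_1[OF q(1,2), of ?F, OF marks_sub this] marks_sub[of s "s r"] show ?thesis
          by (auto simp: G_def add.commute)
      qed
      have 2: "reach ?M 1 (3 * pc + 3, tape x G, int (Suc (s r)))
         (3 * t + 4, tape x (G(Suc (s r) := insert r (G (Suc (s r))))), int (Suc (s r)))"
        by (rule reach_stay[OF q(3,4) Gs]) (use act_mid[OF pc op] IInc Gs rR in auto)
      have 3: "G(Suc (s r) := insert r (G (Suc (s r)))) = marks R s'"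
        using False rR unfolding s' bump_def G_def marks_def by (auto simp: fun_eq_iff intro!: gr0I)
      from reach_trans[OF reach_trans[OF reach_trans[OF sc 1] 2[unfolded 3]] ret[OF b', of "Suc (s r)" t]]
      have "reach ?M (s r + 1 + 1 + (Suc (s r) + 1)) (3 * pc + 2, tape x ?F, 0) (3 * t + 2, tape x (marks R s'), 0)" .
      then show ?thesis using s' le[of r] by (intro exI[of _ "s r + 1 + 1 + (Suc (s r) + 1)"]) auto
    qed
  next
    case (IZero r)
    have rR: "r < R" "2 \<le> r" using r w IZero by (auto simp: rused_def)
    have s': "pc' = t" "s' = s(r := 0)" using st op IZero by (auto simp: istep_def)
    have b': "bounded s'" using zero_bounded s rR s' by auto
    have sc: "reach ?M (s r) (3 * pc + 2, tape x ?F, 0) (3 * pc + 2, tape x ?F, int (s r))"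
      by (rule scan) (auto simp: IZero marks_def)
    define G where "G = ?F(s r := ?F (s r) - {r})"
    have Gs: "G j \<subseteq> {..<R}" for j using marks_sub by (auto simp: G_def marks_def)
    have G1: "1 \<in> G i \<longleftrightarrow> i = 0" for i using one[OF s, of i] rR by (auto simp: G_def)
    have 1: "reach ?M 1 (3 * pc + 2, tape x ?F, int (s r)) (3 * pc + 3, tape x G, int (s r))"
    proof -
      have "act R P (3 * pc + 2) (inp x (s r)) (?F (s r)) = (3 * pc + 3, ?F (s r) - {r}, 0)"
        using act_run[OF pc op] IZero rR by (auto simp: marks_def)
      from reach_stay[OF q(1,2), of ?F, OF marks_sub this] marks_sub[of s "s r"] show ?thesis
        by (auto simp: G_def)
    qed
    have 2: "reach ?M (s r) (3 * pc + 3, tape x G, int (s r)) (3 * pc + 3, tape x G, 0)"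
      by (rule reach_left[OF q(3,4)]) (use act_mid[OF pc op] IZero Gs G1 in auto)
    have 3: "reach ?M 1 (3 * pc + 3, tape x G, int 0)
         (3 * t + 4, tape x (G(0 := insert r (G 0))), int 0)"
      by (rule reach_stay[OF q(3,4) Gs]) (use act_mid[OF pc op] IZero Gs G1 rR in auto)
    have 4: "G(0 := insert r (G 0)) = marks R s'"
      using rR unfolding s' G_def marks_def by (auto simp: fun_eq_iff)
    from reach_trans[OF reach_trans[OF reach_trans[OF sc 1] 2] 3[unfolded 4 of_nat_0]]
    have "reach ?M (s r + 1 + s r + 1) (3 * pc + 2, tape x ?F, 0) (3 * t + 4, tape x (marks R s'), int 0)"
      by (simp only: of_nat_0)
    from reach_trans[OF this ret[OF b', of 0 t]]
    show ?thesis using s' le[of r] by (intro exI[of _ "s r + 1 + s r + 1 + (0 + 1)"]) auto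
  next
    case (IEq r r')
    have rR: "r < R" "r' < R" using r IEq by (auto simp: rused_def)
    have s': "pc' = (if s r = s r' then t else f)" "s' = s" using st op IEq by (auto simp: istep_def)
    \<comment> \<open>The scan stops at the first of the two markers; the values agree iff the other
      marker is in the same cell.\<close>
    let ?d = "min (s r) (s r')"
    have sc: "reach ?M ?d (3 * pc + 2, tape x ?F, 0) (3 * pc + 2, tape x ?F, int ?d)"
      by (rule scan) (auto simp: IEq marks_def)
    have "reach ?M 1 (3 * pc + 2, tape x ?F, int ?d) (3 * pc' + 4, tape x (?F(?d := ?F ?d)), int ?d)"
      by (rule reach_stay[OF q(1,2)]) (use marks_sub act_run[OF pc op] IEq rR s' in \<open>auto simp: marks_def min_def\<close>)
    from reach_trans[OF reach_trans[OF sc this[unfolded fun_upd_triv]] ret[OF s, of ?d pc']]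
    have "reach ?M (?d + 1 + (?d + 1)) (3 * pc + 2, tape x ?F, 0) (3 * pc' + 2, tape x ?F, 0)" .
    then show ?thesis using s' le[of r] by (intro exI[of _ "?d + 1 + (?d + 1)"]) (auto simp: min_def)
  next
    case (ISym a r)
    have rR: "r < R" using r ISym by (auto simp: rused_def)
    have s': "pc' = (if inp x (s r) = a then t else f)" "s' = s" using st op ISym by (auto simp: istep_def)
    have sc: "reach ?M (s r) (3 * pc + 2, tape x ?F, 0) (3 * pc + 2, tape x ?F, int (s r))"
      by (rule scan) (auto simp: ISym marks_def)
    have "reach ?M 1 (3 * pc + 2, tape x ?F, int (s r)) (3 * pc' + 4, tape x (?F(s r := ?F (s r))), int (s r))"
      by (rule reach_stay[OF q(1,2)]) (use marks_sub act_run[OF pc op] ISym rR s' in \<open>auto simp: marks_def\<close>)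
    from reach_trans[OF reach_trans[OF sc this[unfolded fun_upd_triv]] ret[OF s, of "s r" pc']]
    have "reach ?M (s r + 1 + (s r + 1)) (3 * pc + 2, tape x ?F, 0) (3 * pc' + 2, tape x ?F, 0)" .
    then show ?thesis using s' le[of r] by (intro exI[of _ "s r + 1 + (s r + 1)"]) auto
  qed
qed

lemma sim_steps:
  assumes wf: "\<And>op t f. (op, t, f) \<in> set P \<Longrightarrow> wf_ins R op"
  shows "steps x P n c c' \<Longrightarrow> bounded (snd c) \<Longrightarrow>
    snd c 0 \<le> snd c' 0 \<and> (\<exists>u \<le> n * (2 * snd c' 0 + 5).
      reach (machine R P) u (3 * fst c + 2, tape x (marks R (snd c)), 0)
            (3 * fst c' + 2, tape x (marks R (snd c')), 0))"
proof (induction rule: steps.induct)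
  case (steps_0 c)
  then show ?case by (auto intro: reach_0)
next
  case (steps_Suc c n c')
  obtain pc s where c: "c = (pc, s)" by (cases c)
  obtain pc1 s1 where c1: "istep x P (pc, s) = (pc1, s1)" by (cases "istep x P (pc, s)")
  have pc: "pc < length P" using steps_Suc c by simp
  obtain op t f where op: "P ! pc = (op, t, f)" by (cases "P ! pc")
  have w: "wf_ins R op" using wf[of op t f] pc op nth_mem by metis
  have s: "bounded s" using steps_Suc c by simp
  have b1: "bounded s1 \<and> s 0 \<le> s1 0"
    using c1 op w s bump_bounded[OF s] zero_bounded[OF s] by (cases op) (auto simp: istep_def wf_ins_def)
  obtain u where u: "u \<le> 2 * s 0 + 5" "reach (machine R P) u (3 * pc + 2, tape x (marks R s), 0)
            (3 * pc1 + 2, tape x (marks R s1), 0)"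
    using sim_step[OF pc op s _ _ _ c1] w by (auto simp: wf_ins_def)
  obtain v where v: "s1 0 \<le> snd c' 0" "v \<le> n * (2 * snd c' 0 + 5)" "reach (machine R P) v (3 * pc1 + 2, tape x (marks R s1), 0)
            (3 * fst c' + 2, tape x (marks R (snd c')), 0)"
    using steps_Suc.IH b1 c c1 by auto
  have "u + v \<le> Suc n * (2 * snd c' 0 + 5)" using u(1) v(1,2) b1 by simp
  then show ?case using reach_trans[OF u(2) v(3)] b1 v(1) c by auto
qed

text \<open>The wall goes to the first blank cell, so its initial value is the input length.
  Recognising that cell uses that input symbols are positive.\<close>

lemma sim_init:
  assumes "x \<noteq> []"
  shows "reach (machine R P) (2 * length x + 2) (tm_init x)
    (2, tape x (marks R (\<lambda>r. if r = 0 then length x else 0)), 0)"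
proof -
  let ?M = "machine R P"
  let ?L = "length x"
  have q: "0 \<noteq> 3 * length P + 2" "0 \<noteq> 3 * (length P + 1) + 2"
    "1 \<noteq> 3 * length P + 2" "1 \<noteq> 3 * (length P + 1) + 2" by auto
  have e: "set_encode {} = 0" by (simp add: set_encode_def)
  have init: "tm_init x = (0, tape x (\<lambda>_. {}), int 0)"
    by (auto simp: tm_init_def tape_def inp_def fun_eq_iff e nat_less_iff)
  define F where "F = (\<lambda>_. {})(0::nat := {1..<R})"
  have 1: "reach ?M 1 (0, tape x (\<lambda>_. {}), int 0) (1, tape x F, int 1)"
  proof -
    have "{1..<R} \<subseteq> {..<R}" by auto
    with reach_1[OF q(1,2), of "\<lambda>_. {}" 0 1 "{1..<R}" 1] show ?thesis by (simp add: act_def F_def)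
  qed
  have Fs: "F j \<subseteq> {..<R}" for j by (auto simp: F_def)
  obtain l where l: "?L = Suc l" using assms by (cases x) auto
  have 2: "reach ?M l (1, tape x F, int 1) (1, tape x F, int (1 + l))"
    by (rule reach_right[OF q(3,4)]) (use Fs x13 l in \<open>auto simp: act_def inp_def\<close>)
  have 3: "reach ?M 1 (1, tape x F, int ?L) (4, tape x (F(?L := {0})), int ?L)"
    by (rule reach_stay[OF q(3,4) Fs]) (use R in \<open>auto simp: act_def inp_def\<close>)
  have 4: "F(?L := {0}) = marks R (\<lambda>r. if r = 0 then ?L else 0)"
    using l R by (auto simp: F_def marks_def fun_eq_iff)
  have 5: "reach ?M (?L + 1) (4, tape x (marks R (\<lambda>r. if r = 0 then ?L else 0)), int ?L)
       (2, tape x (marks R (\<lambda>r. if r = 0 then ?L else 0)), 0)"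
    using reach_ret[of "marks R (\<lambda>r. if r = 0 then ?L else 0)" ?L 0] R marks_sub by (auto simp: marks_def numeral_2_eq_2)
  have "int (1 + l) = int ?L" by (simp add: l)
  from reach_trans[OF reach_trans[OF reach_trans[OF 1 2[unfolded this]] 3[unfolded 4]] 5]
  show ?thesis unfolding init by (simp only: l) (simp add: mult_2)
qed

end


section \<open>From loop programs to deciding machines\<close>

primrec rbound :: "com \<Rightarrow> nat" where
  "rbound (Inc r) = Suc r"
| "rbound (Zero r) = Suc r"
| "rbound (Seq c d) = max (rbound c) (rbound d)"
| "rbound (IfEq r q c d) = max (Suc (max r q)) (max (rbound c) (rbound d))"
| "rbound (IfSym a r c d) = max (Suc r) (max (rbound c) (rbound d))"
| "rbound (For i r c) = max (Suc (max i r)) (rbound c)"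

lemma wf_ins_simps [simp]:
  "wf_ins R (IInc r) \<longleftrightarrow> r < R \<and> r \<noteq> 1"
  "wf_ins R (IZero r) \<longleftrightarrow> r < R \<and> 2 \<le> r"
  "wf_ins R (IEq r q) \<longleftrightarrow> r < R \<and> q < R"
  "wf_ins R (ISym a r) \<longleftrightarrow> r < R"
  by (auto simp: wf_ins_def rused_def)

lemma wf_ins_compile:
  "wfc c \<Longrightarrow> rbound c \<le> R \<Longrightarrow> (op, t, f) \<in> set (compile c b e) \<Longrightarrow> wf_ins R op"
  by (induction c arbitrary: b e) auto

definition init_store :: "nat list \<Rightarrow> store" where
  "init_store x = (\<lambda>r. if r = 0 then length x else 0)"

lemma init_store_bounded: "bounded (init_store x)"
  by (simp add: bounded_def init_store_def)

text \<open>A final instruction compares register 2 with the zero in register 1. Its targets are the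
  two addresses behind the code, whose scan states are the accepting and the rejecting
  state.\<close>

lemma machine_decides:
  assumes c: "wfc c"
  shows "\<exists>M. tm_wf M \<and> (\<forall>x. x \<noteq> [] \<and> (\<forall>a\<in>set x. 0 < a \<and> a < 13) \<longrightarrow>
     (let s = exec x c (init_store x) in
       tm_decides_within M x (2 * length x + 2 + ((s 0 + 5) ^ csize c + 1) * (2 * s 0 + 5)) (s 2 \<noteq> 0)))"
proof -
  define P where "P = compile c 0 (csize c) @ [(IEq 2 1, csize c + 2, csize c + 1)]"
  define R where "R = max 3 (rbound c)"
  define M where "M = machine R P"
  have R: "2 \<le> R" by (simp add: R_def)
  have lP: "length P = csize c + 1" by (simp add: P_def)
  have wfi: "wf_ins R op" if "(op, t, f) \<in> set P" for op t f
    using that wf_ins_compile[OF c, of R op t f 0 "csize c"]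
    by (auto simp: P_def R_def)
  have "tm_decides_within M x (2 * length x + 2 + ((s 0 + 5) ^ csize c + 1) * (2 * s 0 + 5)) (s 2 \<noteq> 0)"
    if x: "x \<noteq> []" "\<forall>a\<in>set x. 0 < a \<and> a < 13" and s: "s = exec x c (init_store x)" for x s
  proof -
    have "seg P 0 (compile c 0 (csize c))" unfolding seg_def P_def by auto
    then obtain t where t: "t \<le> (s 0 + 5) ^ csize c" "steps x P t (0, init_store x) (csize c, s)"
      using compile_correct[OF c init_store_bounded] s by blast
    define pc where "pc = (if s 2 = 0 then length P + 1 else length P)"
    have "s 1 = 0" using exec_bounded[OF c init_store_bounded, of x] s by (simp add: bounded_def)
    then have "istep x P (csize c, s) = (pc, s)"
      by (simp add: istep_def P_def nth_append pc_def)
    then have "steps x P (Suc 0) (csize c, s) (pc, s)"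
      using lP steps_Suc[of "(csize c, s)" P x 0 "(pc, s)"] steps_0 by simp
    from steps_trans[OF t(2) this] have st: "steps x P (t + 1) (0, init_store x) (pc, s)" by simp
    have "0 < a \<and> a < 13" if "a \<in> set x" for a using x that by blast
    then have "\<exists>u \<le> (t + 1) * (2 * snd (pc, s) 0 + 5).
        reach (machine R P) u (3 * fst (0::nat, init_store x) + 2, tape x (marks R (snd (0::nat, init_store x))), 0)
          (3 * fst (pc, s) + 2, tape x (marks R (snd (pc, s))), 0)"
      using sim_steps[of R x P "t + 1" "(0, init_store x)" "(pc, s)"] R wfi st init_store_bounded
      by (metis snd_conv)
    then obtain u where u: "u \<le> (t + 1) * (2 * s 0 + 5)"
       "reach M u (2, tape x (marks R (init_store x)), 0) (3 * pc + 2, tape x (marks R s), 0)"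
      unfolding M_def fst_conv snd_conv mult_0_right add_0 by blast
    have "reach M (2 * length x + 2) (tm_init x) (2, tape x (marks R (init_store x)), 0)"
      unfolding M_def init_store_def by (rule sim_init) (use R x in auto)
    from reach_trans[OF this u(2)]
    have "tm_conf M x (2 * length x + 2 + u) = (3 * pc + 2, tape x (marks R s), 0)"
      by (simp add: reach_def tm_conf_def)
    moreover have "u \<le> ((s 0 + 5) ^ csize c + 1) * (2 * s 0 + 5)"
      using u(1) by (rule order_trans) (use t(1) in \<open>intro mult_right_mono; auto\<close>)
    then have "2 * length x + 2 + u \<le> 2 * length x + 2 + ((s 0 + 5) ^ csize c + 1) * (2 * s 0 + 5)"
      by (rule add_left_mono)
    moreover have "tm_acc M = 3 * length P + 2" "tm_rej M = 3 * (length P + 1) + 2"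
      by (simp_all add: M_def machine_def)
    ultimately show ?thesis unfolding tm_decides_within_def
      by (intro exI[of _ "2 * length x + 2 + u"] conjI) (simp_all add: pc_def)
  qed
  moreover have "tm_wf M" unfolding M_def by (rule machine_wf[OF R])
  ultimately show ?thesis by (intro exI[of _ M]) (auto simp: Let_def)
qed

section \<open>Computable functions\<close>

type_synonym ctx = "nat list \<times> nat"

text \<open>A wall of at least 16 leaves room for the small constants used in programs, in
  particular all input symbols.\<close>

definition okc :: "ctx \<Rightarrow> bool" where
  "okc c \<longleftrightarrow> 16 \<le> snd c \<and> length (fst c) \<le> snd c \<and> (\<forall>a\<in>set (fst c). 0 < a \<and> a < 13)"

definition computes :: "(nat \<Rightarrow> nat) \<Rightarrow> nat \<Rightarrow> com \<Rightarrow> (ctx \<Rightarrow> (nat \<Rightarrow> nat) \<Rightarrow> nat) \<Rightarrow> bool" where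
  "computes vs n p F \<longleftrightarrow> wfc p \<and> mods p \<subseteq> {n..} \<and>
     (\<forall>x s. bounded s \<and> okc (x, s 0) \<longrightarrow> exec x p s n = F (x, s 0) (\<lambda>i. s (vs i)))"

text \<open>Every variable of the environment lives in some register \<open>vs i < n\<close>, and the value is computed into
register \<open>n\<close> using registers from \<open>n\<close> on. As \<open>vs\<close> is arbitrary, renaming and weakening come for free.\<close>

definition computable :: "(ctx \<Rightarrow> (nat \<Rightarrow> nat) \<Rightarrow> nat) \<Rightarrow> bool" where
  "computable F \<longleftrightarrow> (\<forall>vs n. 2 \<le> n \<and> (\<forall>i. vs i < n) \<longrightarrow> (\<exists>p. computes vs n p F))"

lemma computableI:
  assumes "\<And>vs n. 2 \<le> n \<Longrightarrow> \<forall>i. vs i < n \<Longrightarrow> \<exists>p. computes vs n p F"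
  shows "computable F"
  using assms unfolding computable_def by blast

lemma computableE:
  assumes "computable F" "2 \<le> n" "\<forall>i. vs i < n"
  obtains c where "wfc c" "mods c \<subseteq> {n..}"
    "\<And>x s. bounded s \<Longrightarrow> okc (x, s 0) \<Longrightarrow> exec x c s n = F (x, s 0) (\<lambda>i. s (vs i))"
    "\<And>x s q. q < n \<Longrightarrow> exec x c s q = s q"
    "\<And>x s. bounded s \<Longrightarrow> bounded (exec x c s)"
proof -
  obtain c where c: "wfc c" "mods c \<subseteq> {n..}"
    "\<And>x s. bounded s \<Longrightarrow> okc (x, s 0) \<Longrightarrow> exec x c s n = F (x, s 0) (\<lambda>i. s (vs i))"
    using assms unfolding computable_def computes_def by meson
  show thesis
  proof (rule that[OF c])
    show "exec x c s q = s q" if "q < n" for x s q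
      using exec_frame[of q c x s] c(2) that by force
    show "bounded (exec x c s)" if "bounded s" for x s using exec_bounded c(1) that by blast
  qed
qed

definition copy :: "nat \<Rightarrow> nat \<Rightarrow> nat \<Rightarrow> com" where
  "copy d r t = Seq (Zero d) (For t r (Inc d))"

lemma copy:
  assumes "2 \<le> d" "2 \<le> t" "d \<noteq> r" "t \<noteq> r" "d \<noteq> t"
  shows "wfc (copy d r t)" "mods (copy d r t) = {d, t}"
    "bounded s \<Longrightarrow> exec x (copy d r t) s d = s r"
proof -
  show wf: "wfc (copy d r t)" "mods (copy d r t) = {d, t}"
    using assms by (auto simp: copy_def)
  assume s: "bounded s"
  define z where "z = s(d := 0)"
  have z: "bounded z" "z r = s r" "z d = 0" "z 0 = s 0"
    unfolding z_def using assms s by (auto intro: zero_bounded)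
  have wf': "wfc (For t r (Inc d))" using assms by simp
  obtain G where G: "exec x (For t r (Inc d)) z = G (z r)" "G 0 = z(t := 0)"
    "\<And>k. G (Suc k) = bump t (exec x (Inc d) (G k))"
    "\<And>k q. q \<notin> mods (Inc d) \<Longrightarrow> q \<noteq> t \<Longrightarrow> G k q = z q"
    by (rule For_unroll[OF wf' z(1)]) blast
  have 0: "G k 0 = s 0" for k using G(4)[of 0 k] assms z by simp
  have "s r \<le> s 0" using s by (simp add: bounded_def)
  have "k \<le> s r \<Longrightarrow> G k d = k" for k
  proof (induction k)
    case 0
    then show ?case using G(2) z assms by simp
  next
    case (Suc k)
    then have "G k d \<noteq> G k 0" using 0[of k] \<open>s r \<le> s 0\<close> by simp
    then show ?case using Suc G(3)[of k] assms by (simp add: bump_def)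
  qed
  then have "exec x (For t r (Inc d)) z d = s r" using G(1) z by simp
  then show "exec x (copy d r t) s d = s r" by (simp add: copy_def z_def)
qed

text \<open>Registers never exceed the wall, so two functions need to agree only on environments
  below it. This lets saturating operations stand for exact ones.\<close>

lemma computable_cong:
  assumes "computable F" "\<And>c e. okc c \<Longrightarrow> (\<And>i. e i \<le> snd c) \<Longrightarrow> F c e = G c e"
  shows "computable G" (is "computable ?F")
proof (rule computableI)
  fix vs :: "nat \<Rightarrow> nat" and n assume n: "2 \<le> (n::nat)" and vs: "\<forall>i. vs i < n"
  obtain c where c: "wfc c" "mods c \<subseteq> {n..}"
    "\<And>x s. bounded s \<Longrightarrow> okc (x, s 0) \<Longrightarrow> exec x c s n = F (x, s 0) (\<lambda>i. s (vs i))"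
    by (rule computableE[OF assms(1) n vs]) blast
  then show "\<exists>p. computes vs n p ?F" unfolding computes_def
    by (intro exI[of _ c]) (simp add: assms(2) bounded_def)
qed

lemma computable_var: "computable (\<lambda>c e. e i)" (is "computable ?F")
proof (rule computableI)
  fix vs :: "nat \<Rightarrow> nat" and n assume n: "2 \<le> (n::nat)" and vs: "\<forall>i. vs i < n"
  have v: "vs i < n" using vs by blast
  show "\<exists>p. computes vs n p ?F" unfolding computes_def
    using copy[of n "n + 1" "vs i"] n v by (intro exI[of _ "copy n (vs i) (n + 1)"]) auto
qed

lemma computable_wall: "computable (\<lambda>c e. snd c)" (is "computable ?F")
proof (rule computableI)
  fix vs :: "nat \<Rightarrow> nat" and n assume n: "2 \<le> (n::nat)"
  show "\<exists>p. computes vs n p ?F" unfolding computes_def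
    using copy[of n "n + 1" 0] n by (intro exI[of _ "copy n 0 (n + 1)"]) auto
qed

lemma computable_0: "computable (\<lambda>c e. 0)"
  by (rule computableI, unfold computes_def, rule exI[of _ "Zero _"]) auto

lemma computable_suc:
  assumes "computable F" shows "computable (\<lambda>c e. if F c e = snd c then snd c else Suc (F c e))" (is "computable ?F")
proof (rule computableI)
  fix vs :: "nat \<Rightarrow> nat" and n assume n: "2 \<le> (n::nat)" and vs: "\<forall>i. vs i < n"
  obtain c where c: "wfc c" "mods c \<subseteq> {n..}"
    "\<And>x s. bounded s \<Longrightarrow> okc (x, s 0) \<Longrightarrow> exec x c s n = F (x, s 0) (\<lambda>i. s (vs i))"
    "\<And>x s q. q < n \<Longrightarrow> exec x c s q = s q"
    by (rule computableE[OF assms n vs]) blast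
  then show "\<exists>p. computes vs n p ?F" unfolding computes_def
    using n by (intro exI[of _ "Seq c (Inc n)"]) (auto simp: bump_def)
qed

lemma computable_weak: "computable F \<Longrightarrow> computable (\<lambda>c e. F c (\<lambda>i. e (g i)))"
  unfolding computable_def computes_def
proof (intro allI impI, goal_cases)
  case (1 vs n)
  then show ?case using spec[OF spec[OF 1(1), of "\<lambda>i. vs (g i)"], of n] by simp
qed

text \<open>Variables are de Bruijn indices: the value of \<open>F\<close> becomes index 0 and stays
  in register \<open>n\<close> while \<open>H\<close> computes above it.\<close>

lemma computable_let:
  assumes "computable F" "computable H"
  shows "computable (\<lambda>c e. H c (case_nat (F c e) e))" (is "computable ?F")
proof (rule computableI)
  fix vs :: "nat \<Rightarrow> nat" and n assume n: "2 \<le> (n::nat)" and vs: "\<forall>i. vs i < n"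
  obtain c where c: "wfc c" "mods c \<subseteq> {n..}"
    "\<And>x s. bounded s \<Longrightarrow> okc (x, s 0) \<Longrightarrow> exec x c s n = F (x, s 0) (\<lambda>i. s (vs i))"
    "\<And>x s q. q < n \<Longrightarrow> exec x c s q = s q" "\<And>x s. bounded s \<Longrightarrow> bounded (exec x c s)"
    by (rule computableE[OF assms(1) n vs]) blast
  have n1: "2 \<le> n + 1" and vs1: "\<forall>i. case_nat n vs i < n + 1"
    using n vs by (auto simp: less_Suc_eq split: nat.splits)
  obtain d where d: "wfc d" "mods d \<subseteq> {n+1..}"
    "\<And>x s. bounded s \<Longrightarrow> okc (x, s 0) \<Longrightarrow> exec x d s (n + 1) = H (x, s 0) (\<lambda>i. s (case_nat n vs i))"
    "\<And>x s q. q < n + 1 \<Longrightarrow> exec x d s q = s q" "\<And>x s. bounded s \<Longrightarrow> bounded (exec x d s)"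
    by (rule computableE[OF assms(2) n1, of "case_nat n vs", OF vs1]) blast
  let ?p = "Seq c (Seq d (copy n (n + 1) (n + 2)))"
  have cp: "wfc (copy n (n + 1) (n + 2))" "mods (copy n (n + 1) (n + 2)) = {n, n + 2}"
    "\<And>s x. bounded s \<Longrightarrow> exec x (copy n (n + 1) (n + 2)) s n = s (n + 1)"
    using copy[of n "n + 2" "n + 1"] n by auto
  have "exec x ?p s n = ?F (x, s 0) (\<lambda>i. s (vs i))"
    if s: "bounded s" "okc (x, s 0)" for x s
  proof -
    let ?s = "exec x c s"
    have b: "bounded ?s" "?s 0 = s 0" using c s n by auto
    have "(\<lambda>i. ?s (case_nat n vs i)) = case_nat (F (x, s 0) (\<lambda>i. s (vs i))) (\<lambda>i. s (vs i))"
      using c(3)[OF s] c(4) vs by (auto simp: fun_eq_iff split: nat.splits)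
    then show ?thesis using cp(3) d(3)[OF b(1)] d(5)[OF b(1)] b s by simp
  qed
  moreover have "wfc ?p" "mods ?p \<subseteq> {n..}" using c d cp by auto
  ultimately show "\<exists>p. computes vs n p ?F" unfolding computes_def
    by blast
qed

lemma computable_subst1:
  assumes "computable (\<lambda>c e. f c (e 0))" "computable F"
  shows "computable (\<lambda>c e. f c (F c e))"
  using computable_let[OF assms(2,1)] by simp

lemma computable_subst2:
  assumes "computable (\<lambda>c e. f c (e 0) (e 1))" "computable F" "computable G"
  shows "computable (\<lambda>c e. f c (F c e) (G c e))"
proof -
  have "computable (\<lambda>c e. f c (F c (\<lambda>i. e (Suc i))) (e 0))"
    using computable_let[OF computable_weak[OF assms(2), of Suc] computable_weak[OF assms(1), of "\<lambda>i. if i = 0 then 0 else 1"]]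
    by simp
  from computable_let[OF assms(3) this] show ?thesis by simp
qed

lemma computable_if:
  assumes "computable P" "computable F" "computable G"
  shows "computable (\<lambda>c e. if P c e \<noteq> 0 then F c e else G c e)" (is "computable ?F")
proof (rule computableI)
  fix vs :: "nat \<Rightarrow> nat" and n assume n: "2 \<le> (n::nat)" and vs: "\<forall>i. vs i < n"
  obtain p where p: "wfc p" "mods p \<subseteq> {n..}"
    "\<And>x s. bounded s \<Longrightarrow> okc (x, s 0) \<Longrightarrow> exec x p s n = P (x, s 0) (\<lambda>i. s (vs i))"
    "\<And>x s q. q < n \<Longrightarrow> exec x p s q = s q" "\<And>x s. bounded s \<Longrightarrow> bounded (exec x p s)"
    by (rule computableE[OF assms(1) n vs]) blast
  obtain f where f: "wfc f" "mods f \<subseteq> {n..}"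
    "\<And>x s. bounded s \<Longrightarrow> okc (x, s 0) \<Longrightarrow> exec x f s n = F (x, s 0) (\<lambda>i. s (vs i))"
    by (rule computableE[OF assms(2) n vs]) blast
  obtain g where g: "wfc g" "mods g \<subseteq> {n..}"
    "\<And>x s. bounded s \<Longrightarrow> okc (x, s 0) \<Longrightarrow> exec x g s n = G (x, s 0) (\<lambda>i. s (vs i))"
    by (rule computableE[OF assms(3) n vs]) blast
  let ?p = "Seq p (IfEq n 1 g f)"
  have "exec x ?p s n = ?F (x, s 0) (\<lambda>i. s (vs i))"
    if s: "bounded s" "okc (x, s 0)" for x s
  proof -
    have b: "bounded (exec x p s)" using p s by auto
    then have "exec x p s 1 = 0" by (simp add: bounded_def)
    moreover have "exec x p s 0 = s 0" "(\<lambda>i. exec x p s (vs i)) = (\<lambda>i. s (vs i))" using p n vs by auto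
    ultimately show ?thesis using p(3)[OF s] f(3)[OF b] g(3)[OF b] s by simp
  qed
  moreover have "wfc ?p" "mods ?p \<subseteq> {n..}" using p f g by auto
  ultimately show "\<exists>p. computes vs n p ?F" unfolding computes_def
    by blast
qed

lemma bump_1: "bounded s \<Longrightarrow> okc (x, s 0) \<Longrightarrow> 2 \<le> n \<Longrightarrow> bump n (s(n := 0)) n = 1"
  by (auto simp: bump_def okc_def)

lemma computable_eq0: "computable (\<lambda>c e. of_bool (e 0 = e 1))" (is "computable ?F")
proof (rule computableI)
  fix vs :: "nat \<Rightarrow> nat" and n assume n: "2 \<le> (n::nat)" and vs: "\<forall>i. vs i < n"
  let ?p = "IfEq (vs 0) (vs 1) (Seq (Zero n) (Inc n)) (Zero n)"
  show "\<exists>p. computes vs n p ?F" unfolding computes_def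
    using n by (intro exI[of _ ?p]) (auto simp: bump_1)
qed

lemma computable_sym0: "computable (\<lambda>c e. of_bool (inp (fst c) (e 0) = a))" (is "computable ?F")
proof (rule computableI)
  fix vs :: "nat \<Rightarrow> nat" and n assume n: "2 \<le> (n::nat)" and vs: "\<forall>i. vs i < n"
  let ?p = "IfSym a (vs 0) (Seq (Zero n) (Inc n)) (Zero n)"
  show "\<exists>p. computes vs n p ?F" unfolding computes_def
    using n by (intro exI[of _ ?p]) (auto simp: bump_1)
qed

text \<open>A primitive recursion is one bounded loop. Register \<open>n\<close> holds the loop
  bound, \<open>n + 1\<close> the accumulator, \<open>n + 2\<close> the counter, and the body works
  from \<open>n + 3\<close> on. Inside the body, index 0 is the accumulator and index 1 the
  counter.\<close>

lemma computable_rec0: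
  assumes "computable F" "computable H" "computable G"
  shows "computable (\<lambda>c e. rec_nat (F c e) (\<lambda>i a. H c (case_nat a (case_nat i e))) (G c e))" (is "computable ?F")
proof (rule computableI)
  fix vs :: "nat \<Rightarrow> nat" and n assume n: "2 \<le> (n::nat)" and vs: "\<forall>i. vs i < n"
  have n1: "2 \<le> n + 1" and n3: "2 \<le> n + 3" and vs1: "\<forall>i. vs i < n + 1"
    and vs3: "\<forall>i. case_nat (n + 1) (case_nat (n + 2) vs) i < n + 3"
    using n vs by (auto simp: less_Suc_eq numeral_2_eq_2 numeral_3_eq_3 split: nat.splits)
  obtain g where g: "wfc g" "mods g \<subseteq> {n..}"
    "\<And>x s. bounded s \<Longrightarrow> okc (x, s 0) \<Longrightarrow> exec x g s n = G (x, s 0) (\<lambda>i. s (vs i))"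
    "\<And>x s q. q < n \<Longrightarrow> exec x g s q = s q" "\<And>x s. bounded s \<Longrightarrow> bounded (exec x g s)"
    by (rule computableE[OF assms(3) n vs]) blast
  obtain f where f: "wfc f" "mods f \<subseteq> {n+1..}"
    "\<And>x s. bounded s \<Longrightarrow> okc (x, s 0) \<Longrightarrow> exec x f s (n + 1) = F (x, s 0) (\<lambda>i. s (vs i))"
    "\<And>x s q. q < n + 1 \<Longrightarrow> exec x f s q = s q" "\<And>x s. bounded s \<Longrightarrow> bounded (exec x f s)"
    by (rule computableE[OF assms(1) n1 vs1]) blast
  obtain h where h: "wfc h" "mods h \<subseteq> {n+3..}"
    "\<And>x s. bounded s \<Longrightarrow> okc (x, s 0) \<Longrightarrow>
       exec x h s (n + 3) = H (x, s 0) (\<lambda>i. s (case_nat (n + 1) (case_nat (n + 2) vs) i))"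
    "\<And>x s q. q < n + 3 \<Longrightarrow> exec x h s q = s q" "\<And>x s. bounded s \<Longrightarrow> bounded (exec x h s)"
    by (rule computableE[OF assms(2) n3, of "case_nat (n + 1) (case_nat (n + 2) vs)", OF vs3]) blast
  let ?c1 = "copy (n + 1) (n + 3) (n + 4)" and ?c2 = "copy n (n + 1) (n + 2)"
  have c1: "wfc ?c1" "mods ?c1 = {n + 1, n + 4}" "\<And>s x. bounded s \<Longrightarrow> exec x ?c1 s (n + 1) = s (n + 3)"
    using copy[of "n + 1" "n + 4" "n + 3"] n by auto
  have c2: "wfc ?c2" "mods ?c2 = {n, n + 2}" "\<And>s x. bounded s \<Longrightarrow> exec x ?c2 s n = s (n + 1)"
    using copy[of n "n + 2" "n + 1"] n by auto
  let ?b = "Seq h ?c1"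
  let ?for = "For (n + 2) n ?b"
  let ?p = "Seq g (Seq f (Seq ?for ?c2))"
  have wfor: "wfc ?for" using h c1 by auto
  have wf: "wfc ?p" "mods ?p \<subseteq> {n..}" using g f h c1 c2 by auto
  have "exec x ?p s n = ?F (x, s 0) (\<lambda>i. s (vs i))"
    if s: "bounded s" "okc (x, s 0)" for x s
  proof -
    define c e where "c = (x, s 0)" and "e = (\<lambda>i. s (vs i))"
    define s1 where "s1 = exec x g s"
    define s2 where "s2 = exec x f s1"
    have s1: "bounded s1" "s1 n = G c e" "\<And>q. q < n \<Longrightarrow> s1 q = s q"
      using g s by (auto simp: s1_def c_def e_def)
    have "(\<lambda>i. s1 (vs i)) = e" "s1 0 = s 0" using s1 vs n by (auto simp: e_def)
    then have s2: "bounded s2" "s2 n = G c e" "\<And>q. q < n \<Longrightarrow> s2 q = s q" "s2 (n + 1) = F c e"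
      using f(3)[OF s1(1)] f(4,5) s s1 by (auto simp: s2_def c_def)
    obtain K where K: "exec x ?for s2 = K (s2 n)" "K 0 = s2(n + 2 := 0)"
      "\<And>k. K (Suc k) = bump (n + 2) (exec x ?b (K k))" "\<And>k. bounded (K k)"
      "\<And>k. k \<le> s2 n \<Longrightarrow> K k (n + 2) = k" "\<And>k q. q \<notin> mods ?b \<Longrightarrow> q \<noteq> n + 2 \<Longrightarrow> K k q = s2 q"
      by (rule For_unroll[OF wfor s2(1)]) blast
    have Kq: "K k q = s q" if "q < n" for k q
    proof -
      have "q \<notin> mods h" using h(2) that by force
      then show ?thesis using K(6)[of q k] that c1(2) s2(3) by simp
    qed
    have step: "K k (n + 1) = rec_nat (F c e) (\<lambda>i a. H c (case_nat a (case_nat i e))) k" if "k \<le> G c e" for k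
      using that
    proof (induction k)
      case 0
      then show ?case using K(2) s2 by simp
    next
      case (Suc k)
      have b: "bounded (exec x h (K k))" using h K by blast
      have k: "K k (n + 2) = k" using K(5)[of k] s2 Suc.prems by simp
      have "(\<lambda>i. K k (case_nat (n + 1) (case_nat (n + 2) vs) i)) = case_nat (K k (n + 1)) (case_nat k e)"
        using k Kq vs by (auto simp: fun_eq_iff e_def split: nat.splits)
      then have "exec x h (K k) (n + 3) = H c (case_nat (K k (n + 1)) (case_nat k e))"
        using h(3)[OF K(4), of x k] Kq[of 0 k] n s by (simp add: c_def)
      moreover have "K (Suc k) (n + 1) = exec x h (K k) (n + 3)"
        using K(3)[of k] c1(3)[OF b, of x] by simp
      ultimately show ?case using Suc by simp
    qed
    have "exec x ?p s n = exec x ?c2 (K (s2 n)) n" using K(1) by (simp add: s2_def s1_def)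
    also have "\<dots> = K (s2 n) (n + 1)" using c2(3) K(4) by blast
    finally show ?thesis using step[of "G c e"] s2 unfolding c_def e_def by simp
  qed
  with wf show "\<exists>p. computes vs n p ?F" unfolding computes_def
    by blast
qed

lemma computable_rec:
  assumes "computable F" "computable (\<lambda>c e. H c (e 1) (e 0) (\<lambda>j. e (j + 2)))" "computable G"
  shows "computable (\<lambda>c e. rec_nat (F c e) (\<lambda>i a. H c i a e) (G c e))"
  using computable_rec0[OF assms] by simp

section \<open>The model checker\<close>

text \<open>Collects the closure rules, so that computability of a defined function follows the
  syntax of its body.\<close>

named_theorems comp

abbreviation computableP :: "(ctx \<Rightarrow> (nat \<Rightarrow> nat) \<Rightarrow> bool) \<Rightarrow> bool" where
  "computableP P \<equiv> computable (\<lambda>c e. of_bool (P c e))"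

declare computable_var [comp] computable_wall [comp] computable_rec [comp]

definition csuc :: "ctx \<Rightarrow> nat \<Rightarrow> nat" where
  "csuc c a = (if a = snd c then snd c else Suc a)"

lemma computable_csuc [comp]: "computable F \<Longrightarrow> computable (\<lambda>c e. csuc c (F c e))"
  unfolding csuc_def by (rule computable_suc)

lemma computable_const [comp]: "k \<le> 16 \<Longrightarrow> computable (\<lambda>c e. k)"
proof (induction k)
  case 0
  show ?case by (rule computable_0)
next
  case (Suc k)
  then have "computable (\<lambda>c e. csuc c k)" by (intro computable_csuc) simp
  then show ?case by (rule computable_cong) (use Suc in \<open>auto simp: csuc_def okc_def\<close>)
qed

lemma computable_If [comp]:
  assumes "computableP P" "computable F" "computable G"
  shows "computable (\<lambda>c e. if P c e then F c e else G c e)"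
  using computable_if[OF assms] by simp

lemma computable_eq [comp]:
  assumes "computable F" "computable G" shows "computableP (\<lambda>c e. F c e = G c e)"
  using computable_subst2[OF computable_eq0 assms] .

lemma computable_not [comp]:
  assumes "computableP P" shows "computableP (\<lambda>c e. \<not> P c e)"
proof -
  have "computable (\<lambda>c e. if P c e then 0 else 1)" by (intro comp assms) auto
  then show ?thesis by (rule computable_cong) auto
qed

lemma computable_conj [comp]:
  assumes "computableP P" "computableP Q" shows "computableP (\<lambda>c e. P c e \<and> Q c e)"
proof -
  have "computable (\<lambda>c e. if P c e then of_bool (Q c e) else 0)" by (intro comp assms) auto
  then show ?thesis by (rule computable_cong) auto
qed

lemma computable_disj [comp]:
  assumes "computableP P" "computableP Q" shows "computableP (\<lambda>c e. P c e \<or> Q c e)"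
proof -
  have "computable (\<lambda>c e. if P c e then 1 else of_bool (Q c e))" by (intro comp assms) auto
  then show ?thesis by (rule computable_cong) auto
qed

lemma computable_imp [comp]:
  assumes "computableP P" "computableP Q" shows "computableP (\<lambda>c e. P c e \<longrightarrow> Q c e)"
  unfolding imp_conv_disj by (intro comp assms)

text \<open>A program can only compare a symbol with a constant, so the value is found by trying all
  13 candidates.\<close>

lemma computable_inp [comp]:
  assumes "computable F" shows "computable (\<lambda>c e. inp (fst c) (F c e))"
proof -
  have sym: "computableP (\<lambda>c e. inp (fst c) (F c e) = a)" for a
    using computable_subst1[OF computable_sym0 assms] .
  have "computable (\<lambda>c e. if inp (fst c) (F c e) = a then a else G c e)"
    if "a \<le> 16" "computable G" for a G
    using computable_If[OF sym computable_const[OF that(1)] that(2)] .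
  then have "computable (\<lambda>c e. foldr (\<lambda>a r. if inp (fst c) (F c e) = a then a else r) xs 0)"
    if "set xs \<subseteq> {..16}" for xs
    using that by (induction xs) (auto intro: comp)
  moreover have "set [0..<13] \<subseteq> {..16::nat}" by auto
  ultimately have *: "computable (\<lambda>c e. foldr (\<lambda>a r. if inp (fst c) (F c e) = a then a else r) [0..<13] 0)"
    by blast
  have "foldr (\<lambda>a r. if b = a then a else r) xs 0 = (b::nat)" if "b \<in> set xs" for xs b
    using that by (induction xs) auto
  moreover have "inp (fst c) p < 13" if "okc c" for c p
    using that nth_mem[of p "fst c"] by (auto simp: inp_def okc_def simp del: nth_mem)
  ultimately show ?thesis using computable_cong[OF *] by simp
qed

lemma computable_ex [comp]:
  assumes "computableP (\<lambda>c e. P c (e 1) (\<lambda>j. e (j + 2)))" "computable N"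
  shows "computableP (\<lambda>c e. \<exists>i<N c e. P c i e)"
proof -
  have "rec_nat (0::nat) (\<lambda>i a. if P c i e then 1 else a) n = of_bool (\<exists>i<n. P c i e)" for c e n
    by (induction n) (auto simp: less_Suc_eq)
  moreover have "computable (\<lambda>c e. rec_nat 0 (\<lambda>i a. if P c i e then 1 else a) (N c e))"
    by (intro comp assms) auto
  ultimately show ?thesis by simp
qed

lemma computable_all [comp]:
  assumes "computableP (\<lambda>c e. P c (e 1) (\<lambda>j. e (j + 2)))" "computable N"
  shows "computableP (\<lambda>c e. \<forall>i<N c e. P c i e)"
proof -
  have "computableP (\<lambda>c e. \<not> (\<exists>i<N c e. \<not> P c i e))" by (intro comp assms)
  then show ?thesis by simp
qed

text \<open>Truncated subtraction iterates the predecessor, and the predecessor of \<open>n\<close>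
  is the last index met by a recursion of length \<open>n\<close>.\<close>

lemma computable_minus [comp]:
  assumes "computable F" "computable G" shows "computable (\<lambda>c e. F c e - G c e)"
proof -
  have pred: "rec_nat 0 (\<lambda>i a. i) n = n - 1" for n by (cases n) auto
  have "rec_nat a (\<lambda>i r. rec_nat 0 (\<lambda>i a. i) r) n = a - n" for a n
    by (induction n) (auto simp: pred)
  moreover have "computable (\<lambda>c e. rec_nat (F c e) (\<lambda>i r. rec_nat 0 (\<lambda>i a. i) r) (G c e))"
    by (intro comp assms) auto
  ultimately show ?thesis by simp
qed

lemma computable_le [comp]:
  assumes "computable F" "computable G" shows "computableP (\<lambda>c e. F c e \<le> G c e)"
proof -
  have "computableP (\<lambda>c e. F c e - G c e = 0)" by (intro comp assms) auto
  then show ?thesis by simp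
qed

lemma computable_less [comp]:
  assumes "computable F" "computable G" shows "computableP (\<lambda>c e. F c e < G c e)"
  unfolding not_le[symmetric] by (intro comp assms)

lemma computable_mod [comp]:
  assumes "computable F" "computable G" shows "computable (\<lambda>c e. F c e mod G c e)"
proof -
  have r: "rec_nat 0 (\<lambda>i r. if csuc c r = b then 0 else csuc c r) a = a mod b" if "a \<le> snd c" for a b c
    using that
  proof (induction a)
    case (Suc a)
    then have "a mod b \<noteq> snd c" using mod_less_eq_dividend[of a b] by linarith
    then show ?case using Suc by (simp add: csuc_def mod_Suc)
  qed simp
  \<comment> \<open>For variables the bound by the wall is at hand. Arbitrary arguments are
    substituted afterwards, since their values are held in registers too.\<close>
  have "computable (\<lambda>c e. rec_nat 0 (\<lambda>i r. if csuc c r = e 1 then 0 else csuc c r) (e 0))"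
    by (intro comp) auto
  then have "computable (\<lambda>c e. e 0 mod e 1)"
    by (rule computable_cong) (use r in auto)
  from computable_subst2[OF this assms] show ?thesis .
qed

lemma computable_div [comp]:
  assumes "computable F" "computable G" shows "computable (\<lambda>c e. F c e div G c e)"
proof -
  have r: "rec_nat 0 (\<lambda>i r. if csuc c i mod b = 0 then csuc c r else r) a = a div b" if "a \<le> snd c" for a b c
    using that
  proof (induction a)
    case (Suc a)
    then have "a div b \<noteq> snd c" using div_le_dividend[of a b] by linarith
    moreover have "csuc c a = Suc a" using Suc.prems by (simp add: csuc_def)
    ultimately show ?case using Suc by (simp add: csuc_def div_Suc)
  qed simp
  have "computable (\<lambda>c e. rec_nat 0 (\<lambda>i r. if csuc c i mod e 1 = 0 then csuc c r else r) (e 0))"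
    by (intro comp) auto
  then have "computable (\<lambda>c e. e 0 div e 1)"
    by (rule computable_cong) (use r in auto)
  from computable_subst2[OF this assms] show ?thesis .
qed

section \<open>Saturating arithmetic and folds over the input\<close>

definition cadd :: "ctx \<Rightarrow> nat \<Rightarrow> nat \<Rightarrow> nat" where
  "cadd c a b = rec_nat a (\<lambda>i r. csuc c r) b"

definition cmul :: "ctx \<Rightarrow> nat \<Rightarrow> nat \<Rightarrow> nat" where
  "cmul c a b = rec_nat 0 (\<lambda>i r. cadd c r a) b"

definition cpow :: "ctx \<Rightarrow> nat \<Rightarrow> nat \<Rightarrow> nat" where
  "cpow c a b = rec_nat 1 (\<lambda>i r. cmul c r a) b"

lemma computable_cadd [comp]:
  assumes "computable F" "computable G" shows "computable (\<lambda>c e. cadd c (F c e) (G c e))"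
  unfolding cadd_def by (intro comp assms)

lemma computable_cmul [comp]:
  assumes "computable F" "computable G" shows "computable (\<lambda>c e. cmul c (F c e) (G c e))"
  unfolding cmul_def by (intro comp assms assms[THEN computable_weak]) auto

lemma computable_cpow [comp]:
  assumes "computable F" "computable G" shows "computable (\<lambda>c e. cpow c (F c e) (G c e))"
  unfolding cpow_def by (intro comp assms assms[THEN computable_weak]) auto

text \<open>No input symbol is blank, so the length is the number of nonblank positions below the
  wall.\<close>

lemma computable_length [comp]: "computable (\<lambda>c e. length (fst c))"
proof -
  have r: "rec_nat 0 (\<lambda>i r. if inp (fst c) i = 0 then r else csuc c r) n = min n (length (fst c))"
    if "n \<le> snd c" "okc c" for c n
    using that(1)
  proof (induction n)
    case (Suc n)
    show ?case
    proof (cases "n < length (fst c)")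
      case True
      then have "fst c ! n \<noteq> 0" using that(2) nth_mem[of n "fst c"] unfolding okc_def by blast
      with True Suc that(2) show ?thesis by (auto simp: inp_def csuc_def okc_def)
    next
      case False
      with Suc show ?thesis by (simp add: inp_def)
    qed
  qed simp
  have "computable (\<lambda>c e. rec_nat 0 (\<lambda>i r. if inp (fst c) i = 0 then r else csuc c r) (snd c))"
    by (intro comp) auto
  then show ?thesis by (rule computable_cong) (use r in \<open>auto simp: okc_def\<close>)
qed

text \<open>A right fold over the input from position \<open>p\<close>: \<open>h\<close> receives a
  position and the value for the suffix behind it. This direction fits numbers with the least
  significant bit first as well as prefix notation.\<close>

definition suffix_rec :: "ctx \<Rightarrow> nat \<Rightarrow> (nat \<Rightarrow> nat \<Rightarrow> nat) \<Rightarrow> nat \<Rightarrow> nat" where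
  "suffix_rec c z h p = rec_nat z (\<lambda>i a. h (length (fst c) - 1 - i) a) (length (fst c) - p)"

lemma computable_suffix_rec [comp]:
  assumes "computable Z" "computable (\<lambda>c e. H c (e 1) (e 0) (\<lambda>j. e (j + 2)))" "computable P"
  shows "computable (\<lambda>c e. suffix_rec c (Z c e) (\<lambda>q a. H c q a e) (P c e))"
proof -
  let ?g = "\<lambda>e j. if j = 0 then e 0 else if j = 1 then length (fst c) - 1 - e 1 else e j"
  have "computable (\<lambda>c e. H c (length (fst c) - 1 - e 1) (e 0) (\<lambda>j. e (j + 2)))"
  proof -
    have 1: "computable (\<lambda>c e. H c (e 0) (e 1) (\<lambda>j. e (j + 3)))"
      using computable_weak[OF assms(2), of "\<lambda>i. if i = 0 then 1 else if i = 1 then 0 else i + 1"] by (simp add: numeral_3_eq_3)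
    have "computable (\<lambda>c e. length (fst c) - 1 - e 1)" by (intro comp) auto
    from computable_let[OF this 1] show ?thesis by (simp add: numeral_2_eq_2 numeral_3_eq_3)
  qed
  then show ?thesis unfolding suffix_rec_def by (intro comp assms)
qed

text \<open>The input is accessed by position. An edge starts at a symbol 4 followed by two numbers, a label at
a symbol 4 followed by a number and then a list symbol, and a row of labels at a symbol 4 followed by
a list symbol. The row of a label is identified by the number of rows to its right.\<close>

definition num :: "ctx \<Rightarrow> nat \<Rightarrow> nat" where
  "num c p = suffix_rec c 0 (\<lambda>q a. if inp (fst c) q = 1 then cadd c a a
     else if inp (fst c) q = 2 then csuc c (cadd c a a) else 0) p"

definition nxt :: "ctx \<Rightarrow> nat \<Rightarrow> nat" where
  "nxt c p = suffix_rec c (length (fst c)) (\<lambda>q a. if inp (fst c) q = 3 then csuc c q else a) p"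

definition is_num :: "ctx \<Rightarrow> nat \<Rightarrow> bool" where
  "is_num c p \<longleftrightarrow> inp (fst c) p = 1 \<or> inp (fst c) p = 2 \<or> inp (fst c) p = 3"

definition is_list :: "ctx \<Rightarrow> nat \<Rightarrow> bool" where
  "is_list c p \<longleftrightarrow> inp (fst c) p = 4 \<or> inp (fst c) p = 5"

definition row_count :: "ctx \<Rightarrow> nat \<Rightarrow> nat" where
  "row_count c p = suffix_rec c 0 (\<lambda>q a. if inp (fst c) q = 4 \<and> is_list c (csuc c q) then csuc c a else a) p"

definition nstates :: "ctx \<Rightarrow> nat" where "nstates c = num c 0"

definition initial :: "ctx \<Rightarrow> nat" where "initial c = num c (nxt c 0)"

definition edge :: "ctx \<Rightarrow> nat \<Rightarrow> nat \<Rightarrow> bool" where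
  "edge c u v \<longleftrightarrow> (\<exists>p<length (fst c). inp (fst c) p = 4 \<and> is_num c (csuc c p) \<and>
     is_num c (nxt c (csuc c p)) \<and> num c (csuc c p) = u \<and> num c (nxt c (csuc c p)) = v)"

definition label :: "ctx \<Rightarrow> nat \<Rightarrow> nat \<Rightarrow> bool" where
  "label c s a \<longleftrightarrow> (\<exists>p<length (fst c). inp (fst c) p = 4 \<and> is_num c (csuc c p) \<and>
     is_list c (nxt c (csuc c p)) \<and> num c (csuc c p) = a \<and> row_count c (csuc c p) = nstates c - 1 - s)"

lemma computable_num [comp]: "computable P \<Longrightarrow> computable (\<lambda>c e. num c (P c e))"
  unfolding num_def by (intro comp) auto

lemma computable_nxt [comp]: "computable P \<Longrightarrow> computable (\<lambda>c e. nxt c (P c e))"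
  unfolding nxt_def by (intro comp) auto

lemma computable_is_num [comp]: "computable P \<Longrightarrow> computableP (\<lambda>c e. is_num c (P c e))"
  unfolding is_num_def by (intro comp) auto

lemma computable_is_list [comp]: "computable P \<Longrightarrow> computableP (\<lambda>c e. is_list c (P c e))"
  unfolding is_list_def by (intro comp) auto

lemma computable_row_count [comp]: "computable P \<Longrightarrow> computable (\<lambda>c e. row_count c (P c e))"
  unfolding row_count_def by (intro comp) auto

lemma computable_nstates [comp]: "computable (\<lambda>c e. nstates c)"
  unfolding nstates_def by (intro comp) auto

lemma computable_initial [comp]: "computable (\<lambda>c e. initial c)"
  unfolding initial_def by (intro comp) auto

lemma computable_edge [comp]:
  assumes "computable F" "computable G" shows "computableP (\<lambda>c e. edge c (F c e) (G c e))"
  unfolding edge_def by (intro comp assms[THEN computable_weak]) auto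

lemma computable_label [comp]:
  assumes "computable F" "computable G" shows "computableP (\<lambda>c e. label c (F c e) (G c e))"
  unfolding label_def by (intro comp assms[THEN computable_weak]) auto

section \<open>State sets and threshold vectors as numbers\<close>

definition mkvec :: "ctx \<Rightarrow> (nat \<Rightarrow> nat) \<Rightarrow> nat \<Rightarrow> nat \<Rightarrow> nat" where
  "mkvec c f D n = rec_nat 0 (\<lambda>i a. cadd c a (cmul c (f i) (cpow c D i))) n"

definition dig :: "ctx \<Rightarrow> nat \<Rightarrow> nat \<Rightarrow> nat \<Rightarrow> nat" where
  "dig c D y v = (y div cpow c D v) mod D"

definition mem :: "ctx \<Rightarrow> nat \<Rightarrow> nat \<Rightarrow> bool" where
  "mem c A v \<longleftrightarrow> dig c 2 A v = 1"

definition mkset :: "ctx \<Rightarrow> (nat \<Rightarrow> bool) \<Rightarrow> nat" where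
  "mkset c P = mkvec c (\<lambda>v. of_bool (P v)) 2 (nstates c)"

lemma computable_mkvec [comp]:
  assumes "computable (\<lambda>c e. f c (e 1) (\<lambda>j. e (j + 2)))" "computable D" "computable N"
  shows "computable (\<lambda>c e. mkvec c (\<lambda>i. f c i e) (D c e) (N c e))"
  unfolding mkvec_def by (intro comp assms assms(2)[THEN computable_weak]) auto

lemma computable_dig [comp]:
  assumes "computable D" "computable Y" "computable V"
  shows "computable (\<lambda>c e. dig c (D c e) (Y c e) (V c e))"
  unfolding dig_def by (intro comp assms)

lemma computable_mem [comp]:
  assumes "computable A" "computable V" shows "computableP (\<lambda>c e. mem c (A c e) (V c e))"
  unfolding mem_def by (intro comp assms) auto

lemma computable_mkset [comp]:
  assumes "computableP (\<lambda>c e. P c (e 1) (\<lambda>j. e (j + 2)))"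
  shows "computable (\<lambda>c e. mkset c (\<lambda>v. P c v e))"
  unfolding mkset_def by (intro comp assms) auto

text \<open>The unit of size, \<open>2 ^ (k * L)\<close> for input length \<open>L\<close> as long
  as this fits. Level 1 is the digit base of the stack, 5 the number of iterations, 7 the counter
  offset, 8 infinity, 9 the digit base of threshold vectors.\<close>

definition scale :: "ctx \<Rightarrow> nat \<Rightarrow> nat" where
  "scale c k = cpow c 2 (cmul c k (length (fst c)))"

lemma computable_scale [comp]: "computable F \<Longrightarrow> computable (\<lambda>c e. scale c (F c e))"
  unfolding scale_def by (intro comp) auto

text \<open>Counter thresholds are stored with offset \<open>scale c 7\<close>, and \<open>scale c 8\<close> stands for infinity.\<close>

definition best :: "ctx \<Rightarrow> nat \<Rightarrow> nat \<Rightarrow> nat" where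
  "best c y v = rec_nat (scale c 8) (\<lambda>u a. if edge c v u \<and> dig c (scale c 9) y u < a
     then dig c (scale c 9) y u else a) (nstates c)"

text \<open>A step at \<open>v\<close> changes the counter by \<open>r1 - q\<close> or
  \<open>r0 - q\<close>; gain and loss are kept apart to remain in the natural numbers. A
  \<open>hi\<close>-state lowers the threshold to counter 0, a \<open>lo\<close>-state raises it to
  counter 1.\<close>

definition relax :: "ctx \<Rightarrow> nat \<Rightarrow> nat \<Rightarrow> nat \<Rightarrow> nat \<Rightarrow> nat \<Rightarrow> nat \<Rightarrow> nat \<Rightarrow> nat \<Rightarrow> nat" where
  "relax c A r1 r0 q lo hi y v =
     (let t = cadd c (best c y v) q - (if mem c A v then r1 else r0);
          t' = (if mem c hi v \<and> scale c 7 < t then scale c 7 else if scale c 8 < t then scale c 8 else t)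
      in if mem c lo v \<and> t' \<le> scale c 7 then csuc c (scale c 7) else t')"

definition thresholds :: "ctx \<Rightarrow> nat \<Rightarrow> nat \<Rightarrow> nat \<Rightarrow> nat \<Rightarrow> nat \<Rightarrow> nat \<Rightarrow> nat \<Rightarrow> nat \<Rightarrow> nat" where
  "thresholds c A r1 r0 q lo hi z k =
     rec_nat (mkvec c (\<lambda>v. z) (scale c 9) (nstates c))
       (\<lambda>i y. mkvec c (relax c A r1 r0 q lo hi y) (scale c 9) (nstates c)) k"

definition winning :: "ctx \<Rightarrow> nat \<Rightarrow> nat \<Rightarrow> nat \<Rightarrow> nat \<Rightarrow> nat \<Rightarrow> nat \<Rightarrow> nat \<Rightarrow> nat" where
  "winning c A r1 r0 q lo hi z =
     mkset c (\<lambda>v. dig c (scale c 9) (thresholds c A r1 r0 q lo hi z (scale c 5)) v \<le> scale c 7)"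

text \<open>With zero weights and no constraints, surviving all iterations means having an infinite
  path.\<close>

definition live :: "ctx \<Rightarrow> nat" where "live c = winning c 0 0 0 0 0 0 0"

definition set_and :: "ctx \<Rightarrow> nat \<Rightarrow> nat \<Rightarrow> nat" where
  "set_and c A B = mkset c (\<lambda>v. mem c A v \<and> mem c B v)"

definition set_not :: "ctx \<Rightarrow> nat \<Rightarrow> nat" where
  "set_not c A = mkset c (\<lambda>v. \<not> mem c A v)"

definition set_prop :: "ctx \<Rightarrow> nat \<Rightarrow> nat" where
  "set_prop c a = mkset c (\<lambda>v. label c v a)"

definition set_EX :: "ctx \<Rightarrow> nat \<Rightarrow> nat" where
  "set_EX c A = mkset c (\<lambda>v. \<exists>u<nstates c. edge c v u \<and> mem c (live c) u \<and> mem c A u)"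

definition set_AX :: "ctx \<Rightarrow> nat \<Rightarrow> nat" where
  "set_AX c A = mkset c (\<lambda>v. \<forall>u<nstates c. edge c v u \<and> mem c (live c) u \<longrightarrow> mem c A u)"

text \<open>The weights are \<open>m - n\<close> on \<open>A\<close> and \<open>- n\<close>
  elsewhere. Targets must be live because a finite witness has to extend to an infinite
  path.\<close>

definition set_EU :: "ctx \<Rightarrow> nat \<Rightarrow> nat \<Rightarrow> nat \<Rightarrow> nat \<Rightarrow> nat" where
  "set_EU c A n m B = winning c A m 0 n 0 (set_and c B (live c)) (scale c 8)"

text \<open>Complement of the states with a path whose counter is positive at every
  \<open>B\<close>-state. Weights are the negated ones, \<open>n - m\<close> on \<open>A\<close> and
  \<open>n\<close> elsewhere, written with gains \<open>n\<close> and \<open>n + m\<close> and loss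
  \<open>m\<close>.\<close>

definition set_AU :: "ctx \<Rightarrow> nat \<Rightarrow> nat \<Rightarrow> nat \<Rightarrow> nat \<Rightarrow> nat" where
  "set_AU c A n m B = set_not c (winning c A n (cadd c n m) m B 0 0)"

lemma computable_best [comp]:
  assumes "computable Y" "computable V" shows "computable (\<lambda>c e. best c (Y c e) (V c e))"
  unfolding best_def by (intro comp assms assms[THEN computable_weak]) auto

lemma computable_relax [comp]:
  assumes "computable A" "computable R1" "computable R0" "computable Q" "computable Lo" "computable Hi"
    "computable Y" "computable V"
  shows "computable (\<lambda>c e. relax c (A c e) (R1 c e) (R0 c e) (Q c e) (Lo c e) (Hi c e) (Y c e) (V c e))"
  unfolding relax_def Let_def by (intro comp assms) auto

lemma computable_thresholds [comp]:
  assumes "computable A" "computable R1" "computable R0" "computable Q" "computable Lo" "computable Hi"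
    "computable Z" "computable K"
  shows "computable (\<lambda>c e. thresholds c (A c e) (R1 c e) (R0 c e) (Q c e) (Lo c e) (Hi c e) (Z c e) (K c e))"
  unfolding thresholds_def by (intro comp assms assms[THEN computable_weak]) auto

lemma computable_winning [comp]:
  assumes "computable A" "computable R1" "computable R0" "computable Q" "computable Lo" "computable Hi"
    "computable Z"
  shows "computable (\<lambda>c e. winning c (A c e) (R1 c e) (R0 c e) (Q c e) (Lo c e) (Hi c e) (Z c e))"
  unfolding winning_def by (intro comp assms assms[THEN computable_weak]) auto

lemma computable_live [comp]: "computable (\<lambda>c e. live c)"
  unfolding live_def by (intro comp) auto

lemma computable_set_and [comp]:
  assumes "computable A" "computable B" shows "computable (\<lambda>c e. set_and c (A c e) (B c e))"
  unfolding set_and_def by (intro comp assms[THEN computable_weak])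

lemma computable_set_not [comp]:
  assumes "computable A" shows "computable (\<lambda>c e. set_not c (A c e))"
  unfolding set_not_def by (intro comp assms[THEN computable_weak])

lemma computable_set_prop [comp]:
  assumes "computable A" shows "computable (\<lambda>c e. set_prop c (A c e))"
  unfolding set_prop_def by (intro comp assms[THEN computable_weak])

lemma computable_set_EX [comp]:
  assumes "computable A" shows "computable (\<lambda>c e. set_EX c (A c e))"
  unfolding set_EX_def by (intro comp assms[THEN computable_weak])

lemma computable_set_AX [comp]:
  assumes "computable A" shows "computable (\<lambda>c e. set_AX c (A c e))"
  unfolding set_AX_def by (intro comp assms[THEN computable_weak])

lemma computable_set_EU [comp]:
  assumes "computable A" "computable N" "computable M" "computable B"
  shows "computable (\<lambda>c e. set_EU c (A c e) (N c e) (M c e) (B c e))"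
  unfolding set_EU_def by (intro comp assms) auto

lemma computable_set_AU [comp]:
  assumes "computable A" "computable N" "computable M" "computable B"
  shows "computable (\<lambda>c e. set_AU c (A c e) (N c e) (M c e) (B c e))"
  unfolding set_AU_def by (intro comp assms) auto

text \<open>The formula is in prefix notation and hence evaluated from right to left on a stack of state sets.\<close>

definition stack_push :: "ctx \<Rightarrow> nat \<Rightarrow> nat \<Rightarrow> nat" where
  "stack_push c a st = cadd c a (cmul c (scale c 1) st)"

definition stack_top :: "ctx \<Rightarrow> nat \<Rightarrow> nat" where "stack_top c st = st mod scale c 1"

definition stack_pop :: "ctx \<Rightarrow> nat \<Rightarrow> nat" where "stack_pop c st = st div scale c 1"

lemma computable_stack_push [comp]:
  assumes "computable A" "computable S" shows "computable (\<lambda>c e. stack_push c (A c e) (S c e))"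
  unfolding stack_push_def by (intro comp assms) auto

lemma computable_stack_top [comp]: "computable S \<Longrightarrow> computable (\<lambda>c e. stack_top c (S c e))"
  unfolding stack_top_def by (intro comp) auto

lemma computable_stack_pop [comp]: "computable S \<Longrightarrow> computable (\<lambda>c e. stack_pop c (S c e))"
  unfolding stack_pop_def by (intro comp) auto

text \<open>Symbols 11 and 12 leave the stack alone: a path operator is handled together with its
  quantifier, when its operands are already on the stack with the first one on top.\<close>

definition stack_step :: "ctx \<Rightarrow> nat \<Rightarrow> nat \<Rightarrow> nat" where
  "stack_step c p st =
    (let i = inp (fst c); p1 = csuc c p; p2 = csuc c p1; A = stack_top c st; B = stack_top c (stack_pop c st); st2 = stack_pop c (stack_pop c st)
     in if i p = 6 then stack_push c (set_prop c (num c p1)) st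
        else if i p = 7 then stack_push c (set_and c A B) st2
        else if i p = 8 then stack_push c (set_not c A) (stack_pop c st)
        else if i p = 9 then
          (if i p1 = 11 then stack_push c (set_EX c A) (stack_pop c st)
           else stack_push c (set_EU c A (num c p2) (num c (nxt c p2)) B) st2)
        else if i p = 10 then
          (if i p1 = 11 then stack_push c (set_AX c A) (stack_pop c st)
           else stack_push c (set_AU c A (num c p2) (num c (nxt c p2)) B) st2)
        else st)"

definition stack :: "ctx \<Rightarrow> nat \<Rightarrow> nat" where
  "stack c p = suffix_rec c 0 (stack_step c) p"

definition verdict :: "ctx \<Rightarrow> bool" where
  "verdict c \<longleftrightarrow> mem c (stack_top c (stack c 0)) (initial c) \<and> mem c (live c) (initial c)"

lemma computable_stack_step [comp]:
  assumes "computable P" "computable S" shows "computable (\<lambda>c e. stack_step c (P c e) (S c e))"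
  unfolding stack_step_def Let_def by (intro comp assms) auto

lemma computable_stack [comp]:
  assumes "computable P" shows "computable (\<lambda>c e. stack c (P c e))"
  unfolding stack_def by (intro comp assms) auto

lemma computable_verdict: "computableP (\<lambda>c e. verdict c)"
  unfolding verdict_def by (intro comp) auto

section \<open>Reading the input\<close>

lemma cadd_eq: "a \<le> snd c \<Longrightarrow> cadd c a b = min (snd c) (a + b)"
  by (induction b) (auto simp: cadd_def csuc_def)

lemma cmul_eq: "cmul c a b = min (snd c) (a * b)"
  by (induction b) (auto simp: cmul_def cadd_eq)

lemma cpow_eq: "0 < snd c \<Longrightarrow> cpow c a b = min (snd c) (a ^ b)"
proof (induction b)
  case (Suc b)
  have "cpow c a (Suc b) = min (snd c) (min (snd c) (a ^ b) * a)"
    using Suc by (simp add: cpow_def cmul_eq)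
  also have "\<dots> = min (snd c) (a ^ Suc b)"
  proof (cases "a ^ b \<le> snd c \<or> a = 0")
    case False
    then have "snd c \<le> snd c * a" "snd c \<le> a ^ b * a" by (auto intro: order_trans[of _ "a ^ b * 1"])
    with False show ?thesis by (simp add: mult.commute)
  qed (auto simp: mult.commute)
  finally show ?case .
qed (auto simp: cpow_def)

lemma suffix_rec_end: "length (fst c) \<le> p \<Longrightarrow> suffix_rec c z h p = z"
  by (simp add: suffix_rec_def)

lemma suffix_rec_step:
  "p < length (fst c) \<Longrightarrow> suffix_rec c z h p = h p (suffix_rec c z h (Suc p))"
proof -
  assume p: "p < length (fst c)"
  then have "length (fst c) - p = Suc (length (fst c) - Suc p)" by simp
  moreover have "length (fst c) - 1 - (length (fst c) - Suc p) = p" using p by simp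
  ultimately show ?thesis by (simp add: suffix_rec_def)
qed

lemma suffix_rec_eq:
  assumes "\<And>q. q < length (fst c) \<Longrightarrow> g q = h q (g (Suc q))" "g (length (fst c)) = z"
    "p \<le> length (fst c)"
  shows "suffix_rec c z h p = g p"
  using assms(3)
proof (induction rule: inc_induct)
  case base
  then show ?case using assms(2) by (simp add: suffix_rec_end)
next
  case (step n)
  then show ?case using assms(1) by (simp add: suffix_rec_step)
qed

section \<open>List versions of the parsing functions\<close>

fun numv :: "nat list \<Rightarrow> nat" where
  "numv [] = 0"
| "numv (a # xs) = (if a = 1 then 2 * numv xs else if a = 2 then 2 * numv xs + 1 else 0)"

fun aft :: "nat list \<Rightarrow> nat list" where
  "aft [] = []"
| "aft (a # xs) = (if a = 3 then xs else aft xs)"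

fun isn :: "nat list \<Rightarrow> bool" where
  "isn [] = False"
| "isn (a # xs) = (a = 1 \<or> a = 2 \<or> a = 3)"

fun isl :: "nat list \<Rightarrow> bool" where
  "isl [] = False"
| "isl (a # xs) = (a = 4 \<or> a = 5)"

fun rows :: "nat list \<Rightarrow> nat" where
  "rows [] = 0"
| "rows (a # xs) = (if a = 4 \<and> isl xs then Suc (rows xs) else rows xs)"

lemma numv_less: "numv xs < 2 ^ length xs"
  by (induction xs) auto

lemma rows_le: "rows xs \<le> length xs"
  by (induction xs) auto

lemma drop_inp: "p < length x \<Longrightarrow> drop p x = inp x p # drop (Suc p) x"
  by (simp add: inp_def Cons_nth_drop_Suc)

lemma csuc_less: "p < snd c \<Longrightarrow> csuc c p = Suc p"
  by (simp add: csuc_def)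

text \<open>\<open>big\<close> reflects the largest objects, threshold vectors: \<open>9 * L\<close>
  bits for each of at most \<open>L\<close> states.\<close>

locale checker =
  fixes c :: ctx and x :: "nat list" and W :: nat and L :: nat
  defines "x \<equiv> fst c" and "W \<equiv> snd c" and "L \<equiv> length x"
  assumes ok: "okc c" and L_pos: "0 < L" and big: "2 ^ (9 * L * L) \<le> W"
begin

lemma pow_le_W: "k \<le> 9 * L * L \<Longrightarrow> 2 ^ k \<le> W"
  using big by (meson one_le_numeral order_trans power_increasing)

lemma L_less_W: "L < W"
proof -
  have "L \<le> 9 * L * L" using L_pos by simp
  then have "2 ^ L \<le> W" by (rule pow_le_W)
  then show ?thesis by (meson less_exp less_le_trans)
qed

lemma csuc_L: "p \<le> L \<Longrightarrow> csuc c p = Suc p"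
  using L_less_W by (simp add: csuc_less W_def)

lemma is_num_iff: "is_num c p \<longleftrightarrow> isn (drop p x)"
  by (cases "p < L") (auto simp: is_num_def drop_inp L_def x_def[symmetric] inp_def)

lemma is_list_iff: "is_list c p \<longleftrightarrow> isl (drop p x)"
  by (cases "p < L") (auto simp: is_list_def drop_inp L_def x_def[symmetric] inp_def)

lemma num_eq:
  assumes "p \<le> L" shows "num c p = numv (drop p x)"
  unfolding num_def
proof (rule suffix_rec_eq)
  fix q assume q: "q < length (fst c)"
  define v where "v = numv (drop (Suc q) x)"
  have "v < 2 ^ (L - Suc q)" using numv_less[of "drop (Suc q) x"] by (simp add: v_def L_def)
  then have "2 * v + 1 < 2 * 2 ^ (L - Suc q)" by simp
  also have "\<dots> = 2 ^ (L - q)" using q by (simp add: L_def x_def flip: power_Suc Suc_diff_le)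
  also have "\<dots> \<le> W"
  proof (rule pow_le_W)
    have "L \<le> 9 * L * L" using L_pos by simp
    then show "L - q \<le> 9 * L * L" by linarith
  qed
  finally have v: "2 * v + 1 < W" .
  have "cadd c v v = 2 * v" "csuc c (2 * v) = Suc (2 * v)"
    using v by (simp_all add: cadd_eq W_def csuc_less)
  moreover have "drop q x = inp x q # drop (Suc q) x" using q by (simp add: drop_inp x_def[symmetric])
  ultimately show "numv (drop q x) =
           (if inp (fst c) q = 1 then cadd c (numv (drop (Suc q) x)) (numv (drop (Suc q) x))
            else if inp (fst c) q = 2
                 then csuc c (cadd c (numv (drop (Suc q) x)) (numv (drop (Suc q) x))) else 0)"
    by (simp add: v_def[symmetric] x_def[symmetric])
qed (use assms in \<open>auto simp: x_def L_def\<close>)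

lemma nxt_drop:
  assumes "p \<le> L" shows "nxt c p \<le> L \<and> drop (nxt c p) x = aft (drop p x)"
  using assms
proof (induction rule: inc_induct)
  case base
  then show ?case by (simp add: nxt_def suffix_rec_end L_def x_def)
next
  case (step n)
  have "nxt c n = (if inp x n = 3 then Suc n else nxt c (Suc n))"
    unfolding nxt_def using step suffix_rec_step[of n c] csuc_L[of n] by (simp add: L_def x_def)
  then show ?case using step drop_inp[of n x] by (auto simp: L_def)
qed

lemma row_count_eq:
  assumes "p \<le> L" shows "row_count c p = rows (drop p x)"
  unfolding row_count_def
proof (rule suffix_rec_eq)
  fix q assume q: "q < length (fst c)"
  have "rows (drop (Suc q) x) \<le> L" using rows_le[of "drop (Suc q) x"] by (simp add: L_def)
  then show "rows (drop q x) = (if inp (fst c) q = 4 \<and> is_list c (csuc c q) then csuc c (rows (drop (Suc q) x))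
            else rows (drop (Suc q) x))"
    using q csuc_L[of q] by (simp add: drop_inp x_def[symmetric] is_list_iff csuc_L L_def)
qed (use assms in \<open>auto simp: x_def L_def\<close>)

end

fun edges_of :: "nat list \<Rightarrow> (nat \<times> nat) set" where
  "edges_of [] = {}"
| "edges_of (a # xs) = (if a = 4 \<and> isn xs \<and> isn (aft xs) then {(numv xs, numv (aft xs))} else {}) \<union> edges_of xs"

fun labels_of :: "nat list \<Rightarrow> (nat \<times> nat) set" where
  "labels_of [] = {}"
| "labels_of (a # xs) = (if a = 4 \<and> isn xs \<and> isl (aft xs) then {(rows xs, numv xs)} else {}) \<union> labels_of xs"

lemma edges_of_drop: "(u, v) \<in> edges_of xs \<longleftrightarrow>
   (\<exists>p<length xs. xs ! p = 4 \<and> isn (drop (Suc p) xs) \<and> isn (aft (drop (Suc p) xs)) \<and>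
      numv (drop (Suc p) xs) = u \<and> numv (aft (drop (Suc p) xs)) = v)"
  by (induction xs) (auto simp: Ex_less_Suc2)

lemma labels_of_drop: "(u, v) \<in> labels_of xs \<longleftrightarrow>
   (\<exists>p<length xs. xs ! p = 4 \<and> isn (drop (Suc p) xs) \<and> isl (aft (drop (Suc p) xs)) \<and>
      rows (drop (Suc p) xs) = u \<and> numv (drop (Suc p) xs) = v)"
  by (induction xs) (auto simp: Ex_less_Suc2)

lemma enc_list_Nil [simp]: "enc_list f [] = [5]"
  by (simp add: enc_list_def)

lemma enc_list_Cons [simp]: "enc_list f (y # ys) = 4 # f y @ enc_list f ys"
  by (simp add: enc_list_def)

declare bits.simps [simp del]

lemma bits_symbols: "set (bits n) \<subseteq> {1, 2}"
  by (induction n rule: bits.induct) (subst bits.simps, auto)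

lemma numv_bits: "numv (bits n @ 3 # xs) = n"
proof (induction n rule: bits.induct)
  case (1 n)
  show ?case
  proof (cases "n = 0")
    case False
    then show ?thesis using 1 by (subst bits.simps) (auto simp: mod_2_eq_odd)
  qed (simp add: bits.simps)
qed

lemma aft_low: "3 \<notin> set ys \<Longrightarrow> aft (ys @ 3 # xs) = xs"
  by (induction ys) auto

lemma enc_nat_parse [simp]:
  "numv (enc_nat n @ xs) = n" "aft (enc_nat n @ xs) = xs" "isn (enc_nat n @ xs)" "\<not> isl (enc_nat n @ xs)"
proof -
  show "numv (enc_nat n @ xs) = n" by (simp add: enc_nat_def numv_bits)
  have "3 \<notin> set (bits n)" using bits_symbols[of n] by auto
  then show "aft (enc_nat n @ xs) = xs" by (simp add: enc_nat_def aft_low)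
  show "isn (enc_nat n @ xs)" "\<not> isl (enc_nat n @ xs)"
    using bits_symbols[of n] by (cases "bits n"; auto simp: enc_nat_def)+
qed

lemma isl_enc_list [simp]: "isl (enc_list f ys @ xs)" "\<not> isn (enc_list f ys @ xs)"
  by (cases ys; simp)+

text \<open>Edges, labels and rows are all introduced by symbol 4, so a stretch without it is
  transparent to them.\<close>

lemma no4:
  assumes "4 \<notin> set ys"
  shows "edges_of (ys @ xs) = edges_of xs" "labels_of (ys @ xs) = labels_of xs" "rows (ys @ xs) = rows xs"
  using assms by (induction ys) auto

lemma enc_nat_symbols: "set (enc_nat n) \<subseteq> {1, 2, 3}"
  using bits_symbols[of n] by (auto simp: enc_nat_def)

lemma no4_nat [simp]:
  "edges_of (enc_nat n @ xs) = edges_of xs" "labels_of (enc_nat n @ xs) = labels_of xs"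
  "rows (enc_nat n @ xs) = rows xs"
proof -
  have "4 \<notin> set (enc_nat n)" using enc_nat_symbols[of n] by auto
  from no4[OF this] show "edges_of (enc_nat n @ xs) = edges_of xs"
    "labels_of (enc_nat n @ xs) = labels_of xs" "rows (enc_nat n @ xs) = rows xs" by auto
qed

lemma edges_of_edges [simp]:
  "edges_of (enc_list (\<lambda>(a, b). enc_nat a @ enc_nat b) es @ xs) = set es \<union> edges_of xs"
  "labels_of (enc_list (\<lambda>(a, b). enc_nat a @ enc_nat b) es @ xs) = labels_of xs"
  "rows (enc_list (\<lambda>(a, b). enc_nat a @ enc_nat b) es @ xs) = rows xs"
  by (induction es) auto

lemma row_parse [simp]:
  "edges_of (enc_list enc_nat r @ xs) = edges_of xs"
  "labels_of (enc_list enc_nat r @ xs) = {rows xs} \<times> set r \<union> labels_of xs"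
  "rows (enc_list enc_nat r @ xs) = rows xs"
  by (induction r) auto

lemma rows_parse [simp]:
  "edges_of (enc_list (enc_list enc_nat) ls @ xs) = edges_of xs"
  "rows (enc_list (enc_list enc_nat) ls @ xs) = length ls + rows xs"
  by (induction ls) auto

lemma labels_parse:
  "labels_of (enc_list (enc_list enc_nat) ls @ xs) =
     (\<Union>i<length ls. {length ls - 1 - i + rows xs} \<times> set (ls ! i)) \<union> labels_of xs"
proof (induction ls)
  case (Cons r rs)
  have "(\<Union>i<length (r # rs). {length (r # rs) - 1 - i + rows xs} \<times> set ((r # rs) ! i))
    = ({length rs + rows xs} \<times> set r) \<union> (\<Union>i<length rs. {length rs - 1 - i + rows xs} \<times> set (rs ! i))"
    by (simp add: lessThan_Suc_eq_insert_0 image_UN)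
  then show ?case using Cons by auto
qed simp

lemma enc_fctl_symbols:
  "set (enc_fctl f) \<subseteq> {1, 2, 3, 6, 7, 8, 9, 10, 11, 12}" "set (enc_pfctl g) \<subseteq> {1, 2, 3, 6, 7, 8, 9, 10, 11, 12}"
proof (induction f and g)
  case (Until f n m g)
  then show ?case using enc_nat_symbols[of n] enc_nat_symbols[of m] by auto
next
  case (Prop p)
  then show ?case using enc_nat_symbols[of p] by auto
qed auto

lemma enc_list_symbols:
  "(\<And>y. set (f y) \<subseteq> {1, 2, 3, 4, 5}) \<Longrightarrow> set (enc_list f ys) \<subseteq> {1, 2, 3, 4, 5}"
  by (induction ys) auto

lemma enc_kripke_symbols: "set (enc_kripke K) \<subseteq> {1, 2, 3, 4, 5}"
proof -
  have n: "set (enc_nat n) \<subseteq> {1, 2, 3, 4, 5}" for n using enc_nat_symbols[of n] by auto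
  have "set (enc_list (enc_list enc_nat) (klabels K)) \<subseteq> {1, 2, 3, 4, 5}"
    by (intro enc_list_symbols n)
  moreover have "set (enc_list (\<lambda>(a, b). enc_nat a @ enc_nat b) (kedges K)) \<subseteq> {1, 2, 3, 4, 5}"
  proof (rule enc_list_symbols)
    show "set (case y of (a, b) \<Rightarrow> enc_nat a @ enc_nat b) \<subseteq> {1, 2, 3, 4, 5}" for y
      using n[of "fst y"] n[of "snd y"] by (cases y) simp
  qed
  ultimately show ?thesis using n[of "nst K"] n[of "kinit K"] unfolding enc_kripke_def set_append
    by (intro Un_least)
qed

lemma enc_input_symbols: "a \<in> set (enc_input K f) \<Longrightarrow> 0 < a \<and> a < 13"
  using enc_fctl_symbols(1)[of f] enc_kripke_symbols[of K] unfolding enc_input_def by fastforce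

locale checker_input = checker +
  fixes K phi
  assumes x_enc: "x = enc_input K phi" and wf: "kripke_wf K"
begin

lemma nstates_eq: "nstates c = nst K"
  unfolding nstates_def using num_eq[of 0] by (simp add: x_enc enc_input_def enc_kripke_def)

lemma initial_eq: "initial c = kinit K"
  unfolding initial_def using nxt_drop[of 0] num_eq[of "nxt c 0"]
  by (simp add: x_enc enc_input_def enc_kripke_def)

text \<open>The number of states is written in binary, but the labelling spends one row on each
  state. This keeps a vector over all states polynomially long.\<close>

lemma nst_le_L: "nst K \<le> L"
proof -
  have "nst K = length (klabels K)" using wf by (simp add: kripke_wf_def)
  also have "\<dots> \<le> rows x"
    by (simp add: x_enc enc_input_def enc_kripke_def)
  finally show ?thesis using rows_le[of x] by (simp add: L_def)
qed

lemma tail4: "edges_of (enc_fctl phi) = {}" "labels_of (enc_fctl phi) = {}" "rows (enc_fctl phi) = 0"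
proof -
  have "4 \<notin> set (enc_fctl phi)" using enc_fctl_symbols(1)[of phi] by auto
  from no4[OF this, of "[]"] show "edges_of (enc_fctl phi) = {}" "labels_of (enc_fctl phi) = {}"
    "rows (enc_fctl phi) = 0" by auto
qed

lemma edge_eq: "edge c u v \<longleftrightarrow> (u, v) \<in> set (kedges K)"
proof -
  have "edge c u v \<longleftrightarrow> (\<exists>p<L. x ! p = 4 \<and> isn (drop (Suc p) x) \<and> isn (aft (drop (Suc p) x)) \<and>
      numv (drop (Suc p) x) = u \<and> numv (aft (drop (Suc p) x)) = v)"
    unfolding edge_def x_def[symmetric] L_def[symmetric]
  proof (intro ex_cong1 conj_cong refl, goal_cases)
    case (1 p) then show ?case by (simp add: inp_def L_def)
  next
    case (2 p) then show ?case by (simp add: csuc_L is_num_iff)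
  next
    case (3 p) then show ?case using nxt_drop[of "Suc p"] by (simp add: csuc_L is_num_iff)
  next
    case (4 p) then show ?case by (simp add: csuc_L num_eq)
  next
    case (5 p) then show ?case using nxt_drop[of "Suc p"] num_eq[of "nxt c (Suc p)"] by (simp add: csuc_L)
  qed
  also have "\<dots> \<longleftrightarrow> (u, v) \<in> edges_of x" by (simp add: edges_of_drop L_def)
  also have "edges_of x = set (kedges K)"
    by (simp add: x_enc enc_input_def enc_kripke_def tail4)
  finally show ?thesis .
qed

lemma label_eq:
  assumes "s < nst K" shows "label c s a \<longleftrightarrow> a \<in> klab K s"
proof -
  have "label c s a \<longleftrightarrow> (\<exists>p<L. x ! p = 4 \<and> isn (drop (Suc p) x) \<and> isl (aft (drop (Suc p) x)) \<and>
      rows (drop (Suc p) x) = nst K - 1 - s \<and> numv (drop (Suc p) x) = a)"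
    unfolding label_def x_def[symmetric] L_def[symmetric] conj_commute[of "num c _ = a"]
  proof (intro ex_cong1 conj_cong refl, goal_cases)
    case (1 p) then show ?case by (simp add: inp_def L_def)
  next
    case (2 p) then show ?case by (simp add: csuc_L is_num_iff)
  next
    case (3 p) then show ?case using nxt_drop[of "Suc p"] by (simp add: csuc_L is_list_iff)
  next
    case (4 p) then show ?case by (simp add: csuc_L row_count_eq nstates_eq)
  next
    case (5 p) then show ?case by (simp add: csuc_L num_eq)
  qed
  also have "\<dots> \<longleftrightarrow> (nst K - 1 - s, a) \<in> labels_of x" by (simp add: labels_of_drop L_def)
  also have "\<dots> \<longleftrightarrow> (\<exists>i<nst K. nst K - 1 - s = nst K - 1 - i \<and> a \<in> set (klabels K ! i))"
    using wf by (simp add: x_enc enc_input_def enc_kripke_def tail4 labels_parse kripke_wf_def Bex_def)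
  also have "\<dots> \<longleftrightarrow> a \<in> klab K s"
  proof -
    have "nst K - 1 - s = nst K - 1 - i \<longleftrightarrow> i = s" if "i < nst K" for i using that assms by auto
    then show ?thesis using assms by (auto simp: klab_def)
  qed
  finally show ?thesis .
qed

end

section \<open>Paths with a counter\<close>

definition path :: "(nat \<times> nat) set \<Rightarrow> (nat \<Rightarrow> nat) \<Rightarrow> nat \<Rightarrow> bool" where
  "path E p j \<longleftrightarrow> (\<forall>i<j. (p i, p (Suc i)) \<in> E)"

definition ipath :: "(nat \<times> nat) set \<Rightarrow> (nat \<Rightarrow> nat) \<Rightarrow> bool" where
  "ipath E p \<longleftrightarrow> (\<forall>i. (p i, p (Suc i)) \<in> E)"

definition join :: "nat \<Rightarrow> (nat \<Rightarrow> nat) \<Rightarrow> (nat \<Rightarrow> nat) \<Rightarrow> nat \<Rightarrow> nat" where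
  "join a p q i = (if i < a then p i else q (i - a))"

lemma join_simps [simp]: "join a p q (a + i) = q i" "i < a \<Longrightarrow> join a p q i = p i"
  by (auto simp: join_def)

lemma join_0: "q 0 = p a \<Longrightarrow> join a p q 0 = p 0"
  by (auto simp: join_def)

lemma join_edge:
  "path E p a \<Longrightarrow> q 0 = p a \<Longrightarrow> i < a \<Longrightarrow> (join a p q i, join a p q (Suc i)) \<in> E"
  by (cases "Suc i = a") (auto simp: join_def path_def)

lemma join_path: "path E p a \<Longrightarrow> path E q l \<Longrightarrow> q 0 = p a \<Longrightarrow> path E (join a p q) (a + l)"
  unfolding path_def[of _ "join a p q"]
proof (intro allI impI)
  fix i assume "path E p a" "path E q l" "q 0 = p a" "i < a + l"
  then show "(join a p q i, join a p q (Suc i)) \<in> E"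
    using join_edge[of E p a q i] by (cases "i < a") (blast, simp add: join_def path_def Suc_diff_le)
qed

lemma join_ipath: "path E p a \<Longrightarrow> ipath E q \<Longrightarrow> q 0 = p a \<Longrightarrow> ipath E (join a p q)"
  unfolding ipath_def[of _ "join a p q"]
proof (intro allI impI)
  fix i assume "path E p a" "ipath E q" "q 0 = p a"
  then show "(join a p q i, join a p q (Suc i)) \<in> E"
    using join_edge[of E p a q i] by (cases "i < a") (blast, simp add: join_def ipath_def Suc_diff_le)
qed

lemma sum_join: "(\<Sum>i<a + l. w (join a p q i)) = (\<Sum>i<a. w (p i)) + (\<Sum>i<l. (w (q i) :: int))"
proof -
  have "(\<Sum>i<a + l. w (join a p q i)) = (\<Sum>i<a. w (join a p q i)) + (\<Sum>i<l. w (join a p q (a + i)))"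
    by (induction l) auto
  then show ?thesis by simp
qed

lemma sum_shift: "(\<Sum>i<(l::nat). w (p (b + i))) = (\<Sum>i<b + l. w (p i)) - (\<Sum>i<b. (w (p i) :: int))"
  by (induction l) auto

lemma path_shift: "path E p (b + l) \<Longrightarrow> path E (\<lambda>i. p (b + i)) l"
  by (auto simp: path_def)

lemma path_mono: "path E p b \<Longrightarrow> a \<le> b \<Longrightarrow> path E p a"
  by (auto simp: path_def)

lemma path_Cons: "path E (case_nat v p) (Suc j) \<longleftrightarrow> (v, p 0) \<in> E \<and> path E p j"
  by (auto simp: path_def less_Suc_eq_0_disj)

lemma ipath_Cons: "ipath E (case_nat v p) \<longleftrightarrow> (v, p 0) \<in> E \<and> ipath E p"
proof -
  have "(\<forall>n. P n) \<longleftrightarrow> P 0 \<and> (\<forall>n. P (Suc n))" for P by (metis not0_implies_Suc)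
  from this[of "\<lambda>i. (case_nat v p i, case_nat v p (Suc i)) \<in> E"] show ?thesis by (simp add: ipath_def)
qed

lemma path_less:
  assumes "path E p j" "E \<subseteq> {..<N} \<times> {..<N}" "p 0 < N" "i \<le> j" shows "p i < N"
proof (cases i)
  case (Suc k)
  then have "(p k, p i) \<in> E" using assms by (auto simp: path_def)
  then show ?thesis using assms(2) by auto
qed (use assms in simp)

text \<open>Splicing the prefix up to \<open>a\<close> with the suffix from \<open>b\<close> loses
  exactly the weight of the cycle in between.\<close>

lemma cut_path:
  assumes "path E p j" "a < b" "b \<le> j" "p a = p b"
  obtains q where "path E q (a + (j - b))" "q 0 = p 0" "q (a + (j - b)) = p j"
    "\<And>w. (\<Sum>i<a + (j - b). w (q i)) = (\<Sum>i<a. w (p i)) + (\<Sum>i<j. w (p i)) - (\<Sum>i<b. (w (p i) :: int))"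
proof
  let ?r = "\<lambda>i. p (b + i)"
  let ?q = "join a p ?r"
  have e: "?r 0 = p a" "b + (j - b) = j" using assms by auto
  show "path E ?q (a + (j - b))"
    using assms e by (intro join_path path_shift) (auto intro: path_mono)
  show "?q 0 = p 0" using e(1) by (rule join_0)
  show "?q (a + (j - b)) = p j" by (simp only: join_simps e)
  show "(\<Sum>i<a + (j - b). w (?q i)) = (\<Sum>i<a. w (p i)) + (\<Sum>i<j. w (p i)) - (\<Sum>i<b. (w (p i) :: int))" for w
    by (simp only: sum_join sum_shift e)
qed

lemma repeat_state:
  fixes p :: "nat \<Rightarrow> nat"
  assumes "\<And>i. i \<le> N \<Longrightarrow> p (k + i) < N"
  obtains a b where "k \<le> a" "a < b" "b \<le> k + N" "p a = p b"
proof -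
  have "\<not> inj_on (\<lambda>i. p (k + i)) {..N}"
  proof
    assume "inj_on (\<lambda>i. p (k + i)) {..N}"
    then have "card {..N} \<le> card {..<N}" using assms by (intro card_inj_on_le) auto
    then show False by simp
  qed
  then obtain x y where xy: "x \<le> N" "y \<le> N" "x \<noteq> y" "p (k + x) = p (k + y)"
    unfolding inj_on_def by auto
  then have "x < y \<or> y < x" by auto
  then show thesis using xy that[of "k + x" "k + y"] that[of "k + y" "k + x"] by auto
qed

lemma short_path:
  assumes "E \<subseteq> {..<N} \<times> {..<N}"
  shows "path E p j \<Longrightarrow> p 0 < N \<Longrightarrow> \<exists>q l. l \<le> N \<and> path E q l \<and> q 0 = p 0 \<and> q l = p j"
proof (induction j arbitrary: p rule: less_induct)
  case (less j)
  show ?case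
  proof (cases "j \<le> N")
    case False
    have "p (0 + i) < N" if "i \<le> N" for i
      using path_less[OF less.prems(1) assms less.prems(2), of i] that False by simp
    from repeat_state[of N p 0, OF this] obtain a b where ab: "a < b" "b \<le> N" "p a = p b" by auto
    obtain q where q: "path E q (a + (j - b))" "q 0 = p 0" "q (a + (j - b)) = p j"
      using cut_path[OF less.prems(1) ab(1) _ ab(3)] False ab by auto
    have "a + (j - b) < j" using ab False by simp
    from less.IH[OF this q(1)] q less.prems show ?thesis by auto
  qed (use less.prems in blast)
qed

text \<open>A step to a new state loses at most \<open>m\<close>, and a return to an old state
  leaves the counter above its earlier value there; so it never falls below \<open>- m * N\<close>.
  Increasing cycles also make all pairs of state and counter distinct, and only
  \<open>2 * m * N * N\<close> pairs have a counter between \<open>- m * N\<close> and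
  \<open>m * N\<close>. The lemma is used with \<open>w\<close> for until witnesses and with negated
  weights for safe paths.\<close>

lemma increasing_returns:
  fixes w :: "nat \<Rightarrow> int" and m N :: nat
  defines "C p \<equiv> \<lambda>i. \<Sum>k<i. w (p k :: nat)"
  assumes w: "\<And>v. - int m \<le> w v" and pN: "\<And>i. i \<le> J \<Longrightarrow> p i < N"
    and inc: "\<And>a b. a < b \<Longrightarrow> b \<le> J \<Longrightarrow> p a = p b \<Longrightarrow> C p a < C p b"
  shows "i \<le> J \<Longrightarrow> - int (m * N) \<le> C p i"
    and "I \<le> Suc J \<Longrightarrow> (\<And>i. i < I \<Longrightarrow> C p i < int (m * N)) \<Longrightarrow> I \<le> 2 * m * N * N"
proof -
  have card: "- int (m * card (p ` {..i})) \<le> C p i" if "i \<le> J" for i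
    using that
  proof (induction i rule: less_induct)
    case (less i)
    show ?case
    proof (cases i)
      case 0
      then show ?thesis by (simp add: C_def)
    next
      case (Suc k)
      show ?thesis
      proof (cases "p (Suc k) \<in> p ` {..k}")
        case True
        then obtain a where a: "a \<le> k" "p a = p (Suc k)" by auto
        have "card (p ` {..a}) \<le> card (p ` {..i})" using a Suc by (intro card_mono) auto
        then have "m * card (p ` {..a}) \<le> m * card (p ` {..i})" by (rule mult_le_mono2)
        moreover have "- int (m * card (p ` {..a})) \<le> C p a" using less.IH[of a] less.prems a Suc by simp
        moreover have "C p a < C p i" using inc[of a i] a Suc less.prems by simp
        ultimately show ?thesis by linarith
      next
        case False
        have "card (p ` {..i}) = Suc (card (p ` {..k}))" using False Suc by (simp add: atMost_Suc)
        moreover have "- int (m * card (p ` {..k})) \<le> C p k" using less.IH[of k] less.prems Suc by simp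
        moreover have "C p i = C p k + w (p k)" using Suc by (simp add: C_def)
        ultimately show ?thesis using w[of "p k"] by (simp add: algebra_simps)
      qed
    qed
  qed
  show lower: "- int (m * N) \<le> C p i" if "i \<le> J" for i
  proof -
    have "p ` {..i} \<subseteq> {..<N}" using pN that by auto
    then have "card (p ` {..i}) \<le> N" using card_mono[of "{..<N}"] by fastforce
    then have "m * card (p ` {..i}) \<le> m * N" by (rule mult_le_mono2)
    with card[OF that] show ?thesis by linarith
  qed
  assume I: "I \<le> Suc J" and up: "\<And>i. i < I \<Longrightarrow> C p i < int (m * N)"
  let ?f = "\<lambda>i. (p i, C p i)"
  have "inj_on ?f {..<I}"
  proof (rule linorder_inj_onI)
    fix a b assume "a < b" "a \<in> {..<I}" "b \<in> {..<I}"
    then show "?f a \<noteq> ?f b" using inc[of a b] I by auto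
  qed auto
  moreover have "?f ` {..<I} \<subseteq> {..<N} \<times> {- int (m * N)..<int (m * N)}"
    using pN lower up I by auto
  ultimately have "card {..<I} \<le> card ({..<N} \<times> {- int (m * N)..<int (m * N)})"
    by (intro card_inj_on_le) auto
  moreover have "nat (int (m * N) - - int (m * N)) = 2 * m * N" by (subst nat_eq_iff) simp
  ultimately show "I \<le> 2 * m * N * N" by (simp add: card_cartesian_product mult.commute)
qed

text \<open>\<open>win E w lo hi z k v c\<close>: starting in \<open>v\<close> with counter \<open>c\<close>, some path of at most \<open>k\<close> steps
never meets a \<open>lo\<close>-state with a counter below 1 and either ends in a \<open>hi\<close>-state with nonnegative
counter or, provided \<open>z\<close>, survives for \<open>k\<close> steps. Being monotone in \<open>c\<close>, it is described by one
threshold per state. Existential until is the case without \<open>lo\<close>, and the negation of universal until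
is the case without \<open>hi\<close>.\<close>

primrec win :: "(nat \<times> nat) set \<Rightarrow> (nat \<Rightarrow> int) \<Rightarrow> (nat \<Rightarrow> bool) \<Rightarrow> (nat \<Rightarrow> bool) \<Rightarrow> bool \<Rightarrow>
    nat \<Rightarrow> nat \<Rightarrow> int \<Rightarrow> bool" where
  "win E w lo hi z 0 v c = z"
| "win E w lo hi z (Suc k) v c =
     ((lo v \<longrightarrow> 1 \<le> c) \<and> (hi v \<and> 0 \<le> c \<or> (\<exists>u. (v, u) \<in> E \<and> win E w lo hi z k u (c + w v))))"

lemma sum_0_shift: "(\<Sum>i<Suc j. w (p i)) = w (p 0) + (\<Sum>i<j. (w (p (Suc i)) :: int))"
  using sum.lessThan_Suc_shift[of "\<lambda>i. w (p i)" j] by simp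

lemma win_reach:
  "win E w (\<lambda>_. False) hi False k v c \<longleftrightarrow>
   (\<exists>j<k. \<exists>p. p 0 = v \<and> path E p j \<and> hi (p j) \<and> 0 \<le> c + (\<Sum>i<j. w (p i)))"
proof (induction k arbitrary: v c)
  case (Suc k)
  have "(\<exists>j<Suc k. \<exists>p. p 0 = v \<and> path E p j \<and> hi (p j) \<and> 0 \<le> c + (\<Sum>i<j. w (p i)))
    \<longleftrightarrow> hi v \<and> 0 \<le> c \<or> (\<exists>j<k. \<exists>p. p 0 = v \<and> path E p (Suc j) \<and> hi (p (Suc j)) \<and> 0 \<le> c + (\<Sum>i<Suc j. w (p i)))"
    (is "_ \<longleftrightarrow> _ \<or> ?A") unfolding Ex_less_Suc2
    by (intro arg_cong2[of _ _ _ _ "(\<or>)"] refl) (auto simp: path_def intro!: exI[of _ "\<lambda>_. v"])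
  also have "?A \<longleftrightarrow> (\<exists>u. (v, u) \<in> E \<and> (\<exists>j<k. \<exists>p. p 0 = u \<and> path E p j \<and> hi (p j) \<and> 0 \<le> c + w v + (\<Sum>i<j. w (p i))))"
  proof safe
    fix j p assume h: "j < k" "path E p (Suc j)" "hi (p (Suc j))" "0 \<le> c + (\<Sum>i<Suc j. w (p i))" "v = p 0"
    then have "(p 0, p 1) \<in> E" "path E (\<lambda>i. p (Suc i)) j" by (auto simp: path_def)
    with h show "\<exists>u. (p 0, u) \<in> E \<and> (\<exists>j<k. \<exists>q. q 0 = u \<and> path E q j \<and> hi (q j) \<and> 0 \<le> c + w (p 0) + (\<Sum>i<j. w (q i)))"
      by (intro exI[of _ "p 1"] conjI exI[of _ j] exI[of _ "\<lambda>i. p (Suc i)"]) (auto simp: sum_0_shift simp del: sum.lessThan_Suc)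
  next
    fix j p assume h: "(v, p 0) \<in> E" "j < k" "path E p j" "hi (p j)" "0 \<le> c + w v + (\<Sum>i<j. w (p i))"
    let ?q = "case_nat v p"
    have "path E ?q (Suc j)" using h by (simp only: path_Cons simp_thms)
    with h show "\<exists>j<k. \<exists>p. p 0 = v \<and> path E p (Suc j) \<and> hi (p (Suc j)) \<and> 0 \<le> c + (\<Sum>i<Suc j. w (p i))"
      by (intro exI[of _ j] conjI exI[of _ ?q]) (simp_all add: sum_0_shift add.assoc del: sum.lessThan_Suc)
  qed
  finally show ?case by (simp add: Suc)
qed simp

lemma win_safe:
  "win E w lo (\<lambda>_. False) True k v c \<longleftrightarrow>
   (\<exists>p. p 0 = v \<and> path E p k \<and> (\<forall>j<k. lo (p j) \<longrightarrow> 1 \<le> c + (\<Sum>i<j. w (p i))))"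
proof (induction k arbitrary: v c)
  case 0
  then show ?case by (auto simp: path_def intro!: exI[of _ "\<lambda>_. v"])
next
  case (Suc k)
  have "(\<exists>p. p 0 = v \<and> path E p (Suc k) \<and> (\<forall>j<Suc k. lo (p j) \<longrightarrow> 1 \<le> c + (\<Sum>i<j. w (p i)))) \<longleftrightarrow>
    (lo v \<longrightarrow> 1 \<le> c) \<and> (\<exists>u. (v, u) \<in> E \<and>
       (\<exists>p. p 0 = u \<and> path E p k \<and> (\<forall>j<k. lo (p j) \<longrightarrow> 1 \<le> c + w v + (\<Sum>i<j. w (p i)))))"
    (is "?l \<longleftrightarrow> ?r")
  proof
    assume ?l
    then obtain p where h: "p 0 = v" "path E p (Suc k)" "\<And>j. j < Suc k \<Longrightarrow> lo (p j) \<Longrightarrow> 1 \<le> c + (\<Sum>i<j. w (p i))"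
      by auto
    then have "(v, p 1) \<in> E" "path E (\<lambda>i. p (Suc i)) k" by (auto simp: path_def)
    moreover have "1 \<le> c + w v + (\<Sum>i<j. w (p (Suc i)))" if "j < k" "lo (p (Suc j))" for j
      using h(3)[of "Suc j"] that h(1) by (simp add: sum_0_shift del: sum.lessThan_Suc)
    ultimately show ?r using h(1) h(3)[of 0]
      by (intro conjI exI[of _ "p 1"] exI[of _ "\<lambda>i. p (Suc i)"]) auto
  next
    assume ?r
    then obtain p where h: "lo v \<longrightarrow> 1 \<le> c" "(v, p 0) \<in> E" "path E p k"
      "\<And>j. j < k \<Longrightarrow> lo (p j) \<Longrightarrow> 1 \<le> c + w v + (\<Sum>i<j. w (p i))" by auto
    let ?q = "case_nat v p"
    have "path E ?q (Suc k)" using h by (simp only: path_Cons simp_thms)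
    moreover have "1 \<le> c + (\<Sum>i<j. w (?q i))" if "j < Suc k" "lo (?q j)" for j
      using that h(1) h(4) by (cases j) (auto simp: sum_0_shift add.assoc simp del: sum.lessThan_Suc)
    ultimately show ?l by (intro exI[of _ ?q]) auto
  qed
  then show ?case by (simp add: Suc)
qed

text \<open>In a shortest witness every cycle increases the counter. Once the counter exceeds \<open>m * N\<close>, a
shortest path to the target suffices, and before that no pair of state and counter repeats.\<close>

lemma reach_bound:
  fixes w :: "nat \<Rightarrow> int"
  assumes E: "E \<subseteq> {..<N} \<times> {..<N}" and w: "\<And>v. - int m \<le> w v" and v: "v < N"
    and p: "p 0 = v" "path E p j" "hi (p j)" "0 \<le> (\<Sum>i<j. w (p i))"
  shows "\<exists>j \<le> 2 * m * N * N + N. \<exists>p. p 0 = v \<and> path E p j \<and> hi (p j) \<and> 0 \<le> (\<Sum>i<j. w (p i))"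
proof -
  define P where "P j p \<longleftrightarrow> p 0 = v \<and> path E p j \<and> hi (p j) \<and> 0 \<le> (\<Sum>i<j. w (p i))" for j p
  define j where "j = (LEAST j. \<exists>p. P j p)"
  have ex: "\<exists>j p. P j p" using p unfolding P_def by blast
  have "\<exists>p. P j p" unfolding j_def by (rule LeastI_ex[OF ex])
  then obtain p where p: "P j p" ..
  have min: "j \<le> j'" if "P j' q" for j' q unfolding j_def using that by (intro Least_le) blast
  have pj: "path E p j" "p 0 = v" "hi (p j)" "0 \<le> (\<Sum>i<j. w (p i))" using p by (auto simp: P_def)
  have pN: "p i < N" if "i \<le> j" for i using path_less[OF pj(1) E _ that] pj v by simp
  have inc: "(\<Sum>i<a. w (p i)) < (\<Sum>i<b. w (p i))" if ab: "a < b" "b \<le> j" "p a = p b" for a b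
  proof (rule ccontr)
    assume n: "\<not> ?thesis"
    obtain q where "path E q (a + (j - b))" "q 0 = p 0" "q (a + (j - b)) = p j"
      "(\<Sum>i<a + (j - b). w (q i)) = (\<Sum>i<a. w (p i)) + (\<Sum>i<j. w (p i)) - (\<Sum>i<b. w (p i))"
      using cut_path[OF pj(1) ab] by metis
    then have "P (a + (j - b)) q" using pj n by (auto simp: P_def)
    from min[OF this] show False using ab by simp
  qed
  note R = increasing_returns[where w = w and m = m and N = N and p = p and J = j, OF w pN inc]
  have "j \<le> 2 * m * N * N + N"
  proof (cases "\<exists>i\<le>j. int (m * N) \<le> (\<Sum>k<i. w (p k))")
    case True
    define i where "i = (LEAST i. int (m * N) \<le> (\<Sum>k<i. w (p k)))"
    have i: "int (m * N) \<le> (\<Sum>k<i. w (p k))" "i \<le> j"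
      using True LeastI[of "\<lambda>i. int (m * N) \<le> (\<Sum>k<i. w (p k))"] Least_le[of "\<lambda>i. int (m * N) \<le> (\<Sum>k<i. w (p k))"]
      unfolding i_def by (blast intro: order_trans)+
    have "(\<Sum>k<i'. w (p k)) < int (m * N)" if "i' < i" for i'
      using not_less_Least[of i' "\<lambda>i. int (m * N) \<le> (\<Sum>k<i. w (p k))"] that unfolding i_def by simp
    then have il: "i \<le> 2 * m * N * N" using i(2) by (intro R(2)) auto
    have "path E (\<lambda>k. p (i + k)) (j - i)" using pj(1) i(2) by (intro path_shift) simp
    from short_path[OF E this] pN[of i] i(2)
    obtain q l where q: "l \<le> N" "path E q l" "q 0 = p i" "q l = p j" by auto
    let ?r = "join i p q"
    have r: "path E ?r (i + l)" using path_mono[OF pj(1) i(2)] q by (intro join_path) auto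
    \<comment> \<open>The at most \<open>N\<close> steps to the target lose at most
      \<open>m * N\<close>, which the counter at \<open>i\<close> covers.\<close>
    have "- int (m * l) \<le> (\<Sum>k<l. w (q k))"
      using sum_bounded_below[of "{..<l}" "- int m" "\<lambda>k. w (q k)"] w by (simp add: mult.commute)
    moreover have "m * l \<le> m * N" using q by simp
    ultimately have "0 \<le> (\<Sum>k<i + l. w (?r k))" using i(1) by (simp only: sum_join)
    then have "P (i + l) ?r" using r q pj join_0[of q p i] by (auto simp: P_def)
    from min[OF this] il q show ?thesis by simp
  next
    case False
    then have "(\<Sum>k<i. w (p k)) < int (m * N)" if "i < Suc j" for i
      using that less_Suc_eq_le not_le by blast
    then have "Suc j \<le> 2 * m * N * N" by (intro R(2)) auto
    then show ?thesis by simp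
  qed
  then show ?thesis using p unfolding P_def by blast
qed

text \<open>Dependent choice inside a set \<open>X\<close> of configurations each of which has a
  step staying in \<open>X\<close>. Both kinds of cycle in the next lemma are presented as such an
  \<open>X\<close>.\<close>

lemma invariant_path:
  fixes w :: "nat \<Rightarrow> int"
  assumes X: "\<And>v c. X v c \<Longrightarrow> (lo v \<longrightarrow> 1 \<le> c) \<and> (\<exists>u. (v, u) \<in> E \<and> X u (c + w v))" and v: "X v c"
  shows "\<exists>p. p 0 = v \<and> ipath E p \<and> (\<forall>j. lo (p j) \<longrightarrow> 1 \<le> c + (\<Sum>i<j. w (p i)))"
proof -
  have "\<exists>f. \<forall>n. (case f n of (v', c') \<Rightarrow> X v' c' \<and> (n = 0 \<longrightarrow> v' = v \<and> c' = c)) \<and>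
     (fst (f n), fst (f (Suc n))) \<in> E \<and> snd (f (Suc n)) = snd (f n) + w (fst (f n))"
  proof (rule dependent_nat_choice, goal_cases)
    case 1
    show ?case using v by (intro exI[of _ "(v, c)"]) simp
  next
    case (2 x n)
    then obtain u where "(fst x, u) \<in> E" "X u (snd x + w (fst x))" using X by (cases x) fastforce
    then show ?case by (intro exI[of _ "(u, snd x + w (fst x))"]) simp
  qed
  then obtain f where F: "\<forall>n. (case f n of (v', c') \<Rightarrow> X v' c' \<and> (n = 0 \<longrightarrow> v' = v \<and> c' = c)) \<and>
     (fst (f n), fst (f (Suc n))) \<in> E \<and> snd (f (Suc n)) = snd (f n) + w (fst (f n))" ..
  have f: "case f n of (v', c') \<Rightarrow> X v' c' \<and> (n = 0 \<longrightarrow> v' = v \<and> c' = c)"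
     "(fst (f n), fst (f (Suc n))) \<in> E" "snd (f (Suc n)) = snd (f n) + w (fst (f n))" for n
    using spec[OF F, of n] by (simp_all only: simp_thms)
  have f0: "fst (f 0) = v" "snd (f 0) = c" using f(1)[of 0] by (auto split: prod.splits)
  have s: "snd (f n) = c + (\<Sum>i<n. w (fst (f i)))" for n
    by (induction n) (auto simp: f0 f(3))
  have "lo (fst (f n)) \<longrightarrow> 1 \<le> snd (f n)" for n using f(1)[of n] X by (auto split: prod.splits)
  then show ?thesis using f(2) f0 s by (intro exI[of _ "\<lambda>n. fst (f n)"]) (auto simp: ipath_def)
qed

text \<open>A cycle that does not decrease the counter can be pumped. If there is none, the counter falls below
\<open>- m * N\<close>, hence stays nonpositive for \<open>N\<close> steps, and the cycle found there avoids \<open>lo\<close>.\<close>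

lemma safe_bound:
  fixes w :: "nat \<Rightarrow> int"
  assumes E: "E \<subseteq> {..<N} \<times> {..<N}" and w: "\<And>v. w v \<le> int m" and v: "v < N"
    and K: "2 * m * N * N + N \<le> K"
    and p: "p 0 = v" "path E p K" "\<And>j. j < K \<Longrightarrow> lo (p j) \<Longrightarrow> 1 \<le> (\<Sum>i<j. w (p i))"
  shows "\<exists>p. p 0 = v \<and> ipath E p \<and> (\<forall>j. lo (p j) \<longrightarrow> 1 \<le> (\<Sum>i<j. w (p i)))"
proof -
  let ?c = "\<lambda>j. \<Sum>i<j. w (p i)"
  have pN: "p i < N" if "i \<le> K" for i using path_less[OF p(2) E _ that] p v by simp
  have pE: "(p i, p (Suc i)) \<in> E" if "i < K" for i using p(2) that by (simp add: path_def)
  have N: "0 < N" using v by simp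
  show ?thesis
  proof (cases "\<exists>a b. a < b \<and> b \<le> K \<and> p a = p b \<and> ?c a \<le> ?c b")
    case True
    then obtain a b where ab: "a < b" "b \<le> K" "p a = p b" "?c a \<le> ?c b" by blast
    \<comment> \<open>Configurations with at least the counter of the path at some index before
      \<open>b\<close>. The step that closes the cycle stays inside because
      \<open>?c a \<le> ?c b\<close>.\<close>
    let ?X = "\<lambda>v c. \<exists>i<b. v = p i \<and> ?c i \<le> c"
    have "(lo v \<longrightarrow> 1 \<le> c) \<and> (\<exists>u. (v, u) \<in> E \<and> ?X u (c + w v))" if "?X v c" for v c
    proof -
      obtain i where i: "i < b" "v = p i" "?c i \<le> c" using \<open>?X v c\<close> by blast
      have "lo v \<longrightarrow> 1 \<le> c" using p(3)[of i] i ab by fastforce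
      moreover have "?X (p (Suc i)) (c + w v)"
      proof (cases "Suc i = b")
        case True
        have "?c b = ?c i + w (p i)" using True[symmetric] by simp
        then show ?thesis using i ab True by (intro exI[of _ a]) auto
      next
        case False
        then show ?thesis using i by (intro exI[of _ "Suc i"]) auto
      qed
      moreover have "(v, p (Suc i)) \<in> E" using pE[of i] i ab by simp
      ultimately show ?thesis by blast
    qed
    from invariant_path[of ?X lo E w v 0, OF this] show ?thesis using p(1) ab by fastforce
  next
    case False
    \<comment> \<open>Every cycle loses, hence is increasing for the negated weights.\<close>
    have inc: "(\<Sum>i<a. - w (p i)) < (\<Sum>i<b. - w (p i))" if "a < b" "b \<le> K" "p a = p b" for a b
      using False that by (force simp: sum_negf)
    have w': "- int m \<le> - w v" for v using w[of v] by simp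
    note R = increasing_returns[where w = "\<lambda>v. - w v" and m = m and N = N and p = p and J = K, OF w' pN inc]
    \<comment> \<open>The bound \<open>K - N\<close> leaves \<open>N\<close> more steps of the given
      path, in which a cycle can be found.\<close>
    have "\<exists>i\<le>K - N. \<not> (\<Sum>k<i. - w (p k)) < int (m * N)"
    proof (rule ccontr)
      assume "\<not> ?thesis"
      then have "(\<Sum>k<i. - w (p k)) < int (m * N)" if "i < Suc (K - N)" for i
        using that less_Suc_eq_le by blast
      then have "Suc (K - N) \<le> 2 * m * N * N" by (intro R(2)) auto
      then show False using K by linarith
    qed
    then obtain k where k: "k \<le> K - N" "?c k \<le> - int (m * N)" by (auto simp: sum_negf)
    have kK: "k + N \<le> K" using k K by linarith
    \<comment> \<open>Starting at \<open>- m * N\<close> or lower, \<open>N\<close> steps cannot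
      lift the counter above 0, while a \<open>lo\<close>-state would require at least 1.\<close>
    have low: "?c (k + i) \<le> 0" if "i \<le> N" for i
    proof -
      have "(\<Sum>l<i. w (p (k + l))) \<le> int (m * i)"
        using sum_bounded_above[of "{..<i}" "\<lambda>l. w (p (k + l))" "int m"] w by (simp add: mult.commute)
      moreover have "m * i \<le> m * N" using that by simp
      ultimately show ?thesis using k(2) unfolding sum_shift by linarith
    qed
    have "p (k + i) < N" if "i \<le> N" for i using pN[of "k + i"] that kK by simp
    from repeat_state[of N p k, OF this] obtain a b where ab: "k \<le> a" "a < b" "b \<le> k + N" "p a = p b" by blast
    have nlo: "\<not> lo (p i)" if "a \<le> i" "i < b" for i
    proof -
      have "?c (k + (i - k)) \<le> 0" by (rule low) (use that ab in auto)
      then show ?thesis using p(3)[of i] that ab kK by fastforce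
    qed
    \<comment> \<open>From \<open>a\<close> on the counter is arbitrary, since the states of the
      cycle avoid \<open>lo\<close>; only before \<open>a\<close> must it be that of the
      path.\<close>
    let ?X = "\<lambda>v c. \<exists>i<b. v = p i \<and> (i < a \<longrightarrow> c = ?c i)"
    have "(lo v \<longrightarrow> 1 \<le> c) \<and> (\<exists>u. (v, u) \<in> E \<and> ?X u (c + w v))" if "?X v c" for v c
    proof -
      obtain i where i: "i < b" "v = p i" "i < a \<longrightarrow> c = ?c i" using \<open>?X v c\<close> by blast
      have "lo v \<longrightarrow> 1 \<le> c" using p(3)[of i] nlo[of i] i ab kK by (cases "i < a") auto
      moreover have "?X (p (Suc i)) (c + w v)"
      proof (cases "Suc i = b")
        case True
        then show ?thesis using i ab by (intro exI[of _ a]) auto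
      next
        case False
        then show ?thesis using i by (intro exI[of _ "Suc i"]) auto
      qed
      moreover have "(v, p (Suc i)) \<in> E" using pE[of i] i ab kK by simp
      ultimately show ?thesis by blast
    qed
    from invariant_path[of ?X lo E w v 0, OF this] show ?thesis using p(1) ab by fastforce
  qed
qed

section \<open>State semantics of fCTL\<close>

primrec st :: "kripke \<Rightarrow> fctl \<Rightarrow> nat \<Rightarrow> bool"
  and pst :: "kripke \<Rightarrow> pfctl \<Rightarrow> (nat \<Rightarrow> nat) \<Rightarrow> bool" where
  "st K (Prop a) v = (a \<in> klab K v)"
| "st K (And f g) v = (st K f v \<and> st K g v)"
| "st K (Neg f) v = (\<not> st K f v)"
| "st K (Ex b) v = (\<exists>p. p 0 = v \<and> ipath (set (kedges K)) p \<and> pst K b p)"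
| "st K (All b) v = (\<forall>p. p 0 = v \<and> ipath (set (kedges K)) p \<longrightarrow> pst K b p)"
| "pst K (Next f) p = st K f (p 1)"
| "pst K (Until f n m g) p = (st K g (p 0) \<or>
     (\<exists>k. st K g (p (Suc k)) \<and> n * (k + 1) \<le> m * card {j. j \<le> k \<and> st K f (p j)}))"

lemma run_suffix: "is_run K r \<Longrightarrow> ipath (set (kedges K)) (\<lambda>j. r (i + j))"
  by (simp add: is_run_def ipath_def)

lemma run_switch:
  assumes "is_run K r" "p 0 = r i" "ipath (set (kedges K)) p"
  shows "is_run K (join i r p) \<and> (\<forall>j\<le>i. join i r p j = r j) \<and> (\<lambda>j. join i r p (i + j)) = p"
proof -
  have "path (set (kedges K)) r i" using assms(1) by (simp add: path_def is_run_def)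
  then have "ipath (set (kedges K)) (join i r p)" using assms by (intro join_ipath)
  moreover have "join i r p j = r j" if "j \<le> i" for j using that assms(2) by (auto simp: join_def)
  ultimately show ?thesis using assms(1) by (simp add: is_run_def ipath_def)
qed

text \<open>Runs that agree with \<open>r\<close> up to \<open>i\<close> correspond to infinite
  paths from \<open>r i\<close>, by taking suffixes in one direction and splicing in the other. So
  the past has no influence on path quantifiers.\<close>

lemma sat_st:
  "is_run K r \<Longrightarrow> sat K r i f = st K f (r i)"
  "is_run K r \<Longrightarrow> psat K r i b = pst K b (\<lambda>j. r (i + j))"
proof (induction f and b arbitrary: r i and r i)
  case (Ex b)
  have "(\<exists>r'. is_run K r' \<and> (\<forall>j\<le>i. r' j = r j) \<and> psat K r' i b) \<longleftrightarrow>
      (\<exists>p. p 0 = r i \<and> ipath (set (kedges K)) p \<and> pst K b p)"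
  proof safe
    fix r' assume "is_run K r'" "\<forall>j\<le>i. r' j = r j" "psat K r' i b"
    then show "\<exists>p. p 0 = r i \<and> ipath (set (kedges K)) p \<and> pst K b p"
      using Ex.IH[of r' i] run_suffix[of K r' i] by (intro exI[of _ "\<lambda>j. r' (i + j)"]) simp
  next
    fix p assume p: "p 0 = r i" "ipath (set (kedges K)) p" "pst K b p"
    then show "\<exists>r'. is_run K r' \<and> (\<forall>j\<le>i. r' j = r j) \<and> psat K r' i b"
      using Ex.IH[of "join i r p" i] run_switch[OF Ex.prems p(1,2)] by (intro exI[of _ "join i r p"]) simp
  qed
  then show ?case by simp
next
  case (All b)
  have "(\<exists>r'. is_run K r' \<and> (\<forall>j\<le>i. r' j = r j) \<and> \<not> psat K r' i b) \<longleftrightarrow>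
      (\<exists>p. p 0 = r i \<and> ipath (set (kedges K)) p \<and> \<not> pst K b p)"
  proof safe
    fix r' assume "is_run K r'" "\<forall>j\<le>i. r' j = r j" "\<not> psat K r' i b"
    then show "\<exists>p. p 0 = r i \<and> ipath (set (kedges K)) p \<and> \<not> pst K b p"
      using All.IH[of r' i] run_suffix[of K r' i] by (intro exI[of _ "\<lambda>j. r' (i + j)"]) simp
  next
    fix p assume p: "p 0 = r i" "ipath (set (kedges K)) p" "\<not> pst K b p"
    then show "\<exists>r'. is_run K r' \<and> (\<forall>j\<le>i. r' j = r j) \<and> \<not> psat K r' i b"
      using All.IH[of "join i r p" i] run_switch[OF All.prems p(1,2)] by (intro exI[of _ "join i r p"]) simp
  qed
  then show ?case by (simp only: sat.simps st.simps) blast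
next
  case (Until f n m g)
  have c: "card {j \<in> {i..i + k}. sat K r j f} = card {j. j \<le> k \<and> st K f (r (i + j))}" for k
  proof -
    have "{j \<in> {i..i + k}. sat K r j f} = (+) i ` {j. j \<le> k \<and> st K f (r (i + j))}"
      using Until.IH(1)[OF Until.prems] by (auto simp: image_iff) (metis add_le_cancel_left le_Suc_ex)
    then show ?thesis by (simp add: card_image)
  qed
  have "(\<exists>k\<ge>i. sat K r (Suc k) g \<and> n * (k - i + 1) \<le> m * card {j \<in> {i..k}. sat K r j f})
     \<longleftrightarrow> (\<exists>k. sat K r (Suc (i + k)) g \<and> n * (k + 1) \<le> m * card {j \<in> {i..i + k}. sat K r j f})"
    unfolding le_iff_add by (auto simp: add.commute[of i])
  from this[unfolded c Until.IH(2)[OF Until.prems]] show ?case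
    by (simp only: psat.simps pst.simps Until.IH(2)[OF Until.prems] add_0_right add_Suc_right)
qed auto

text \<open>Satisfaction presupposes that some run exists, which \<open>st\<close> does not express:
  for instance, a Boolean formula may hold at a dead end.\<close>

lemma models_st:
  "models K f \<longleftrightarrow> (\<exists>p. p 0 = kinit K \<and> ipath (set (kedges K)) p) \<and> st K f (kinit K)"
proof
  assume "models K f"
  then obtain r i where r: "is_run K r" "r i = kinit K" "sat K r i f" by (auto simp: models_def)
  then have "ipath (set (kedges K)) r" "r 0 = kinit K" by (auto simp: is_run_def ipath_def)
  then show "(\<exists>p. p 0 = kinit K \<and> ipath (set (kedges K)) p) \<and> st K f (kinit K)"
    using r sat_st(1)[of K r i f] by auto
next
  assume "(\<exists>p. p 0 = kinit K \<and> ipath (set (kedges K)) p) \<and> st K f (kinit K)"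
  then obtain p where p: "p 0 = kinit K" "ipath (set (kedges K)) p" "st K f (kinit K)" by auto
  then have "is_run K p" by (auto simp: is_run_def ipath_def)
  then show "models K f" using p sat_st(1)[of K p 0 f] by (auto simp: models_def)
qed

section \<open>Until as a one-counter condition\<close>

lemma sum_card:
  "(\<Sum>i<j. (if P (p i) then int m else 0) - int n) = int (m * card {i. i < j \<and> P (p i)}) - int (n * j)"
proof (induction j)
  case (Suc j)
  have "{i. i < Suc j \<and> P (p i)} = (if P (p j) then insert j {i. i < j \<and> P (p i)} else {i. i < j \<and> P (p i)})"
    by (auto simp: less_Suc_eq)
  then have "card {i. i < Suc j \<and> P (p i)} = card {i. i < j \<and> P (p i)} + (if P (p j) then 1 else 0)"
    by simp
  then show ?case using Suc by (simp add: algebra_simps)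
qed simp

text \<open>Multiplied out, the frequency condition says that the sum of the weights
  \<open>m - n\<close> and \<open>- n\<close> is nonnegative. Immediate satisfaction is the case
  \<open>j = 0\<close> with its empty sum.\<close>

lemma pst_until:
  "pst K (Until f n m g) p \<longleftrightarrow>
     (\<exists>j. st K g (p j) \<and> 0 \<le> (\<Sum>i<j. (if st K f (p i) then int m else 0) - int n))"
proof -
  let ?S = "\<lambda>j. \<Sum>i<j. (if st K f (p i) then int m else 0) - int n"
  have "n * (k + 1) \<le> m * card {j. j \<le> k \<and> st K f (p j)} \<longleftrightarrow> 0 \<le> ?S (Suc k)" for k
    unfolding sum_card less_Suc_eq_le by (simp flip: of_nat_mult of_nat_add del: of_nat_Suc)
  then have "pst K (Until f n m g) p \<longleftrightarrow> st K g (p 0) \<or> (\<exists>k. st K g (p (Suc k)) \<and> 0 \<le> ?S (Suc k))"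
    by (simp only: pst.simps(2))
  also have "\<dots> \<longleftrightarrow> (\<exists>j. st K g (p j) \<and> 0 \<le> ?S j)"
  proof -
    have "Q 0 \<or> (\<exists>k. Q (Suc k)) \<longleftrightarrow> (\<exists>j. Q j)" for Q
      by (metis not0_implies_Suc)
    from this[of "\<lambda>j. st K g (p j) \<and> 0 \<le> ?S j"] show ?thesis
      by (simp only: lessThan_0 sum.empty order_refl simp_thms)
  qed
  finally show ?thesis .
qed

locale kripke_structure =
  fixes K :: kripke
  assumes wf: "kripke_wf K"
begin

abbreviation "E \<equiv> set (kedges K)"
abbreviation "N \<equiv> nst K"

lemma E_sub: "E \<subseteq> {..<N} \<times> {..<N}"
  using wf by (auto simp: kripke_wf_def)

definition liv :: "nat \<Rightarrow> bool" where
  "liv v \<longleftrightarrow> (\<exists>p. p 0 = v \<and> ipath E p)"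

text \<open>For weight bound 0 the length bound of \<open>safe_bound\<close> reduces to
  \<open>N\<close>.\<close>

lemma liv_win:
  assumes "v < N" "N \<le> k"
  shows "liv v \<longleftrightarrow> win E (\<lambda>_. 0) (\<lambda>_. False) (\<lambda>_. False) True k v 0"
  unfolding win_safe liv_def
proof
  assume "\<exists>p. p 0 = v \<and> ipath E p"
  then show "\<exists>p. p 0 = v \<and> path E p k \<and> (\<forall>j<k. False \<longrightarrow> 1 \<le> (0::int) + (\<Sum>i<j. 0))"
    by (auto simp: path_def ipath_def)
next
  assume "\<exists>p. p 0 = v \<and> path E p k \<and> (\<forall>j<k. False \<longrightarrow> 1 \<le> (0::int) + (\<Sum>i<j. 0))"
  then obtain p where "p 0 = v" "path E p k" by auto
  then show "\<exists>p. p 0 = v \<and> ipath E p"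
    using safe_bound[OF E_sub, of "\<lambda>_. 0" 0 v k p "\<lambda>_. False"] assms by auto
qed

text \<open>A finite witness ending in a live state can be spliced with an infinite path, and
  conversely every state on an infinite path is live. The strict bound on \<open>k\<close> matches
  \<open>j < k\<close> in \<open>win_reach\<close>.\<close>

lemma EU_win:
  assumes "v < N" "n \<le> m" "2 * m * N * N + N < k"
  shows "st K (Ex (Until f n m g)) v \<longleftrightarrow>
    win E (\<lambda>v. (if st K f v then int m else 0) - int n) (\<lambda>_. False) (\<lambda>v. st K g v \<and> liv v) False k v 0"
    (is "_ \<longleftrightarrow> win E ?w _ ?hi False k v 0")
proof -
  have "st K (Ex (Until f n m g)) v \<longleftrightarrow> (\<exists>j p. p 0 = v \<and> path E p j \<and> ?hi (p j) \<and> 0 \<le> (\<Sum>i<j. ?w (p i)))"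
    unfolding st.simps pst_until
  proof safe
    fix p j assume h: "ipath (set (kedges K)) p" "st K g (p j)" "0 \<le> (\<Sum>i<j. ?w (p i))" "v = p 0"
    moreover have "liv (p j)" unfolding liv_def
      using h(1) by (intro exI[of _ "\<lambda>i. p (j + i)"]) (simp add: ipath_def)
    moreover have "path E p j" using h(1) by (simp add: path_def ipath_def)
    ultimately show "\<exists>j q. q 0 = p 0 \<and> path E q j \<and> (st K g (q j) \<and> liv (q j)) \<and> 0 \<le> (\<Sum>i<j. ?w (q i))"
      by blast
  next
    fix p j assume h: "path E p j" "st K g (p j)" "liv (p j)" "0 \<le> (\<Sum>i<j. ?w (p i))" "v = p 0"
    obtain q where q: "q 0 = p j" "ipath E q" using h(3) by (auto simp: liv_def)
    let ?r = "join j p q"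
    have "ipath (set (kedges K)) ?r" using h(1) q by (intro join_ipath)
    moreover have "?r 0 = p 0" using q(1) by (rule join_0)
    moreover have "?r j = p j" using join_simps(1)[of j p q 0] q by simp
    moreover have "(\<Sum>i<j. ?w (?r i)) = (\<Sum>i<j. ?w (p i))" by (intro sum.cong) simp_all
    ultimately show "\<exists>r. r 0 = p 0 \<and> ipath (set (kedges K)) r \<and> (\<exists>j. st K g (r j) \<and> 0 \<le> (\<Sum>i<j. ?w (r i)))"
      using h by (intro exI[of _ ?r] conjI exI[of _ j]) simp_all
  qed
  also have "\<dots> \<longleftrightarrow> (\<exists>j<k. \<exists>p. p 0 = v \<and> path E p j \<and> ?hi (p j) \<and> 0 \<le> (\<Sum>i<j. ?w (p i)))"
  proof safe
    fix j p assume h: "path E p j" "st K g (p j)" "liv (p j)" "0 \<le> (\<Sum>i<j. ?w (p i))" "v = p 0"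
    have w: "- int m \<le> ?w u" for u using assms(2) by simp
    have "\<exists>j\<le>2 * m * N * N + N. \<exists>p. p 0 = v \<and> path E p j \<and> ?hi (p j) \<and> 0 \<le> (\<Sum>i<j. ?w (p i))"
      by (rule reach_bound[OF E_sub w assms(1), of p j]) (use h in auto)
    then show "\<exists>j<k. \<exists>q. q 0 = p 0 \<and> path E q j \<and> (st K g (q j) \<and> liv (q j)) \<and> 0 \<le> (\<Sum>i<j. ?w (q i))"
      using assms(3) h(5) by (meson le_less_trans)
  qed blast
  finally show ?thesis unfolding win_reach by simp
qed

text \<open>On a counterexample every position satisfying \<open>g\<close> has a negative sum; over
  the integers this means that the negated sum is at least 1.\<close>

lemma AU_win:
  assumes "v < N" "n \<le> m" "2 * m * N * N + N \<le> k"
  shows "st K (All (Until f n m g)) v \<longleftrightarrow>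
    \<not> win E (\<lambda>v. int n - (if st K f v then int m else 0)) (st K g) (\<lambda>_. False) True k v 0"
    (is "_ \<longleftrightarrow> \<not> win E ?w _ _ True k v 0")
proof -
  have neg: "(\<Sum>i<j. ?w (p i)) = - (\<Sum>i<j. (if st K f (p i) then int m else 0) - int n)" for p :: "nat \<Rightarrow> nat" and j
    by (simp flip: sum_negf)
  have "\<not> st K (All (Until f n m g)) v \<longleftrightarrow>
      (\<exists>p. p 0 = v \<and> ipath E p \<and> (\<forall>j. st K g (p j) \<longrightarrow> 1 \<le> (\<Sum>i<j. ?w (p i))))"
  proof -
    have "\<not> 0 \<le> s \<longleftrightarrow> 1 \<le> - s" for s :: int by linarith
    then show ?thesis unfolding st.simps pst_until neg by blast
  qed
  also have "\<dots> \<longleftrightarrow> win E ?w (st K g) (\<lambda>_. False) True k v 0"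
    unfolding win_safe add_0
  proof
    assume "\<exists>p. p 0 = v \<and> ipath E p \<and> (\<forall>j. st K g (p j) \<longrightarrow> 1 \<le> (\<Sum>i<j. ?w (p i)))"
    then show "\<exists>p. p 0 = v \<and> path E p k \<and> (\<forall>j<k. st K g (p j) \<longrightarrow> 1 \<le> (\<Sum>i<j. ?w (p i)))"
      unfolding path_def ipath_def by blast
  next
    assume "\<exists>p. p 0 = v \<and> path E p k \<and> (\<forall>j<k. st K g (p j) \<longrightarrow> 1 \<le> (\<Sum>i<j. ?w (p i)))"
    then obtain p where p: "p 0 = v" "path E p k" "\<And>j. j < k \<Longrightarrow> st K g (p j) \<Longrightarrow> 1 \<le> (\<Sum>i<j. ?w (p i))"
      by blast
    have w: "?w u \<le> int m" for u using assms(2) by simp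
    show "\<exists>p. p 0 = v \<and> ipath E p \<and> (\<forall>j. st K g (p j) \<longrightarrow> 1 \<le> (\<Sum>i<j. ?w (p i)))"
      by (rule safe_bound[OF E_sub w assms(1,3) p])
  qed
  finally show ?thesis by blast
qed

end

section \<open>Correctness of the model checker\<close>

definition vec :: "(nat \<Rightarrow> nat) \<Rightarrow> nat \<Rightarrow> nat \<Rightarrow> nat" where
  "vec f D n = (\<Sum>i<n. f i * D ^ i)"

lemma vec_less: "(\<And>i. i < n \<Longrightarrow> f i < D) \<Longrightarrow> vec f D n < D ^ n"
proof (induction n)
  case (Suc n)
  have "Suc (f n) * D ^ n \<le> D * D ^ n" using Suc.prems[of n] by (intro mult_right_mono) auto
  then show ?case using Suc by (simp add: vec_def)
qed (simp add: vec_def)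

lemma vec_digit:
  "(\<And>i. i < n \<Longrightarrow> f i < D) \<Longrightarrow> v < n \<Longrightarrow> (vec f D n div D ^ v) mod D = f v"
proof (induction n)
  case (Suc n)
  have D: "0 < D" using Suc.prems(1)[of n] by auto
  show ?case
  proof (cases "v = n")
    case True
    have "vec f D n < D ^ n" using Suc.prems by (intro vec_less) auto
    then show ?thesis using True Suc.prems(1)[of n] D by (simp add: vec_def)
  next
    case False
    then have "v < n" using Suc.prems by simp
    then obtain l where l: "n = Suc (v + l)" by (metis less_iff_Suc_add)
    have "vec f D (Suc n) = vec f D n + D ^ v * (D * (f n * D ^ l))"
      by (simp add: vec_def l power_add mult_ac)
    then have "vec f D (Suc n) div D ^ v = vec f D n div D ^ v + D * (f n * D ^ l)"
      using D by simp
    then show ?thesis using Suc \<open>v < n\<close> by simp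
  qed
qed simp

text \<open>All powers and partial sums involved are at most \<open>D ^ n\<close>, so saturation
  never takes effect.\<close>

lemma mkvec_eq:
  assumes "\<And>i. i < n \<Longrightarrow> f i < D" "D ^ n \<le> snd c"
  shows "mkvec c f D n = vec f D n"
proof (cases "n = 0")
  case False
  then have D: "0 < D" using assms(1)[of 0] by simp
  have W: "0 < snd c" using assms(2) D by (meson less_le_trans zero_less_power)
  have "k \<le> n \<Longrightarrow> mkvec c f D k = vec f D k" for k
  proof (induction k)
    case (Suc k)
    have le: "D ^ k \<le> D ^ n" "D ^ Suc k \<le> D ^ n" using Suc.prems D by (auto intro!: power_increasing simp del: power_Suc)
    have fk: "\<And>i. i < Suc k \<Longrightarrow> f i < D" using assms(1) Suc.prems by simp
    have v: "vec f D (Suc k) < D ^ Suc k" using fk by (rule vec_less)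
    have s: "vec f D (Suc k) = vec f D k + f k * D ^ k" by (simp add: vec_def)
    have 1: "vec f D k \<le> snd c" "f k * D ^ k \<le> snd c" "vec f D k + f k * D ^ k \<le> snd c" "D ^ k \<le> snd c"
      using v s le assms(2) by linarith+
    then show ?case using Suc W s
      by (simp add: mkvec_def cmul_eq cpow_eq cadd_eq)
  qed (simp add: mkvec_def vec_def)
  then show ?thesis by simp
qed (simp add: mkvec_def vec_def)

lemma dig_mkvec:
  assumes "\<And>i. i < n \<Longrightarrow> f i < D" "D ^ n \<le> snd c" "v < n"
  shows "dig c D (mkvec c f D n) v = f v"
proof -
  have D: "0 < D" using assms(1)[of v] assms(3) by simp
  then have "D ^ v \<le> D ^ n" using assms(3) by (intro power_increasing) auto
  moreover have "0 < snd c" using assms(2) D by (meson less_le_trans zero_less_power)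
  ultimately have "cpow c D v = D ^ v" using assms(2) by (simp add: cpow_eq)
  then show ?thesis using assms by (simp add: dig_def mkvec_eq vec_digit)
qed

text \<open>Encoded sets match the semantics only on states below \<open>N\<close>, and edges do not
  leave these.\<close>

lemma win_cong:
  assumes "E \<subseteq> {..<N} \<times> {..<N}" "\<And>v. v < N \<Longrightarrow> w v = w' v \<and> lo v = lo' v \<and> hi v = hi' v"
  shows "v < N \<Longrightarrow> win E w lo hi z k v e = win E w' lo' hi' z k v e"
proof (induction k arbitrary: v e)
  case (Suc k)
  have "u < N" if "(v, u) \<in> E" for u using that assms(1) by auto
  then show ?case using Suc assms(2)[OF Suc.prems] by auto
qed simp

context checker
begin

lemma scale_eq: "k \<le> 9 \<Longrightarrow> scale c k = 2 ^ (k * L)"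
proof -
  assume "k \<le> 9"
  then have "k * L \<le> 9 * L" by simp
  also have "\<dots> \<le> 9 * L * L" using L_pos by simp
  finally have p: "2 ^ (k * L) \<le> W" by (rule pow_le_W)
  then have "k * L \<le> W" by (meson less_exp less_imp_le le_trans)
  then have "cmul c k (length (fst c)) = k * L" by (simp add: cmul_eq W_def L_def x_def)
  moreover have "0 < snd c" using L_less_W by (simp add: W_def)
  ultimately show ?thesis using p by (simp add: scale_def cpow_eq W_def)
qed

lemma scale_less: "k < l \<Longrightarrow> 2 ^ (k * L) * 2 \<le> (2 ^ (l * L) :: nat)"
proof -
  assume "k < l"
  then have "Suc k * L \<le> l * L" by (intro mult_right_mono) auto
  then have "k * L + 1 \<le> l * L" using L_pos by simp
  then have "(2::nat) ^ (k * L + 1) \<le> 2 ^ (l * L)" by (intro power_increasing) auto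
  then show ?thesis by simp
qed

lemma num_less: "p \<le> L \<Longrightarrow> num c p < 2 ^ L"
proof -
  assume p: "p \<le> L"
  have "numv (drop p x) < 2 ^ (L - p)" using numv_less[of "drop p x"] by (simp add: L_def)
  also have "\<dots> \<le> 2 ^ L" by (intro power_increasing) auto
  finally show ?thesis using p by (simp add: num_eq)
qed

end

context checker_input
begin

sublocale kripke_structure K by unfold_locales (rule wf)

lemma pow_N: "2 ^ N \<le> W" "N \<le> L" "2 ^ N \<le> (2::nat) ^ L"
proof -
  have L: "N \<le> L" by (rule nst_le_L)
  moreover have "L \<le> 9 * L * L" using L_pos by simp
  ultimately have "N \<le> 9 * L * L" by linarith
  with L show "2 ^ N \<le> W" "N \<le> L" "2 ^ N \<le> (2::nat) ^ L"
    by (auto intro: pow_le_W power_increasing)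
qed

lemma mem_mkset: "v < N \<Longrightarrow> mem c (mkset c P) v \<longleftrightarrow> P v"
  unfolding mem_def mkset_def nstates_eq
  by (subst dig_mkvec) (use pow_N in \<open>auto simp: W_def\<close>)

lemma mkset_less: "mkset c P < 2 ^ L"
proof -
  have "mkset c P = vec (\<lambda>v. of_bool (P v)) 2 N"
    unfolding mkset_def nstates_eq by (rule mkvec_eq) (use pow_N in \<open>auto simp: W_def\<close>)
  also have "\<dots> < 2 ^ N" by (rule vec_less) auto
  finally show ?thesis using pow_N by linarith
qed

lemma best_le:
  assumes "t < scale c 8"
  shows "best c y v \<le> t \<longleftrightarrow> (\<exists>u<N. (v, u) \<in> E \<and> dig c (scale c 9) y u \<le> t)"
proof -
  have "rec_nat (scale c 8) (\<lambda>u a. if edge c v u \<and> dig c (scale c 9) y u < a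
     then dig c (scale c 9) y u else a) n \<le> t \<longleftrightarrow> (\<exists>u<n. (v, u) \<in> E \<and> dig c (scale c 9) y u \<le> t)" for n
    using assms by (induction n) (auto simp: less_Suc_eq edge_eq)
  then show ?thesis by (simp add: best_def nstates_eq)
qed

lemma best_bound: "best c y v \<le> scale c 8"
proof -
  have "rec_nat (scale c 8) (\<lambda>u a. if edge c v u \<and> dig c (scale c 9) y u < a
     then dig c (scale c 9) y u else a) n \<le> scale c 8" for n
    by (induction n) auto
  then show ?thesis by (simp add: best_def)
qed

lemma scales: "2 * scale c 7 \<le> scale c 8" "2 * scale c 8 \<le> scale c 9" "scale c 9 \<le> W" "0 < scale c 7"
proof -
  have "9 * L \<le> 9 * L * L" using L_pos by simp
  then have "2 ^ (9 * L) \<le> W" by (rule pow_le_W)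
  then show "2 * scale c 7 \<le> scale c 8" "2 * scale c 8 \<le> scale c 9" "scale c 9 \<le> W" "0 < scale c 7"
    using scale_less[of 7 8] scale_less[of 8 9] by (simp_all add: scale_eq)
qed

lemma relax_le:
  assumes s: "s < scale c 8" and q: "q \<le> s + r" "s + r - q < scale c 8" "q \<le> scale c 8"
    and r: "r = (if mem c A v then r1 else r0)"
  shows "relax c A r1 r0 q lo hi y v \<le> s \<longleftrightarrow> (mem c lo v \<longrightarrow> scale c 7 < s) \<and>
     (mem c hi v \<and> scale c 7 \<le> s \<or> (\<exists>u<N. (v, u) \<in> E \<and> dig c (scale c 9) y u \<le> s + r - q))"
proof -
  have "best c y v + q \<le> snd c" using best_bound[of y v] q(3) scales by (simp add: W_def)
  then have t: "cadd c (best c y v) q = best c y v + q"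
    using cadd_eq[of "best c y v" c q] by simp
  have suc: "csuc c (scale c 7) = Suc (scale c 7)" using scales by (intro csuc_less) (simp add: W_def)
  have "best c y v + q - r \<le> s \<longleftrightarrow> best c y v \<le> s + r - q" using q(1) by linarith
  then have b: "best c y v + q - r \<le> s \<longleftrightarrow> (\<exists>u<N. (v, u) \<in> E \<and> dig c (scale c 9) y u \<le> s + r - q)"
    by (simp add: best_le[OF q(2)])
  show ?thesis unfolding b[symmetric] unfolding relax_def t r[symmetric] Let_def suc using s scales by auto
qed

lemma relax_bound: "relax c A r1 r0 q lo hi y v \<le> scale c 8"
proof -
  have suc: "csuc c (scale c 7) = Suc (scale c 7)" using scales by (intro csuc_less) (simp add: W_def)
  show ?thesis unfolding relax_def Let_def suc using scales by auto
qed

lemma pow_D: "scale c 9 ^ N \<le> snd c"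
proof -
  have "scale c 9 ^ N = 2 ^ (9 * L * N)" by (simp add: scale_eq power_mult)
  moreover have "9 * L * N \<le> 9 * L * L" using nst_le_L by simp
  ultimately show ?thesis using pow_le_W by (simp add: W_def)
qed

text \<open>Truncating thresholds at 0 and at infinity is harmless only for counters near 0. One
  step changes the counter by at most \<open>m\<close>, so the admissible window for
  \<open>e\<close> shrinks by \<open>m\<close> per iteration: a step from the window for
  \<open>Suc k\<close> lands in the window for \<open>k\<close>. After \<open>2 ^ (5 * L)\<close>
  iterations only \<open>e = 0\<close> is left, which is the value asked for.\<close>

lemma thresholds_win:
  fixes A r1 r0 q lo hi z m :: nat and b :: bool
  defines "w \<equiv> \<lambda>v. int (if mem c A v then r1 else r0) - int q"
  assumes w: "\<And>v. \<bar>w v\<bar> \<le> int m" and m: "m < 2 ^ L" and q: "q < 2 ^ L" and z: "z = (if b then 0 else scale c 8)"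
  shows "k \<le> 2 ^ (5 * L) \<Longrightarrow> v < N \<Longrightarrow> \<bar>e\<bar> \<le> int ((2 ^ (5 * L) - k) * m) \<Longrightarrow>
     int (dig c (scale c 9) (thresholds c A r1 r0 q lo hi z k) v) \<le> int (scale c 7) + e \<longleftrightarrow>
     win E w (mem c lo) (mem c hi) b k v e"
proof (induction k arbitrary: v e)
  \<comment> \<open>Even the widest window is smaller than the offset, so shifted counters are
    positive and below infinity.\<close>
  have "2 ^ (5 * L) * m < (2::nat) ^ (5 * L) * 2 ^ L" using m by simp
  also have "\<dots> \<le> 2 ^ (7 * L)" using L_pos by (simp flip: power_add)
  finally have Km: "2 ^ (5 * L) * m < scale c 7" by (simp add: scale_eq)
  {
    case 0
    have "dig c (scale c 9) (thresholds c A r1 r0 q lo hi z 0) v = z"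
      using dig_mkvec[of N "\<lambda>_. z" "scale c 9" c v] pow_D 0 z scales by (simp add: thresholds_def nstates_eq)
    moreover have "\<bar>e\<bar> < int (scale c 7)" using 0(3) Km unfolding diff_zero by linarith
    ultimately show ?case using z scales by (cases b) auto
  next
    case (Suc k)
    let ?K = "2 ^ (5 * L) :: nat"
    let ?y = "thresholds c A r1 r0 q lo hi z k"
    have dig: "dig c (scale c 9) (thresholds c A r1 r0 q lo hi z (Suc k)) v = relax c A r1 r0 q lo hi ?y v"
    proof -
      have "thresholds c A r1 r0 q lo hi z (Suc k) = mkvec c (relax c A r1 r0 q lo hi ?y) (scale c 9) N"
        by (simp add: thresholds_def nstates_eq)
      moreover have "relax c A r1 r0 q lo hi ?y i < scale c 9" for i
        using relax_bound[of A r1 r0 q lo hi ?y i] scales by linarith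
      ultimately show ?thesis using dig_mkvec[OF _ pow_D Suc.prems(2)] by simp
    qed
    define s where "s = nat (int (scale c 7) + e)"
    define r where "r = (if mem c A v then r1 else r0)"
    have km: "(?K - k) * m = (?K - Suc k) * m + m" using Suc.prems(1)
      by (metis Suc_diff_le add.commute diff_Suc_Suc mult_Suc)
    have Kk: "(?K - k) * m \<le> ?K * m" by simp
    have e: "\<bar>e\<bar> \<le> int ((?K - Suc k) * m)" by (rule Suc.prems(3))
    have e': "\<bar>e + w v\<bar> \<le> int ((?K - k) * m)" using e w[of v] unfolding km by linarith
    have wr: "w v = int r - int q" by (simp add: w_def r_def)
    have s: "int s = int (scale c 7) + e" "s < scale c 8"
      using e km Kk Km scales unfolding s_def by linarith+
    have sr: "q \<le> s + r" "s + r - q < scale c 8" "int (s + r - q) = int (scale c 7) + (e + w v)"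
      using e' Kk Km scales s(1) wr by linarith+
    have "(2::nat) ^ L \<le> scale c 8" using L_pos by (simp add: scale_eq)
    then have q': "q \<le> scale c 8" using q by linarith
    have ih: "dig c (scale c 9) ?y u \<le> s + r - q \<longleftrightarrow> win E w (mem c lo) (mem c hi) b k u (e + w v)" if "u < N" for u
      using Suc.IH[OF _ that e'] Suc.prems(1) sr(3) by linarith
    have "int (relax c A r1 r0 q lo hi ?y v) \<le> int (scale c 7) + e \<longleftrightarrow> relax c A r1 r0 q lo hi ?y v \<le> s"
      using s(1) by linarith
    also have "\<dots> \<longleftrightarrow> (mem c lo v \<longrightarrow> scale c 7 < s) \<and>
     (mem c hi v \<and> scale c 7 \<le> s \<or> (\<exists>u<N. (v, u) \<in> E \<and> dig c (scale c 9) ?y u \<le> s + r - q))"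
      by (rule relax_le[OF s(2) sr(1,2) q' r_def])
    also have "scale c 7 < s \<longleftrightarrow> 1 \<le> e" using s(1) by linarith
    also have "scale c 7 \<le> s \<longleftrightarrow> 0 \<le> e" using s(1) by linarith
    also have "(\<exists>u<N. (v, u) \<in> E \<and> dig c (scale c 9) ?y u \<le> s + r - q) \<longleftrightarrow>
        (\<exists>u. (v, u) \<in> E \<and> win E w (mem c lo) (mem c hi) b k u (e + w v))"
      using ih E_sub by auto
    finally show ?case by (simp only: dig win.simps)
  }
qed

lemma winning_win:
  fixes A r1 r0 q lo hi z m :: nat and b :: bool
  assumes "\<And>v. \<bar>int (if mem c A v then r1 else r0) - int q\<bar> \<le> int m" "m < 2 ^ L" "q < 2 ^ L"
    "z = (if b then 0 else scale c 8)" "v < N"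
  shows "mem c (winning c A r1 r0 q lo hi z) v \<longleftrightarrow>
    win E (\<lambda>v. int (if mem c A v then r1 else r0) - int q) (mem c lo) (mem c hi) b (2 ^ (5 * L)) v 0"
  using thresholds_win[OF assms(1-4), of "2 ^ (5 * L)" v 0] assms(5)
  by (simp add: winning_def mem_mkset scale_eq)

text \<open>The bound on \<open>A\<close> makes it a single digit of the stack.\<close>

definition represents :: "nat \<Rightarrow> fctl \<Rightarrow> bool" where
  "represents A f \<longleftrightarrow> A < 2 ^ L \<and> (\<forall>v<N. mem c A v \<longleftrightarrow> st K f v)"

text \<open>Shows that the iteration count covers the length bound of both cycle arguments, as
  \<open>N\<close> is also below \<open>2 ^ L\<close>.\<close>

lemma bound_K: "m < 2 ^ L \<Longrightarrow> 2 * m * N * N + N < 2 ^ (5 * L)"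
proof -
  assume m: "m < 2 ^ L"
  have N: "N < 2 ^ L" using nst_le_L by (meson less_exp le_less_trans)
  have "2 * m * N * N + N \<le> 2 * (m + 1) * N * N"
    by (cases "N = 0") (auto simp: algebra_simps)
  also have "\<dots> \<le> 2 * 2 ^ L * 2 ^ L * 2 ^ L" using m N by (intro mult_mono) auto
  also have "\<dots> = 2 ^ (1 + 3 * L)" by (simp add: power_add numeral_3_eq_3 mult_ac)
  also have "\<dots> < 2 ^ (5 * L)" using L_pos by (intro power_strict_increasing) auto
  finally show ?thesis .
qed

lemma live_mem: "v < N \<Longrightarrow> mem c (live c) v \<longleftrightarrow> liv v"
proof -
  assume v: "v < N"
  have "mem c (live c) v \<longleftrightarrow> win E (\<lambda>_. 0) (mem c 0) (mem c 0) True (2 ^ (5 * L)) v 0"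
    unfolding live_def using winning_win[of 0 0 0 0 0 0 True v 0 0] v by simp
  moreover have "mem c 0 = (\<lambda>_. False)" by (simp add: mem_def dig_def fun_eq_iff)
  moreover have "N \<le> 2 ^ (5 * L)" using bound_K[of 0] by simp
  ultimately show ?thesis using liv_win[OF v] by simp
qed

lemma rep_prop: "represents (set_prop c a) (Prop a)"
  by (simp add: represents_def set_prop_def mkset_less mem_mkset label_eq)

lemma rep_and: "represents A f \<Longrightarrow> represents B g \<Longrightarrow> represents (set_and c A B) (And f g)"
  by (simp add: represents_def set_and_def mkset_less mem_mkset)

lemma rep_not: "represents A f \<Longrightarrow> represents (set_not c A) (Neg f)"
  by (simp add: represents_def set_not_def mkset_less mem_mkset)

lemma ex_next:
  "(\<exists>p. p 0 = v \<and> ipath E p \<and> P (p 1)) \<longleftrightarrow> (\<exists>u<N. (v, u) \<in> E \<and> liv u \<and> P u)"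
proof safe
  fix p assume p: "ipath E p" "P (p 1)"
  then have "(p 0, p 1) \<in> E" "ipath E (\<lambda>i. p (Suc i))" by (auto simp: ipath_def)
  then show "\<exists>u<N. (p 0, u) \<in> E \<and> liv u \<and> P u"
    using p E_sub by (intro exI[of _ "p 1"]) (auto simp: liv_def intro!: exI[of _ "\<lambda>i. p (Suc i)"])
next
  fix u assume u: "(v, u) \<in> E" "liv u" "P u"
  then obtain p where p: "p 0 = u" "ipath E p" by (auto simp: liv_def)
  have "ipath E (case_nat v p)" using p u by (simp add: ipath_Cons)
  then show "\<exists>p. p 0 = v \<and> ipath E p \<and> P (p 1)"
    using p u by (intro exI[of _ "case_nat v p"]) simp
qed

lemma rep_EX: "represents A f \<Longrightarrow> represents (set_EX c A) (Ex (Next f))"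
  using ex_next[of _ "st K f"]
  by (auto simp: represents_def set_EX_def mkset_less mem_mkset nstates_eq edge_eq live_mem)

lemma rep_AX: "represents A f \<Longrightarrow> represents (set_AX c A) (All (Next f))"
  using ex_next[of _ "\<lambda>u. \<not> st K f u"]
  by (auto simp: represents_def set_AX_def mkset_less mem_mkset nstates_eq edge_eq live_mem)

lemma rep_EU:
  assumes "represents A f" "represents B g" "n \<le> m" "m < 2 ^ L"
  shows "represents (set_EU c A n m B) (Ex (Until f n m g))"
proof -
  have "mem c (set_EU c A n m B) v \<longleftrightarrow> st K (Ex (Until f n m g)) v" if v: "v < N" for v
  proof -
    have "mem c (set_EU c A n m B) v \<longleftrightarrow> win E (\<lambda>v. int (if mem c A v then m else 0) - int n) (mem c 0)
       (mem c (set_and c B (live c))) False (2 ^ (5 * L)) v 0"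
      unfolding set_EU_def by (rule winning_win[of _ _ _ _ m]) (use assms v in auto)
    also have "\<dots> \<longleftrightarrow> win E (\<lambda>v. (if st K f v then int m else 0) - int n) (\<lambda>_. False) (\<lambda>v. st K g v \<and> liv v)
       False (2 ^ (5 * L)) v 0"
      by (rule win_cong[OF E_sub _ v])
        (use assms(1,2) live_mem in \<open>auto simp: represents_def set_and_def mem_mkset mem_def[of c 0] dig_def\<close>)
    also have "\<dots> \<longleftrightarrow> st K (Ex (Until f n m g)) v"
      by (rule EU_win[symmetric]) (use v assms bound_K in auto)
    finally show ?thesis .
  qed
  then show ?thesis by (simp add: represents_def set_EU_def winning_def mkset_less)
qed

lemma rep_AU:
  assumes "represents A f" "represents B g" "n \<le> m" "m < 2 ^ L"
  shows "represents (set_AU c A n m B) (All (Until f n m g))"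
proof -
  have nm: "cadd c n m = n + m"
  proof -
    have "n + m \<le> 2 ^ (1 * L) * 2" using assms by simp
    also have "\<dots> \<le> 2 ^ (9 * L)" by (rule scale_less) simp
    finally have "n + m \<le> snd c" using scales(3) by (simp add: scale_eq W_def)
    then show ?thesis using cadd_eq[of n c m] by simp
  qed
  have "mem c (set_AU c A n m B) v \<longleftrightarrow> st K (All (Until f n m g)) v" if v: "v < N" for v
  proof -
    have "mem c (set_AU c A n m B) v \<longleftrightarrow> \<not> mem c (winning c A n (n + m) m B 0 0) v"
      using v by (simp add: set_AU_def set_not_def mem_mkset nm)
    also have "mem c (winning c A n (n + m) m B 0 0) v \<longleftrightarrow>
       win E (\<lambda>v. int (if mem c A v then n else n + m) - int m) (mem c B) (mem c 0) True (2 ^ (5 * L)) v 0"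
      by (rule winning_win[of _ _ _ _ m]) (use assms v in auto)
    also have "\<dots> \<longleftrightarrow> win E (\<lambda>v. int n - (if st K f v then int m else 0)) (st K g) (\<lambda>_. False) True (2 ^ (5 * L)) v 0"
      by (rule win_cong[OF E_sub _ v])
        (use assms(1,2) in \<open>auto simp: represents_def mem_def[of c 0] dig_def\<close>)
    also have "\<not> \<dots> \<longleftrightarrow> st K (All (Until f n m g)) v"
      by (rule AU_win[symmetric]) (use v assms bound_K[of m] in auto)
    finally show ?thesis .
  qed
  then show ?thesis by (simp add: represents_def set_AU_def set_not_def mkset_less)
qed

section \<open>Evaluation of the formula on the stack\<close>

abbreviation "B \<equiv> (2::nat) ^ L"

lemma push_eq:
  assumes "A < B" "st' < B ^ k" "Suc k \<le> L"
  shows "stack_push c A st' = A + B * st'" "A + B * st' < B ^ Suc k"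
proof -
  have "B * Suc st' \<le> B * B ^ k" using assms by (intro mult_left_mono) auto
  then show b: "A + B * st' < B ^ Suc k" using assms by simp
  have "B ^ Suc k \<le> B ^ L" using assms by (intro power_increasing) auto
  also have "\<dots> = 2 ^ (L * L)" by (simp add: power_mult)
  also have "\<dots> \<le> W" by (rule pow_le_W) simp
  finally have W: "B ^ Suc k \<le> snd c" by (simp add: W_def)
  have "scale c 1 = B" by (simp add: scale_eq)
  then show "stack_push c A st' = A + B * st'"
    using b W assms by (simp add: stack_push_def cmul_eq cadd_eq)
qed

lemma stack_rec: "p < L \<Longrightarrow> stack c p = stack_step c p (stack c (Suc p))"
  unfolding stack_def by (rule suffix_rec_step) (simp add: L_def x_def)

lemma pop_le: "stack_pop c s \<le> s" by (simp add: stack_pop_def)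

lemma ops_less:
  "set_prop c a < B" "set_and c A A' < B" "set_not c A < B" "set_EX c A < B" "set_AX c A < B"
  "set_EU c A n m A' < B" "set_AU c A n m A' < B"
  by (simp_all add: set_prop_def set_and_def set_not_def set_EX_def set_AX_def set_EU_def set_AU_def
      winning_def mkset_less)

text \<open>Each position pushes at most one digit, whatever it contains. Hence \<open>L\<close>
  positions keep the stack below \<open>B ^ L = 2 ^ (L * L)\<close>.\<close>

lemma stack_step_less:
  assumes "s < B ^ k" "Suc k \<le> L" shows "stack_step c p s < B ^ Suc k"
proof -
  have 1: "stack_pop c s < B ^ k" "stack_pop c (stack_pop c s) < B ^ k"
    using pop_le[of s] pop_le[of "stack_pop c s"] assms(1) by linarith+
  have 2: "stack_push c A s' < B ^ Suc k" if "A < B" "s' < B ^ k" for A s'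
    using push_eq[OF that assms(2)] by simp
  have "B ^ k \<le> B ^ Suc k" by (intro power_increasing) auto
  then have 3: "s < B ^ Suc k" using assms(1) by linarith
  have 4: "(if P then a else b) < B ^ Suc k" if "a < B ^ Suc k" "b < B ^ Suc k" for P a b
    using that by simp
  show ?thesis unfolding stack_step_def Let_def
    by (intro 4 2 ops_less 1 3 assms(1))
qed

lemma stack_less: "p \<le> L \<Longrightarrow> stack c p < B ^ (L - p)"
proof (induction rule: inc_induct)
  case base
  then show ?case by (simp add: stack_def suffix_rec_end L_def x_def)
next
  case (step p)
  have "stack_step c p (stack c (Suc p)) < B ^ Suc (L - Suc p)"
    by (rule stack_step_less) (use step in auto)
  moreover have "Suc (L - Suc p) = L - p" using step by simp
  ultimately show ?case using step by (simp add: stack_rec del: power_Suc)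
qed

lemma push_stack: "p < L \<Longrightarrow> A < B \<Longrightarrow> Suc p \<le> p' \<Longrightarrow> p' \<le> L \<Longrightarrow> stack_push c A (stack c p') = A + B * stack c p'"
  using push_eq(1)[OF _ stack_less[of p']] by simp

lemma top_pop: "A < B \<Longrightarrow> stack_top c (A + B * s) = A \<and> stack_pop c (A + B * s) = s"
  by (simp add: stack_top_def stack_pop_def scale_eq)

lemma at_Cons:
  assumes "drop p x = a # ys"
  shows "p < L" "inp (fst c) p = a" "csuc c p = Suc p" "drop (Suc p) x = ys"
proof -
  show p: "p < L" using assms unfolding L_def by (metis drop_all list.distinct(1) not_le)
  then show "csuc c p = Suc p" by (simp add: csuc_L)
  show "inp (fst c) p = a" "drop (Suc p) x = ys" using assms drop_inp[of p x] p by (auto simp: L_def x_def)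
qed

text \<open>Covers the text that evaluation passes over: the encoded Kripke structure, numbers, and
  the tags of path operators.\<close>

lemma stack_skip:
  "drop p x = ys @ zs \<Longrightarrow> set ys \<subseteq> {1, 2, 3, 4, 5, 11, 12} \<Longrightarrow> stack c p = stack c (p + length ys)"
proof (induction ys arbitrary: p)
  case (Cons a ys)
  have at: "p < L" "inp (fst c) p = a" "drop (Suc p) x = ys @ zs" using at_Cons[of p a "ys @ zs"] Cons.prems by auto
  have "stack c p = stack c (Suc p)"
    using Cons.prems(2) by (auto simp: stack_rec[OF at(1)] stack_step_def at(2) Let_def)
  then show ?case using Cons.IH[OF at(3)] Cons.prems(2) by simp
qed simp

lemma at_nat:
  assumes "drop p x = enc_nat n @ ys" "p \<le> L"
  shows "num c p = n" "drop (nxt c p) x = ys" "nxt c p \<le> L"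
  using num_eq[OF assms(2)] nxt_drop[OF assms(2)] assms(1) by auto

lemma drop_append_at: "drop p x = ys @ zs \<Longrightarrow> drop (p + length ys) x = zs"
  by (metis add.commute append_eq_conv_conj drop_drop)

lemma at_le: "drop p x = ys @ zs \<Longrightarrow> ys \<noteq> [] \<Longrightarrow> p + length ys \<le> L"
proof -
  assume "drop p x = ys @ zs" "ys \<noteq> []"
  then have "length (drop p x) = length ys + length zs" "length ys > 0" by (simp_all del: length_drop)
  then show ?thesis unfolding L_def length_drop by linarith
qed

text \<open>Reading a formula leaves exactly one set on top of the stack that belongs to the text
  behind it.\<close>

definition evaluated :: "fctl \<Rightarrow> bool" where
  "evaluated f \<longleftrightarrow> (\<forall>p ys. fctl_wf f \<and> drop p x = enc_fctl f @ ys \<longrightarrow>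
     (\<exists>A. represents A f \<and> stack c p = A + B * stack c (p + length (enc_fctl f))))"

lemma evaluatedE:
  assumes "evaluated f" "fctl_wf f" "drop p x = enc_fctl f @ ys"
  obtains A where "represents A f" "stack_top c (stack c p) = A"
    "stack_pop c (stack c p) = stack c (p + length (enc_fctl f))"
proof -
  obtain A where A: "represents A f" "stack c p = A + B * stack c (p + length (enc_fctl f))"
    using assms unfolding evaluated_def by blast
  then have "A < B" by (simp add: represents_def)
  then show thesis using that[OF A(1)] A(2) top_pop by simp
qed

lemma next_operand:
  assumes "drop p x = 11 # enc_fctl f @ ys" "evaluated f" "fctl_wf f"
  obtains A where "represents A f" "inp (fst c) p = 11" "stack_top c (stack c p) = A"
    "stack_pop c (stack c p) = stack c (p + length (11 # enc_fctl f))"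
proof -
  note at = at_Cons[OF assms(1)]
  have "stack c p = stack c (Suc p)" using stack_skip[of p "[11]"] assms(1) by simp
  moreover obtain A where "represents A f" "stack_top c (stack c (Suc p)) = A"
    "stack_pop c (stack c (Suc p)) = stack c (Suc p + length (enc_fctl f))"
    by (rule evaluatedE[OF assms(2,3) at(4)])
  ultimately show thesis using that[OF _ at(2), of A] by simp
qed

lemma until_operands:
  assumes "drop p x = 12 # enc_nat n @ enc_nat m @ enc_fctl f @ enc_fctl g @ ys"
    "evaluated f" "evaluated g" "fctl_wf f" "fctl_wf g"
  obtains A A' where "represents A f" "represents A' g" "m < B" "inp (fst c) p = 12" "csuc c p = Suc p"
    "num c (Suc p) = n" "num c (nxt c (Suc p)) = m"
    "stack_top c (stack c p) = A" "stack_top c (stack_pop c (stack c p)) = A'"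
    "stack_pop c (stack_pop c (stack c p)) =
       stack c (p + length (12 # enc_nat n @ enc_nat m @ enc_fctl f @ enc_fctl g))"
proof -
  note at = at_Cons[OF assms(1)]
  have p1: "Suc p \<le> L" using at(1) by simp
  note n = at_nat[OF at(4) p1]
  note m = at_nat[OF n(2,3)]
  have mB: "m < B" using num_less[OF n(3)] m(1) by simp
  have d2: "drop p x = (12 # enc_nat n @ enc_nat m) @ (enc_fctl f @ enc_fctl g @ ys)"
    using assms(1) by simp
  have sk: "stack c p = stack c (p + length (12 # enc_nat n @ enc_nat m))"
    by (rule stack_skip[OF d2]) (use enc_nat_symbols[of n] enc_nat_symbols[of m] in auto)
  note d3 = drop_append_at[OF d2] note d4 = drop_append_at[OF d3]
  obtain A where A: "represents A f" "stack_top c (stack c p) = A"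
    "stack_pop c (stack c p) = stack c (p + length (12 # enc_nat n @ enc_nat m) + length (enc_fctl f))"
    by (rule evaluatedE[OF assms(2,4) d3]) (simp only: sk)
  obtain A' where A': "represents A' g" "stack_top c (stack_pop c (stack c p)) = A'"
    "stack_pop c (stack_pop c (stack c p)) = stack c (p + length (12 # enc_nat n @ enc_nat m) + length (enc_fctl f) + length (enc_fctl g))"
    by (rule evaluatedE[OF assms(3,5) d4]) (simp only: A(3))
  show thesis
    by (rule that[OF A(1) A'(1) mB at(2,3) n(1) m(1) A(2) A'(2)]) (simp add: A'(3) add.assoc)
qed

text \<open>A path formula has no stack value of its own, so in the mutual induction it only hands
  on the claims for its operands.\<close>

lemma evaluated_all:
  "evaluated f"
  "case b of Next f \<Rightarrow> evaluated f | Until f n m g \<Rightarrow> evaluated f \<and> evaluated g"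
proof (induction f and b)
  case (Prop a)
  show ?case unfolding evaluated_def
  proof (intro allI impI, elim conjE)
    fix p ys assume d: "drop p x = enc_fctl (Prop a) @ ys"
    then have d1: "drop p x = 6 # enc_nat a @ ys" by simp
    note at = at_Cons[OF d1]
    have "stack c (Suc p) = stack c (Suc p + length (enc_nat a))"
      by (rule stack_skip[OF at(4)]) (use enc_nat_symbols[of a] in auto)
    moreover have "num c (Suc p) = a" using at_nat[OF at(4)] at(1) by simp
    moreover have "p + length (enc_fctl (Prop a)) \<le> L" using at_le[OF d] by simp
    ultimately have "stack c p = set_prop c a + B * stack c (p + length (enc_fctl (Prop a)))"
      using at(1-3) ops_less(1)[of a] push_stack[OF at(1) ops_less(1)]
      by (simp add: stack_rec stack_step_def Let_def)
    then show "\<exists>A. represents A (Prop a) \<and> stack c p = A + B * stack c (p + length (enc_fctl (Prop a)))"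
      using rep_prop by blast
  qed
next
  case (And f g)
  show ?case unfolding evaluated_def
  proof (intro allI impI, elim conjE)
    fix p ys assume wf': "fctl_wf (And f g)" and d: "drop p x = enc_fctl (And f g) @ ys"
    then have d1: "drop p x = 7 # enc_fctl f @ (enc_fctl g @ ys)" by simp
    note at = at_Cons[OF d1]
    let ?q = "Suc p + length (enc_fctl f)"
    obtain A where A: "represents A f" "stack_top c (stack c (Suc p)) = A" "stack_pop c (stack c (Suc p)) = stack c ?q"
      by (rule evaluatedE[OF And.IH(1) _ at(4)]) (use wf' in simp)
    obtain A' where A': "represents A' g" "stack_top c (stack c ?q) = A'"
      "stack_pop c (stack c ?q) = stack c (?q + length (enc_fctl g))"
      by (rule evaluatedE[OF And.IH(2) _ drop_append_at[OF at(4)]]) (use wf' in simp)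
    have l: "p + length (enc_fctl (And f g)) \<le> L" using at_le[OF d] by simp
    have "stack c p = set_and c A A' + B * stack c (p + length (enc_fctl (And f g)))"
      using at(1-3) A A' l push_stack[OF at(1) ops_less(2)]
      by (simp add: stack_rec stack_step_def Let_def add.assoc)
    then show "\<exists>A. represents A (And f g) \<and> stack c p = A + B * stack c (p + length (enc_fctl (And f g)))"
      using rep_and A A' by blast
  qed
next
  case (Neg f)
  show ?case unfolding evaluated_def
  proof (intro allI impI, elim conjE)
    fix p ys assume wf': "fctl_wf (Neg f)" and d: "drop p x = enc_fctl (Neg f) @ ys"
    then have d1: "drop p x = 8 # enc_fctl f @ ys" by simp
    note at = at_Cons[OF d1]
    let ?q = "Suc p + length (enc_fctl f)"
    obtain A where A: "represents A f" "stack_top c (stack c (Suc p)) = A" "stack_pop c (stack c (Suc p)) = stack c ?q"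
      by (rule evaluatedE[OF Neg.IH _ at(4)]) (use wf' in simp)
    have l: "p + length (enc_fctl (Neg f)) \<le> L" using at_le[OF d] by simp
    have "stack c p = set_not c A + B * stack c (p + length (enc_fctl (Neg f)))"
      using at(1-3) A l push_stack[OF at(1) ops_less(3)]
      by (simp add: stack_rec stack_step_def Let_def)
    then show "\<exists>A. represents A (Neg f) \<and> stack c p = A + B * stack c (p + length (enc_fctl (Neg f)))"
      using rep_not A by blast
  qed
next
  case (Ex b)
  show ?case unfolding evaluated_def
  proof (intro allI impI, elim conjE)
    fix p ys assume wf': "fctl_wf (Ex b)" and d: "drop p x = enc_fctl (Ex b) @ ys"
    have l: "p + length (enc_fctl (Ex b)) \<le> L" using at_le[OF d] by simp
    show "\<exists>A. represents A (Ex b) \<and> stack c p = A + B * stack c (p + length (enc_fctl (Ex b)))"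
    proof (cases b)
      case (Next f)
      then have d1: "drop p x = 9 # 11 # enc_fctl f @ ys" and f: "evaluated f" "fctl_wf f"
        using d wf' Ex.IH by simp_all
      note at = at_Cons[OF d1]
      obtain A where A: "represents A f" "inp (fst c) (Suc p) = 11" "stack_top c (stack c (Suc p)) = A"
        "stack_pop c (stack c (Suc p)) = stack c (Suc p + length (11 # enc_fctl f))"
        by (rule next_operand[OF at(4) f])
      have "stack c p = set_EX c A + B * stack c (p + length (enc_fctl (Ex b)))"
        using at(1-3) A l push_stack[OF at(1) ops_less(4)] Next
        by (simp add: stack_rec stack_step_def Let_def)
      then show ?thesis using rep_EX A Next by blast
    next
      case (Until f n m g)
      then have d1: "drop p x = 9 # 12 # enc_nat n @ enc_nat m @ enc_fctl f @ enc_fctl g @ ys"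
        and fg: "evaluated f" "evaluated g" "fctl_wf f" "fctl_wf g" "n \<le> m"
        using d wf' Ex.IH by simp_all
      note at = at_Cons[OF d1]
      obtain A A' where A: "represents A f" "represents A' g" "m < B" "inp (fst c) (Suc p) = 12"
        "csuc c (Suc p) = Suc (Suc p)" "num c (Suc (Suc p)) = n" "num c (nxt c (Suc (Suc p))) = m"
        "stack_top c (stack c (Suc p)) = A" "stack_top c (stack_pop c (stack c (Suc p))) = A'"
        "stack_pop c (stack_pop c (stack c (Suc p))) =
           stack c (Suc p + length (12 # enc_nat n @ enc_nat m @ enc_fctl f @ enc_fctl g))"
        by (rule until_operands[OF at(4) fg(1-4)])
      have "stack c p = set_EU c A n m A' + B * stack c (p + length (enc_fctl (Ex b)))"
        using at(1-3) A l push_stack[OF at(1) ops_less(6)] Until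
        by (simp add: stack_rec stack_step_def Let_def)
      then show ?thesis using rep_EU[OF A(1,2) fg(5) A(3)] Until by blast
    qed
  qed
next
  case (All b)
  show ?case unfolding evaluated_def
  proof (intro allI impI, elim conjE)
    fix p ys assume wf': "fctl_wf (All b)" and d: "drop p x = enc_fctl (All b) @ ys"
    have l: "p + length (enc_fctl (All b)) \<le> L" using at_le[OF d] by simp
    show "\<exists>A. represents A (All b) \<and> stack c p = A + B * stack c (p + length (enc_fctl (All b)))"
    proof (cases b)
      case (Next f)
      then have d1: "drop p x = 10 # 11 # enc_fctl f @ ys" and f: "evaluated f" "fctl_wf f"
        using d wf' All.IH by simp_all
      note at = at_Cons[OF d1]
      obtain A where A: "represents A f" "inp (fst c) (Suc p) = 11" "stack_top c (stack c (Suc p)) = A"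
        "stack_pop c (stack c (Suc p)) = stack c (Suc p + length (11 # enc_fctl f))"
        by (rule next_operand[OF at(4) f])
      have "stack c p = set_AX c A + B * stack c (p + length (enc_fctl (All b)))"
        using at(1-3) A l push_stack[OF at(1) ops_less(5)] Next
        by (simp add: stack_rec stack_step_def Let_def)
      then show ?thesis using rep_AX A Next by blast
    next
      case (Until f n m g)
      then have d1: "drop p x = 10 # 12 # enc_nat n @ enc_nat m @ enc_fctl f @ enc_fctl g @ ys"
        and fg: "evaluated f" "evaluated g" "fctl_wf f" "fctl_wf g" "n \<le> m"
        using d wf' All.IH by simp_all
      note at = at_Cons[OF d1]
      obtain A A' where A: "represents A f" "represents A' g" "m < B" "inp (fst c) (Suc p) = 12"
        "csuc c (Suc p) = Suc (Suc p)" "num c (Suc (Suc p)) = n" "num c (nxt c (Suc (Suc p))) = m"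
        "stack_top c (stack c (Suc p)) = A" "stack_top c (stack_pop c (stack c (Suc p))) = A'"
        "stack_pop c (stack_pop c (stack c (Suc p))) =
           stack c (Suc p + length (12 # enc_nat n @ enc_nat m @ enc_fctl f @ enc_fctl g))"
        by (rule until_operands[OF at(4) fg(1-4)])
      have "stack c p = set_AU c A n m A' + B * stack c (p + length (enc_fctl (All b)))"
        using at(1-3) A l push_stack[OF at(1) ops_less(7)] Until
        by (simp add: stack_rec stack_step_def Let_def)
      then show ?thesis using rep_AU[OF A(1,2) fg(5) A(3)] Until by blast
    qed
  qed
qed simp_all

lemma verdict_correct:
  assumes "fctl_wf phi" shows "verdict c \<longleftrightarrow> models K phi"
proof -
  have d: "drop 0 x = enc_kripke K @ enc_fctl phi" by (simp add: x_enc enc_input_def)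
  have "stack c 0 = stack c (0 + length (enc_kripke K))"
    by (rule stack_skip[OF d]) (use enc_kripke_symbols[of K] in auto)
  moreover have "drop (0 + length (enc_kripke K)) x = enc_fctl phi @ []" using drop_append_at[OF d] by simp
  ultimately obtain A s where A: "represents A phi" "stack c 0 = A + B * s"
    using evaluated_all(1)[of phi] assms unfolding evaluated_def by metis
  have init: "kinit K < N" using wf by (simp add: kripke_wf_def)
  have "stack_top c (stack c 0) = A" using top_pop A by (auto simp: represents_def)
  then show ?thesis using A init
    by (auto simp: verdict_def models_st represents_def initial_eq live_mem liv_def)
qed

end

section \<open>Time bound\<close>

text \<open>Register 0 alone has no ceiling. Its old value is copied first, because a loop must not
  modify its own bound.\<close>

definition double :: com where
  "double = Seq (copy 3 0 4) (For 4 3 (Inc 0))"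

lemma double:
  "wfc double" "mods double = {0, 3, 4}" "bounded s \<Longrightarrow> exec x double s 0 = 2 * s 0"
proof -
  have cp: "wfc (copy 3 0 4)" "mods (copy 3 0 4) = {3, 4}"
    "bounded s \<Longrightarrow> exec x (copy 3 0 4) s 3 = s 0" for s x
    using copy[of 3 4 0] by auto
  have wf: "wfc (For 4 3 (Inc 0))" by simp
  show "wfc double" "mods double = {0, 3, 4}" using cp by (auto simp: double_def)
  assume s: "bounded s"
  define z where "z = exec x (copy 3 0 4) s"
  have z: "bounded z" "z 3 = s 0" "z 0 = s 0"
    using cp s exec_bounded[OF cp(1) s] exec_frame[of 0 "copy 3 0 4" x s] by (auto simp: z_def)
  obtain G where G: "exec x (For 4 3 (Inc 0)) z = G (z 3)" "G 0 = z(4 := 0)"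
    "\<And>k. G (Suc k) = bump 4 (exec x (Inc 0) (G k))"
    by (rule For_unroll[OF wf z(1)]) blast
  have "G k 0 = s 0 + k" for k
    by (induction k) (simp_all add: G(2,3) z bump_def)
  then show "exec x double s 0 = 2 * s 0" using G(1) z by (simp add: double_def z_def)
qed

text \<open>Nesting \<open>j\<close> loops over the unchanged register 2 around the doubling gives
  \<open>s 2 ^ j\<close> doublings.\<close>

primrec grow :: "nat \<Rightarrow> com" where
  "grow 0 = double"
| "grow (Suc j) = For (5 + j) 2 (grow j)"

lemma grow_mods: "mods (grow j) \<subseteq> {0, 3, 4} \<union> {5..<5 + j}"
  by (induction j) (auto simp: double)

lemma grow_wf: "wfc (grow j)"
  using grow_mods by (induction j) (fastforce simp: double)+

lemma grow: "bounded s \<Longrightarrow> exec x (grow j) s 0 = s 0 * 2 ^ (s 2 ^ j)"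
proof (induction j arbitrary: s)
  case 0
  then show ?case by (simp add: double mult.commute)
next
  case (Suc j)
  have wf: "wfc (For (5 + j) 2 (grow j))" using grow_wf[of "Suc j"] by simp
  obtain G where G: "exec x (For (5 + j) 2 (grow j)) s = G (s 2)" "G 0 = s(5 + j := 0)"
    "\<And>k. G (Suc k) = bump (5 + j) (exec x (grow j) (G k))" "\<And>k. bounded (G k)"
    "\<And>k q. q \<notin> mods (grow j) \<Longrightarrow> q \<noteq> 5 + j \<Longrightarrow> G k q = s q"
    by (rule For_unroll[OF wf Suc.prems]) blast
  note IH = Suc.IH
  have "2 \<notin> mods (grow j)" using grow_mods[of j] by auto
  then have G2: "G k 2 = s 2" for k using G(5)[of 2 k] by simp
  have "G k 0 = s 0 * 2 ^ (s 2 ^ j * k)" for k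
  proof (induction k)
    case 0
    then show ?case by (simp add: G(2))
  next
    case (Suc k')
    have "exec x (grow j) (G k') 0 = G k' 0 * 2 ^ (s 2 ^ j)"
      using IH[OF G(4)] G2 by simp
    then show ?case using Suc by (simp add: G(3) power_add mult_ac)
  qed
  then show ?case using G(1) by (simp add: mult.commute)
qed

text \<open>Register 2 remembers the original wall, the input length, while register 0 grows. The
  four nested loops produce the exponent \<open>l ^ 4\<close>.\<close>

definition widen :: com where
  "widen = Seq (copy 2 0 3) (grow 4)"

lemma widen:
  assumes "bounded s"
  shows "wfc widen" "exec x widen s 0 = s 0 * 2 ^ (s 0 ^ 4)"
proof -
  have cp: "wfc (copy 2 0 3)" "mods (copy 2 0 3) = {2, 3}"
    "bounded s \<Longrightarrow> exec x (copy 2 0 3) s 2 = s 0" for s x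
    using copy[of 2 3 0] by auto
  show "wfc widen" using cp grow_wf by (simp add: widen_def)
  have "exec x (copy 2 0 3) s 0 = s 0" using cp by (simp add: exec_frame)
  then show "exec x widen s 0 = s 0 * 2 ^ (s 0 ^ 4)"
    using cp(3)[OF assms, of x] exec_bounded[OF cp(1) assms, of x] grow[of "exec x (copy 2 0 3) s" x 4]
    by (simp add: widen_def)
qed

text \<open>A polynomial of fixed degree in \<open>W\<close> is 2 to a polynomial in
  \<open>l\<close>. The base \<open>l + 2\<close> is at least 3 and thereby absorbs constant factors
  into the exponent.\<close>

lemma time_bound:
  fixes l W d :: nat
  assumes l: "0 < l" and W: "W = l * 2 ^ (l ^ 4)"
  shows "2 * l + 2 + ((W + 5) ^ d + 1) * (2 * W + 5) \<le> 2 ^ ((l + 2) ^ (d + 8))"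
proof -
  define X where "X = W + 5"
  have lW: "l \<le> W" by (simp add: W)
  have X: "5 \<le> X" by (simp add: X_def)
  then have P: "1 \<le> X ^ d" by simp
  have "2 * l + 2 + (X ^ d + 1) * (2 * W + 5) \<le> 2 * X + (X ^ d + 1) * (2 * X)"
    using lW by (intro add_mono mult_left_mono) (auto simp: X_def)
  also have "\<dots> \<le> 6 * (X * X ^ d)"
  proof -
    have "X * 1 \<le> X * X ^ d" using P by (intro mult_left_mono) auto
    then show ?thesis by (simp add: algebra_simps)
  qed
  also have "\<dots> \<le> X * X * (X * X ^ d)"
    using mult_mono[of 5 X 5 X] X by (intro mult_right_mono) auto
  also have "\<dots> = X ^ (d + 3)" by (simp add: numeral_3_eq_3)
  finally have T: "2 * l + 2 + ((W + 5) ^ d + 1) * (2 * W + 5) \<le> X ^ (d + 3)" by (simp add: X_def)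
  have W1: "1 \<le> W" using l by (simp add: W)
  have "X \<le> 2 ^ 3 * W" using W1 by (simp add: X_def)
  also have "\<dots> \<le> 2 ^ 3 * (2 ^ l * 2 ^ (l ^ 4))"
    unfolding W by (intro mult_left_mono mult_right_mono) (auto intro: less_imp_le less_exp)
  also have "\<dots> = 2 ^ (3 + l + l ^ 4)" by (simp add: power_add)
  also have "\<dots> \<le> 2 ^ ((l + 2) ^ 5)"
  proof (rule power_increasing)
    let ?Y = "(l + 2) ^ 4"
    have Y: "l ^ 4 \<le> ?Y" by (intro power_mono) auto
    have "(l + 2) ^ 1 \<le> ?Y" by (intro power_increasing) auto
    then have "l + 2 \<le> ?Y" by (simp only: power_one_right)
    then have "3 + l + l ^ 4 \<le> 3 * ?Y" using Y l by linarith
    also have "\<dots> \<le> (l + 2) * ?Y" using l by (intro mult_right_mono) auto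
    also have "\<dots> = (l + 2) ^ 5" by (simp add: eval_nat_numeral)
    finally show "3 + l + l ^ 4 \<le> (l + 2) ^ 5" .
  qed simp
  finally have "X ^ (d + 3) \<le> (2 ^ ((l + 2) ^ 5)) ^ (d + 3)" by (intro power_mono) auto
  also have "\<dots> = 2 ^ ((l + 2) ^ 5 * (d + 3))" by (simp add: power_mult)
  also have "\<dots> \<le> 2 ^ ((l + 2) ^ (d + 8))"
  proof (rule power_increasing)
    \<comment> \<open>The factor \<open>d + 3\<close> is itself bounded by a power of
      \<open>l + 2\<close>, whence the exponent \<open>5 + (d + 3) = d + 8\<close>.\<close>
    have "d + 3 < 2 ^ (d + 3)" by (rule less_exp)
    also have "\<dots> \<le> (l + 2) ^ (d + 3)" by (intro power_mono) auto
    finally have "(l + 2) ^ 5 * (d + 3) \<le> (l + 2) ^ 5 * (l + 2) ^ (d + 3)" by (intro mult_left_mono) auto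
    also have "\<dots> = (l + 2) ^ (d + 8)" by (simp add: add.commute flip: power_add)
    finally show "(l + 2) ^ 5 * (d + 3) \<le> (l + 2) ^ (d + 8)" .
  qed simp
  finally show ?thesis using T by linarith
qed

text \<open>Two number terminators and two list terminators are always present; length 4 is what
  makes \<open>9 * l * l \<le> l ^ 4\<close> hold.\<close>

lemma enc_input_length: "4 \<le> length (enc_input K f)"
  by (simp add: enc_input_def enc_kripke_def enc_nat_def enc_list_def)

lemma checker_enc_input:
  assumes "kripke_wf K" and l: "l = length (enc_input K f)" and W: "W = l * 2 ^ (l ^ 4)"
  shows "checker_input (enc_input K f, W) K f"
proof
  have l4: "4 \<le> l" using enc_input_length l by simp
  then have "4 ^ 2 * l ^ 2 \<le> l ^ 2 * l ^ 2" by (intro mult_right_mono power_mono) auto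
  moreover have "9 * l * l \<le> 4 ^ 2 * l ^ 2" by (simp add: power2_eq_square)
  moreover have "l ^ 2 * l ^ 2 = l ^ 4" by (simp flip: power_add)
  ultimately have e: "9 * l * l \<le> l ^ 4" by linarith
  have W2: "2 ^ (l ^ 4) \<le> W" using l4 by (simp add: W)
  show "2 ^ (9 * length (fst (enc_input K f, W)) * length (fst (enc_input K f, W))) \<le> snd (enc_input K f, W)"
    using e W2 unfolding l[symmetric] fst_conv snd_conv by (meson one_le_numeral order_trans power_increasing)
  have "4 \<le> l ^ 4" using e l4 mult_le_mono[of 4 l 1 l] by linarith
  then have "2 ^ 4 \<le> (2::nat) ^ (l ^ 4)" by (intro power_increasing) auto
  then have "16 \<le> W" using W2 by simp
  moreover have "l \<le> W" by (simp add: W)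
  ultimately show "okc (enc_input K f, W)"
    using enc_input_symbols[of _ K f] by (auto simp: okc_def l[symmetric])
  show "0 < length (fst (enc_input K f, W))" using l4 unfolding l fst_conv by linarith
  show "fst (enc_input K f, W) = enc_input K f" by simp
  show "kripke_wf K" by fact
qed

theorem theorem2:
  shows "\<exists>M k. tm_wf M \<and>
    (\<forall>K \<phi>. kripke_wf K \<and> fctl_wf \<phi> \<longrightarrow>
       tm_decides_within M (enc_input K \<phi>) (2 ^ ((length (enc_input K \<phi>) + 2) ^ k))
         (models K \<phi>))"
proof -
  \<comment> \<open>\<open>verdict\<close> reads no variables, so the environment is mapped to the
    zero register; the result goes to register 2, which the machine tests at the end.\<close>
  obtain p where p: "wfc p" "mods p \<subseteq> {2..}"
    "\<And>x s. bounded s \<Longrightarrow> okc (x, s 0) \<Longrightarrow> exec x p s 2 = of_bool (verdict (x, s 0))"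
    by (rule computableE[OF computable_verdict, of 2 "\<lambda>_. 1"]) auto
  let ?p = "Seq widen p"
  have wf: "wfc ?p" using widen(1)[OF init_store_bounded] p by simp
  obtain M where M: "tm_wf M"
    "\<And>x. x \<noteq> [] \<Longrightarrow> \<forall>a\<in>set x. 0 < a \<and> a < 13 \<Longrightarrow> (let s = exec x ?p (init_store x) in
       tm_decides_within M x (2 * length x + 2 + ((s 0 + 5) ^ csize ?p + 1) * (2 * s 0 + 5)) (s 2 \<noteq> 0))"
    using machine_decides[OF wf] by blast
  have "tm_decides_within M (enc_input K f) (2 ^ ((length (enc_input K f) + 2) ^ (csize ?p + 8))) (models K f)"
    if K: "kripke_wf K" and f: "fctl_wf f" for K f
  proof -
    define x where enc: "x = enc_input K f"
    define W where W: "W = length x * 2 ^ (length x ^ 4)"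
    define s where "s = exec x widen (init_store x)"
    define t where "t = exec x ?p (init_store x)"
    have s: "bounded s" "s 0 = W"
      using widen[OF init_store_bounded[of x]]
        exec_bounded[OF widen(1)[OF init_store_bounded[of x]] init_store_bounded[of x], of x]
      by (simp_all add: s_def W init_store_def)
    have x: "x \<noteq> []" "\<forall>a\<in>set x. 0 < a \<and> a < 13"
      using enc_input_length[of K f] enc_input_symbols[of _ K f] by (auto simp: enc)
    have checker: "checker_input (x, W) K f"
      unfolding enc by (rule checker_enc_input[OF K]) (simp_all add: W enc)
    interpret checker_input "(x, W)" "fst (x, W)" "snd (x, W)" "length (fst (x, W))" K f
      by (rule checker)
    have "0 \<notin> mods p" using p(2) by auto
    then have t: "t 0 = W" "t 2 = of_bool (models K f)"
      using s p(3)[OF s(1), of x] exec_frame[of 0 p x s] ok verdict_correct[OF f]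
      by (auto simp: t_def s_def[symmetric])
    from M(2)[OF x] have "tm_decides_within M x (2 * length x + 2 + ((W + 5) ^ csize ?p + 1) * (2 * W + 5)) (models K f)"
      unfolding Let_def t_def[symmetric] t by simp
    moreover have "2 * length x + 2 + ((W + 5) ^ csize ?p + 1) * (2 * W + 5) \<le> 2 ^ ((length x + 2) ^ (csize ?p + 8))"
      by (rule time_bound[OF _ W]) (use x in simp)
    ultimately show ?thesis unfolding tm_decides_within_def enc[symmetric] by (meson order_trans)
  qed
  with M(1) show ?thesis by blast
qed

end
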